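(* Assume hypotheses (A1)–(A9) listed in the context hold. For $\epsilon>0$ let $(u^\epsilon,m^\epsilon)$ be a solution of the regularized system described in the context. Let $\theta>1$, $0\le\upsilon\le 1$, $\beta_0\in\left[1,\frac{d(1+\mu)}{d(1+\mu)-2}\right)$, and set \[ \beta_{\upsilon,\theta}=\frac{\theta\beta_0}{\theta+\upsilon-\theta\upsilon},\qquad r=\frac{d(\theta-1)+2}{2},\qquad p=\frac{\beta_{\upsilon,\theta}}{\alpha}. \] Suppose $p>1$. Then \[ \|g_\epsilon(m^\epsilon)\|_{L^\infty(0,T;L^p(\mathbb{T}^d))}\le C+C\|Du^\epsilon\|_{L^\infty(0,T;L^\infty(\mathbb{T}^d))}^{\frac{(2+2\mu)r\upsilon\alpha}{\theta\beta_0}}, \] where $C$ is independent of $\epsilon$.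
   Context: $\mathbb{T}^d$ is the $d$-dimensional flat torus, $T>0$ fixed. Data: $H:\mathbb{T}^d\times\mathbb{R}^d\to\mathbb{R}$, $g:[0,\infty)\to\mathbb{R}$, $u_T,m_0:\mathbb{T}^d\to\mathbb{R}$. Hypotheses: (A1) $H$ is $C^\infty$; $p\mapsto H(x,p)$ strictly convex; $\lim_{|p|\to\infty}H(x,p)/|p|=+\infty$; $H\ge1$. (A2) $g$ non-negative and increasing; $u_T,m_0\in C^\infty(\mathbb{T}^d)$, $m_0\ge0$, $\int m_0=1$. (A3) With $\hat L(x,p)=D_pH(x,p)\cdot p-H(x,p)$, there are $c,C>0$ with $\hat L\ge cH-C$. (A4) $g(z)=z^\alpha$, $\alpha>0$. (A5) $|D_xH|,|D^2_{xx}H|\le CH+C$, and for every symmetric matrix $M$ and $\delta>0$ there is $C_\delta$ with $\operatorname{tr}(D^2_{px}H M)\le\delta\operatorname{tr}(D^2_{pp}HM^2)+C_\delta H$. (A6) $m_0\ge\kappa_0>0$ for a constant $\kappa_0$. (A7) For some $0<\mu<1$ and non-negative constants: $c_1|p|^{2+\mu}+C_1\le H\le c_2|p|^{2+\mu}+C_2$. (A8) $|D_pH(x,p)|^2\le C|p|^\mu H(x,p)+C$. (A9) $|D^2_{xp}H|^2\le CH^{\frac{2+2\mu}{2+\mu}}$ and, for every symmetric $M$, $|D^2_{pp}HM|^2\le CH^{\frac{\mu}{2+\mu}}\operatorname{tr}(D^2_{pp}HMM)$. Regularized system: $\eta_\epsilon$ is a standard symmetric mollifying kernel on $\mathbb{T}^d$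 and $g_\epsilon(m)=\eta_\epsilon*g(\eta_\epsilon*m)$. A solution is a pair of smooth functions $u^\epsilon,m^\epsilon$ on $\mathbb{T}^d\times[0,T]$ with $-u^\epsilon_t+H(x,Du^\epsilon)=\Delta u^\epsilon+g_\epsilon(m^\epsilon)$, $m^\epsilon_t-\operatorname{div}(D_pH(x,Du^\epsilon)m^\epsilon)=\Delta m^\epsilon$, $u^\epsilon(x,T)=u_T(x)$, $m^\epsilon(x,0)=m_0(x)$. *)

theory Defs
  imports "HOL-Analysis.Analysis"
begin

definition dd :: "('a::real_normed_vector \<Rightarrow> real) \<Rightarrow> 'a \<Rightarrow> 'a \<Rightarrow> real" where
  "dd f v x = deriv (\<lambda>s. f (x + s *\<^sub>R v)) 0"

fun iter_pd :: "'a::euclidean_space list \<Rightarrow> ('a \<Rightarrow> real) \<Rightarrow> 'a \<Rightarrow> real" where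
  "iter_pd [] f = f"
| "iter_pd (v # vs) f = dd (iter_pd vs f) v"

definition smooth_fun :: "('a::euclidean_space \<Rightarrow> real) \<Rightarrow> bool" where
  "smooth_fun f \<longleftrightarrow> (\<forall>vs. set vs \<subseteq> Basis \<longrightarrow>
      continuous_on UNIV (iter_pd vs f) \<and> (\<forall>x. iter_pd vs f differentiable (at x)))"

text \<open>Functions on the flat torus = 1-periodic functions in every coordinate.\<close>
definition periodic :: "(real^'d \<Rightarrow> 'b) \<Rightarrow> bool" where
  "periodic f \<longleftrightarrow> (\<forall>i x. f (x + axis i 1) = f x)"

definition grad :: "(real^'d \<Rightarrow> real) \<Rightarrow> real^'d \<Rightarrow> real^'d" where
  "grad f x = (\<chi> i. dd f (axis i 1) x)"

definition hess :: "(real^'d \<Rightarrow> real) \<Rightarrow> real^'d \<Rightarrow> real^'d^'d" where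
  "hess f x = (\<chi> i j. dd (dd f (axis j 1)) (axis i 1) x)"

definition lap :: "(real^'d \<Rightarrow> real) \<Rightarrow> real^'d \<Rightarrow> real" where
  "lap f x = (\<Sum>i\<in>UNIV. dd (dd f (axis i 1)) (axis i 1) x)"

definition divg :: "(real^'d \<Rightarrow> real^'d) \<Rightarrow> real^'d \<Rightarrow> real" where
  "divg V x = (\<Sum>i\<in>UNIV. dd (\<lambda>y. V y $ i) (axis i 1) x)"

definition DpH :: "(real^'d \<Rightarrow> real^'d \<Rightarrow> real) \<Rightarrow> real^'d \<Rightarrow> real^'d \<Rightarrow> real^'d" where
  "DpH H x p = grad (H x) p"

definition DxH :: "(real^'d \<Rightarrow> real^'d \<Rightarrow> real) \<Rightarrow> real^'d \<Rightarrow> real^'d \<Rightarrow> real^'d" where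
  "DxH H x p = grad (\<lambda>y. H y p) x"

definition D2ppH :: "(real^'d \<Rightarrow> real^'d \<Rightarrow> real) \<Rightarrow> real^'d \<Rightarrow> real^'d \<Rightarrow> real^'d^'d" where
  "D2ppH H x p = hess (H x) p"

definition D2xxH :: "(real^'d \<Rightarrow> real^'d \<Rightarrow> real) \<Rightarrow> real^'d \<Rightarrow> real^'d \<Rightarrow> real^'d^'d" where
  "D2xxH H x p = hess (\<lambda>y. H y p) x"

definition D2pxH :: "(real^'d \<Rightarrow> real^'d \<Rightarrow> real) \<Rightarrow> real^'d \<Rightarrow> real^'d \<Rightarrow> real^'d^'d" where
  "D2pxH H x p = (\<chi> i j. dd (\<lambda>q. dd (\<lambda>y. H y q) (axis j 1) x) (axis i 1) p)"

definition D2xpH :: "(real^'d \<Rightarrow> real^'d \<Rightarrow> real) \<Rightarrow> real^'d \<Rightarrow> real^'d \<Rightarrow> real^'d^'d" where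
  "D2xpH H x p = (\<chi> i j. dd (\<lambda>y. dd (H y) (axis j 1) p) (axis i 1) x)"

definition Lhat :: "(real^'d \<Rightarrow> real^'d \<Rightarrow> real) \<Rightarrow> real^'d \<Rightarrow> real^'d \<Rightarrow> real" where
  "Lhat H x p = DpH H x p \<bullet> p - H x p"

definition strict_convex_fun :: "('a::real_vector \<Rightarrow> real) \<Rightarrow> bool" where
  "strict_convex_fun f \<longleftrightarrow> (\<forall>p q t. p \<noteq> q \<and> 0 < t \<and> t < 1 \<longrightarrow>
      f ((1 - t) *\<^sub>R p + t *\<^sub>R q) < (1 - t) * f p + t * f q)"

definition symmetric_mat :: "real^'d^'d \<Rightarrow> bool" where
  "symmetric_mat M \<longleftrightarrow> transpose M = M"

definition mollifier :: "(real^'d \<Rightarrow> real) \<Rightarrow> bool" where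
  "mollifier \<eta> \<longleftrightarrow> smooth_fun \<eta> \<and> (\<forall>x. 0 \<le> \<eta> x) \<and> (\<forall>x. \<eta> (- x) = \<eta> x) \<and>
     (\<forall>x. norm x > 1 \<longrightarrow> \<eta> x = 0) \<and> integral UNIV \<eta> = 1"

text \<open>Convolution on the torus of a periodic f with the (periodized) kernel
  eta_eps(y) = eps^(-d) eta(y/eps); written as an integral over R^d.\<close>
definition moll :: "(real^'d \<Rightarrow> real) \<Rightarrow> real \<Rightarrow> (real^'d \<Rightarrow> real) \<Rightarrow> real^'d \<Rightarrow> real" where
  "moll \<eta> \<epsilon> f x = integral UNIV
      (\<lambda>y. (1 / \<epsilon> ^ CARD('d)) * \<eta> ((1 / \<epsilon>) *\<^sub>R y) * f (x - y))"

text \<open>g(z) = z^alpha (A4); g_eps(m) = eta_eps * g(eta_eps * m), at a fixed time.\<close>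
definition g_eps :: "(real^'d \<Rightarrow> real) \<Rightarrow> real \<Rightarrow> real \<Rightarrow> (real^'d \<Rightarrow> real) \<Rightarrow> real^'d \<Rightarrow> real" where
  "g_eps \<eta> \<alpha> \<epsilon> m = moll \<eta> \<epsilon> (\<lambda>y. (moll \<eta> \<epsilon> m y) powr \<alpha>)"

definition torus_cell :: "(real^'d) set" where
  "torus_cell = cbox 0 One"

text \<open>u, m : R^d x R -> R, smooth_fun (jointly in (x,t)), 1-periodic in x; the equations
  hold for t in [0,T] (smoothness on T^d x [0,T] = existence of a smooth_fun extension).\<close>
definition reg_solution ::
  "(real^'d \<Rightarrow> real^'d \<Rightarrow> real) \<Rightarrow> (real^'d \<Rightarrow> real) \<Rightarrow> real \<Rightarrow> real \<Rightarrow> real \<Rightarrow>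
   (real^'d \<Rightarrow> real) \<Rightarrow> (real^'d \<Rightarrow> real) \<Rightarrow>
   (real^'d \<Rightarrow> real \<Rightarrow> real) \<Rightarrow> (real^'d \<Rightarrow> real \<Rightarrow> real) \<Rightarrow> bool" where
  "reg_solution H \<eta> \<alpha> T \<epsilon> uT m0 u m \<longleftrightarrow>
     smooth_fun (\<lambda>z::(real^'d) \<times> real. u (fst z) (snd z)) \<and>
     smooth_fun (\<lambda>z::(real^'d) \<times> real. m (fst z) (snd z)) \<and>
     (\<forall>t. periodic (\<lambda>x. u x t)) \<and> (\<forall>t. periodic (\<lambda>x. m x t)) \<and>
     (\<forall>x. \<forall>t\<in>{0..T}.
        - deriv (\<lambda>s. u x s) t + H x (grad (\<lambda>y. u y t) x)
          = lap (\<lambda>y. u y t) x + g_eps \<eta> \<alpha> \<epsilon> (\<lambda>y. m y t) x) \<and>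
     (\<forall>x. \<forall>t\<in>{0..T}.
        deriv (\<lambda>s. m x s) t - divg (\<lambda>y. m y t *\<^sub>R DpH H y (grad (\<lambda>z. u z t) y)) x
          = lap (\<lambda>y. m y t) x) \<and>
     (\<forall>x. u x T = uT x) \<and> (\<forall>x. m x 0 = m0 x)"

end

theory Submission
  imports Defs
begin

text \<open>
  Write \<open>b = D\<^sub>pH(x, Du)\<close>. Testing the first equation with \<open>m\<close> and with time-independent positive
  weights bounds \<open>\<integral>\<integral> H m\<close>; applying the Laplacian to it and testing with \<open>m\<close> bounds
  \<open>\<integral>\<integral> tr(D\<^sub>p\<^sub>pH (D\<^sup>2u)\<^sup>2) m\<close>, because \<open>\<integral> m \<Delta>g\<^sub>\<epsilon>(m) \<le> 0\<close>. With
  \<open>E = H + tr(D\<^sub>p\<^sub>pH (D\<^sup>2u)\<^sup>2)\<close>, (A9) gives \<open>\<bar>div b\<bar> \<le> C E powr ((1+\<mu>)/(2+\<mu>))\<close>. Inserted into the evolution of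
  \<open>\<integral> m powr \<beta>0\<close> and combined with the Gagliardo--Nirenberg inequality for \<open>m powr (\<beta>0/2)\<close>, this
  closes a linear Gronwall inequality exactly in the stated range of \<open>\<beta>0\<close>. In the evolution of
  \<open>\<integral> m powr (\<theta>\<beta>0)\<close> one uses instead \<open>\<bar>b\<bar>\<^sup>2 \<le> C (1 + \<parallel>Du\<parallel> powr (2+2\<mu>))\<close> and interpolates against the
  bound for \<open>\<beta>0\<close>, which produces the exponent \<open>r\<close>. Interpolation between \<open>\<beta>0\<close> and \<open>\<theta>\<beta>0\<close> and Jensen's
  inequality for the two mollifications finish the argument. The Gagliardo--Nirenberg inequality on
  the torus comes from a Loomis--Whitney inequality, obtained by averaging one coordinate at a time.
\<close>

subsection \<open>Smooth functions\<close>

text \<open>The bounds on \<open>E\<close> that are uniform in \<epsilon> are space-time integrals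
  against \<open>m\<close>. So \<open>A(t)\<close>, the integral of \<open>E m\<close> over the
  torus, is only known to be integrable in time and may enter a Gronwall inequality at most to the
  first power. Hoelder bounds the integral of \<open>E powr l * m powr \<beta>\<close>,
  \<open>l = (1+\<mu>)/(2+\<mu>)\<close>, by \<open>A powr l\<close> times a power of the integral
  of \<open>m powr q\<close>, \<open>q = 1 + (2+\<mu>)(\<beta>-1)\<close>; interpolating
  \<open>q\<close> between \<beta> and \<beta>(1+2/d) uses the weight
  \<open>\<sigma> = d(1+\<mu>)(\<beta>-1)/(2\<beta>)\<close>. After absorption into the dissipation
  \<open>A\<close> carries the exponent \<open>(1+\<mu>)/(2+\<mu>-\<sigma>)\<close>, which is at
  most 1 exactly when \<sigma> \<le> 1; \<sigma> < 1 is the stated range of \<beta>0. For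
  \<theta>\<beta>0, which may leave that range, the drift has the coefficient
  \<open>R = 1 + \<parallel>Du\<parallel> powr (2+2\<mu>)\<close>. Interpolation against \<beta>0
  bounds the integral of \<open>m powr (\<theta>\<beta>0)\<close> by a multiple of the power
  \<open>1 - 1/r\<close> of its sum with the dissipation, and Young's inequality then yields
  \<open>R powr r\<close>.\<close>

lemma dd_eqI:
  assumes "(f has_derivative f') (at x)"
  shows "dd f v x = f' v"
proof -
  have f: "(f has_derivative f') (at (x + 0 *\<^sub>R v))" using assms by simp
  have "((\<lambda>s. f (x + s *\<^sub>R v)) has_derivative (\<lambda>s. f' (s *\<^sub>R v))) (at 0)"
    by (rule has_derivative_compose[where f="\<lambda>s. x + s *\<^sub>R v" and x=0 and g=f, OF _ f])
       (auto intro!: derivative_eq_intros)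
  moreover have "(\<lambda>s. f' (s *\<^sub>R v)) = (*) (f' v)"
    by (auto simp: linear_cmul[OF has_derivative_linear[OF assms]])
  ultimately have "((\<lambda>s. f (x + s *\<^sub>R v)) has_real_derivative f' v) (at 0)"
    by (simp add: has_field_derivative_def)
  then show ?thesis unfolding dd_def by (rule DERIV_imp_deriv)
qed

lemma differentiable_has_derivative_dd:
  fixes f :: "'a::real_normed_vector \<Rightarrow> real"
  assumes "f differentiable (at x)"
  shows "(f has_derivative (\<lambda>v. dd f v x)) (at x)"
proof -
  obtain f' where f': "(f has_derivative f') (at x)"
    using assms by (auto simp: differentiable_def)
  then have "(\<lambda>v. dd f v x) = f'" by (auto simp: dd_eqI)
  with f' show ?thesis by simp
qed

lemma smooth_fun_differentiable: "smooth_fun f \<Longrightarrow> f differentiable (at x)"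
  unfolding smooth_fun_def by (metis empty_set empty_subsetI iter_pd.simps(1))

lemma smooth_fun_has_derivative:
  "smooth_fun f \<Longrightarrow> (f has_derivative (\<lambda>v. dd f v x)) (at x)"
  by (intro differentiable_has_derivative_dd smooth_fun_differentiable)

lemma iter_pd_dd: "iter_pd vs (dd f b) = iter_pd (vs @ [b]) f"
  by (induction vs) auto

lemma smooth_fun_dd: "smooth_fun f \<Longrightarrow> b \<in> Basis \<Longrightarrow> smooth_fun (dd f b)"
  unfolding smooth_fun_def iter_pd_dd by auto

lemma smooth_fun_continuous_on: "smooth_fun f \<Longrightarrow> continuous_on S f"
  by (meson continuous_at_imp_continuous_on differentiable_imp_continuous_within smooth_fun_differentiable)

text \<open>Iterated partial derivatives never leave a class \<open>P\<close> that is closed under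
  them, and differentiability of each member gives continuity. So it suffices to describe a single
  differentiation, without induction over lists of directions.\<close>

lemma smooth_fun_coinduct:
  assumes "P f"
    and diff: "\<And>f x. P f \<Longrightarrow> f differentiable (at x)"
    and step: "\<And>f b. P f \<Longrightarrow> b \<in> Basis \<Longrightarrow> P (dd f b)"
  shows "smooth_fun f"
proof -
  have "P (iter_pd vs f)" if "set vs \<subseteq> Basis" for vs
    using that by (induction vs) (auto simp: \<open>P f\<close> step)
  then show ?thesis unfolding smooth_fun_def
    by (metis continuous_at_imp_continuous_on diff differentiable_imp_continuous_within)
qed

lemma dd_const: "dd (\<lambda>x. c) v = (\<lambda>x. 0)"
  by (auto intro!: dd_eqI ext)

lemma smooth_fun_const: "smooth_fun (\<lambda>x. c)"
  by (rule smooth_fun_coinduct[where P="\<lambda>f. \<exists>c. f = (\<lambda>x. c)"])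
     (auto simp: dd_const)

lemma smooth_fun_linear:
  assumes "bounded_linear f"
  shows "smooth_fun f"
proof (rule smooth_fun_coinduct[where P="\<lambda>f. bounded_linear f \<or> (\<exists>c. f = (\<lambda>x. c))"])
  fix f :: "'a \<Rightarrow> real" and b :: 'a
  assume f: "bounded_linear f \<or> (\<exists>c. f = (\<lambda>x. c))"
  then show "f differentiable at x" for x by (auto simp: bounded_linear_imp_differentiable)
  have "dd f b = (\<lambda>x. f b)" if "bounded_linear f"
    using that by (auto intro!: ext dd_eqI bounded_linear_imp_has_derivative)
  then show "bounded_linear (dd f b) \<or> (\<exists>c. dd f b = (\<lambda>x. c))"
    using f by (auto simp: dd_const)
qed (use assms in auto)

lemma dd_add:
  assumes "f differentiable (at x)" "g differentiable (at x)"
  shows "dd (\<lambda>x. f x + g x) v x = dd f v x + dd g v x"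
  by (rule dd_eqI) (intro derivative_intros differentiable_has_derivative_dd assms)

lemma dd_mult:
  fixes f g :: "'a::real_normed_vector \<Rightarrow> real"
  assumes "f differentiable (at x)" "g differentiable (at x)"
  shows "dd (\<lambda>x. f x * g x) v x = f x * dd g v x + dd f v x * g x"
  using dd_eqI[OF has_derivative_mult[OF assms[THEN differentiable_has_derivative_dd]]] by simp

lemma has_derivative_compose_dd:
  fixes F :: "'b::euclidean_space \<Rightarrow> real" and \<Phi> :: "'a::real_normed_vector \<Rightarrow> 'b"
  assumes F: "F differentiable (at (\<Phi> x))"
    and \<Phi>: "\<And>c. c \<in> Basis \<Longrightarrow> (\<lambda>y. \<Phi> y \<bullet> c) differentiable (at x)"
  shows "((\<lambda>y. F (\<Phi> y)) has_derivative
          (\<lambda>v. \<Sum>c\<in>Basis. dd F c (\<Phi> x) * dd (\<lambda>y. \<Phi> y \<bullet> c) v x)) (at x)"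
proof -
  let ?\<Phi>' = "\<lambda>v. \<Sum>c\<in>Basis. dd (\<lambda>y. \<Phi> y \<bullet> c) v x *\<^sub>R c"
  have "(\<Phi> has_derivative ?\<Phi>') (at x)"
    by (subst has_derivative_componentwise_within)
       (auto intro!: differentiable_has_derivative_dd \<Phi> simp: inner_sum_left inner_Basis if_distrib cong: if_cong)
  from has_derivative_compose[OF this differentiable_has_derivative_dd[OF F]]
  have "((\<lambda>y. F (\<Phi> y)) has_derivative (\<lambda>v. dd F (?\<Phi>' v) (\<Phi> x))) (at x)" .
  moreover have L: "linear (\<lambda>v. dd F v (\<Phi> x))"
    by (rule has_derivative_linear[OF differentiable_has_derivative_dd[OF F]])
  have "dd F (?\<Phi>' v) (\<Phi> x) = (\<Sum>c\<in>Basis. dd F c (\<Phi> x) * dd (\<lambda>y. \<Phi> y \<bullet> c) v x)" for v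
    by (simp add: linear_sum[OF L] linear_cmul[OF L] mult.commute)
  ultimately show ?thesis by simp
qed

lemmas dd_compose = has_derivative_compose_dd[THEN dd_eqI]

inductive smooth_gen :: "('a::euclidean_space \<Rightarrow> 'b::euclidean_space) \<Rightarrow> ('a \<Rightarrow> real) \<Rightarrow> bool" for \<Phi> where
  smooth: "smooth_fun f \<Longrightarrow> smooth_gen \<Phi> f"
| compose: "smooth_fun F \<Longrightarrow> smooth_gen \<Phi> (\<lambda>x. F (\<Phi> x))"
| add: "smooth_gen \<Phi> f \<Longrightarrow> smooth_gen \<Phi> g \<Longrightarrow> smooth_gen \<Phi> (\<lambda>x. f x + g x)"
| mult: "smooth_gen \<Phi> f \<Longrightarrow> smooth_gen \<Phi> g \<Longrightarrow> smooth_gen \<Phi> (\<lambda>x. f x * g x)"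

text \<open>The functions generated by sums, products and composition are closed under partial
  derivatives, so coinduction applies to the whole class at once.\<close>
lemma smooth_gen_imp_smooth_fun:
  assumes "smooth_gen \<Phi> f" and \<Phi>: "\<And>c. c \<in> Basis \<Longrightarrow> smooth_fun (\<lambda>x. \<Phi> x \<bullet> c)"
  shows "smooth_fun f"
proof (rule smooth_fun_coinduct[where P="smooth_gen \<Phi>"])
  have sum: "smooth_gen \<Phi> (\<lambda>x. \<Sum>c\<in>A. h c x)"
    if "finite A" "\<And>c. c \<in> A \<Longrightarrow> smooth_gen \<Phi> (h c)" for A :: "'b set" and h
    using that by (induction A) (auto intro: smooth_gen.intros smooth_fun_const)
  have main: "(\<forall>x. f differentiable (at x)) \<and> (\<forall>b\<in>Basis. smooth_gen \<Phi> (dd f b))"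
    if "smooth_gen \<Phi> f" for f
    using that
  proof induction
    case (smooth f)
    then show ?case by (auto intro: smooth_gen.intros smooth_fun_differentiable smooth_fun_dd)
  next
    case (compose F)
    have d: "(\<lambda>y. \<Phi> y \<bullet> c) differentiable (at x)" if "c \<in> Basis" for c x
      by (intro smooth_fun_differentiable \<Phi> that)
    have F: "F differentiable (at y)" for y by (intro smooth_fun_differentiable compose)
    have "(\<lambda>x. F (\<Phi> x)) differentiable (at x)" for x
      using has_derivative_compose_dd[where F=F and \<Phi>=\<Phi>, OF F d] unfolding differentiable_def by blast
    moreover have "dd (\<lambda>x. F (\<Phi> x)) b = (\<lambda>x. \<Sum>c\<in>Basis. dd F c (\<Phi> x) * dd (\<lambda>y. \<Phi> y \<bullet> c) b x)" for b
      by (intro ext dd_compose F d)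
    moreover have "smooth_gen \<Phi> (\<lambda>x. \<Sum>c\<in>Basis. dd F c (\<Phi> x) * dd (\<lambda>y. \<Phi> y \<bullet> c) b x)" if "b \<in> Basis" for b
      by (rule sum) (auto intro!: smooth_gen.mult smooth_gen.compose[of "dd F _"] smooth_gen.smooth[of "dd _ _"]
            smooth_fun_dd compose \<Phi> that)
    ultimately show ?case by auto
  next
    case (add f g)
    then have "dd (\<lambda>x. f x + g x) b = (\<lambda>x. dd f b x + dd g b x)" for b
      by (intro ext dd_add) auto
    with add show ?case by (auto intro: smooth_gen.intros)
  next
    case (mult f g)
    then have "dd (\<lambda>x. f x * g x) b = (\<lambda>x. f x * dd g b x + dd f b x * g x)" for b
      by (intro ext dd_mult) auto
    with mult show ?case by (auto intro!: smooth_gen.add smooth_gen.mult)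
  qed
  show "f differentiable at x" if "smooth_gen \<Phi> f" for f x using main[OF that] by auto
  show "smooth_gen \<Phi> (dd f b)" if "smooth_gen \<Phi> f" "b \<in> Basis" for f b using main[OF that(1)] that(2) by auto
qed fact

lemma smooth_fun_inner_left: "smooth_fun (\<lambda>x::'a::euclidean_space. x \<bullet> c)"
  by (intro smooth_fun_linear bounded_linear_inner_left)

lemma smooth_fun_add: "smooth_fun f \<Longrightarrow> smooth_fun g \<Longrightarrow> smooth_fun (\<lambda>x. f x + g x)"
  by (rule smooth_gen_imp_smooth_fun[where \<Phi>="\<lambda>x. x"]) (auto intro: smooth_gen.intros smooth_fun_inner_left)

lemma smooth_fun_mult: "smooth_fun f \<Longrightarrow> smooth_fun g \<Longrightarrow> smooth_fun (\<lambda>x. f x * g x)"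
  by (rule smooth_gen_imp_smooth_fun[where \<Phi>="\<lambda>x. x"]) (auto intro: smooth_gen.intros smooth_fun_inner_left)

lemma smooth_fun_compose:
  "smooth_fun F \<Longrightarrow> (\<And>c. c \<in> Basis \<Longrightarrow> smooth_fun (\<lambda>x. \<Phi> x \<bullet> c)) \<Longrightarrow> smooth_fun (\<lambda>x. F (\<Phi> x))"
  by (rule smooth_gen_imp_smooth_fun[where \<Phi>=\<Phi>]) (auto intro: smooth_gen.intros)

lemma smooth_fun_diff: "smooth_fun f \<Longrightarrow> smooth_fun g \<Longrightarrow> smooth_fun (\<lambda>x. f x - g x)"
  using smooth_fun_add[of f "\<lambda>x. (-1) * g x"] smooth_fun_mult[of "\<lambda>_. -1" g] smooth_fun_const by auto

lemma smooth_fun_uminus: "smooth_fun f \<Longrightarrow> smooth_fun (\<lambda>x. - f x)"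
  using smooth_fun_mult[of "\<lambda>_. -1" f] smooth_fun_const by auto

lemma smooth_fun_sum: "(\<And>i. i \<in> A \<Longrightarrow> smooth_fun (f i)) \<Longrightarrow> smooth_fun (\<lambda>x. \<Sum>i\<in>A. f i x)"
  by (induction A rule: infinite_finite_induct) (auto intro: smooth_fun_const smooth_fun_add)

lemmas smooth_fun_intros = smooth_fun_const smooth_fun_add smooth_fun_mult smooth_fun_diff
  smooth_fun_uminus smooth_fun_sum

lemma smooth_fun_has_field_derivative:
  assumes "smooth_fun f"
  shows "((\<lambda>s. f (x + s *\<^sub>R v)) has_real_derivative dd f v (x + r *\<^sub>R v)) (at r within S)"
proof -
  have "((\<lambda>s. f (x + s *\<^sub>R v)) has_derivative (\<lambda>s. dd f (s *\<^sub>R v) (x + r *\<^sub>R v))) (at r)"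
    by (rule has_derivative_compose[OF _ smooth_fun_has_derivative[OF assms]])
       (auto intro!: derivative_eq_intros)
  moreover have "(\<lambda>s. dd f (s *\<^sub>R v) (x + r *\<^sub>R v)) = (*) (dd f v (x + r *\<^sub>R v))"
    by (auto simp: linear_cmul[OF has_derivative_linear[OF smooth_fun_has_derivative[OF assms]]])
  ultimately show ?thesis
    by (simp add: has_field_derivative_def has_derivative_at_withinI)
qed

text \<open>Two applications of the fundamental theorem of calculus. The resulting second difference
  is symmetric in \<open>a\<close> and \<open>b\<close>, which is the source of
  \<open>dd_commute\<close>.\<close>

lemma integral_square_dd:
  fixes f :: "'a::euclidean_space \<Rightarrow> real"
  assumes f: "smooth_fun f" and a: "a \<in> Basis" and b: "b \<in> Basis" and h: "0 \<le> h"
  shows "integral {0..h} (\<lambda>s. integral {0..h} (\<lambda>r. dd (dd f a) b (x + s *\<^sub>R a + r *\<^sub>R b)))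
       = f (x + h *\<^sub>R a + h *\<^sub>R b) - f (x + h *\<^sub>R a) - f (x + h *\<^sub>R b) + f x"
proof -
  have 1: "integral {0..h} (\<lambda>r. dd (dd f a) b (x + s *\<^sub>R a + r *\<^sub>R b)) =
      dd f a (x + s *\<^sub>R a + h *\<^sub>R b) - dd f a (x + s *\<^sub>R a)" for s
    using fundamental_theorem_of_calculus[of 0 h "\<lambda>r. dd f a (x + s *\<^sub>R a + r *\<^sub>R b)"
        "\<lambda>r. dd (dd f a) b (x + s *\<^sub>R a + r *\<^sub>R b)"] h
      smooth_fun_has_field_derivative[OF smooth_fun_dd[OF f a], of "x + s *\<^sub>R a" b]
    by (simp add: has_real_derivative_iff_has_vector_derivative integral_unique)
  have 2: "((\<lambda>s. dd f a (x + s *\<^sub>R a + h *\<^sub>R b) - dd f a (x + s *\<^sub>R a)) has_integral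
      (f (x + h *\<^sub>R a + h *\<^sub>R b) - f (x + h *\<^sub>R a)) - (f (x + h *\<^sub>R b) - f x)) {0..h}"
    using fundamental_theorem_of_calculus[of 0 h "\<lambda>s. f (x + s *\<^sub>R a + h *\<^sub>R b) - f (x + s *\<^sub>R a)"
        "\<lambda>s. dd f a (x + s *\<^sub>R a + h *\<^sub>R b) - dd f a (x + s *\<^sub>R a)"] h
      DERIV_diff[OF smooth_fun_has_field_derivative[OF f, of "x + h *\<^sub>R b" a]
          smooth_fun_has_field_derivative[OF f, of x a]]
    by (simp add: has_real_derivative_iff_has_vector_derivative algebra_simps)
  show ?thesis using 2 by (simp add: 1 integral_unique)
qed

text \<open>By Fubini and \<open>integral_square_dd\<close> the continuous difference of the two
  mixed derivatives has zero integral over every square with corner \<open>x\<close>; a nonzero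
  value at \<open>x\<close> would keep its sign on a small such square.\<close>

lemma dd_commute:
  fixes f :: "'a::euclidean_space \<Rightarrow> real"
  assumes f: "smooth_fun f" and a: "a \<in> Basis" and b: "b \<in> Basis"
  shows "dd (dd f a) b x = dd (dd f b) a x"
proof -
  define D where "D y = dd (dd f a) b y - dd (dd f b) a y" for y
  have cab: "continuous_on UNIV (dd (dd f a) b)" "continuous_on UNIV (dd (dd f b) a)"
    by (intro smooth_fun_continuous_on smooth_fun_dd f a b)+
  define G where "G = (\<lambda>(s::real, r::real). D (x + s *\<^sub>R a + r *\<^sub>R b))"
  have cG: "continuous_on S G" for S
    unfolding G_def D_def case_prod_beta
    by (intro continuous_intros continuous_on_compose2[OF cab(1)] continuous_on_compose2[OF cab(2)]) auto
  have int0: "integral (cbox (0,0) (h,h)) G = 0" if h: "0 \<le> h" for h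
  proof -
    have c: "continuous_on (cbox (0::real,0::real) (h,h)) (\<lambda>(s,r). g (x + s *\<^sub>R a + r *\<^sub>R b))"
      if "continuous_on UNIV g" for g :: "'a \<Rightarrow> real"
      unfolding case_prod_beta by (intro continuous_intros continuous_on_compose2[OF that]) auto
    have i: "integral (cbox (0,0) (h,h)) (\<lambda>(s,r). g (x + s *\<^sub>R a + r *\<^sub>R b)) =
        integral {0..h} (\<lambda>s. integral {0..h} (\<lambda>r. g (x + s *\<^sub>R a + r *\<^sub>R b)))"
      if "continuous_on UNIV g" for g :: "'a \<Rightarrow> real"
      using integral_prod_continuous[OF c[OF that]] by simp
    have "integral {0..h} (\<lambda>s. integral {0..h} (\<lambda>r. dd (dd f b) a (x + s *\<^sub>R a + r *\<^sub>R b))) =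
       integral {0..h} (\<lambda>r. integral {0..h} (\<lambda>s. dd (dd f b) a (x + s *\<^sub>R a + r *\<^sub>R b)))"
      using integral_swap_continuous[OF c[OF cab(2)]] by simp
    also have "\<dots> = integral {0..h} (\<lambda>s. integral {0..h} (\<lambda>r. dd (dd f a) b (x + s *\<^sub>R a + r *\<^sub>R b)))"
      using integral_square_dd[OF f a b h, of x] integral_square_dd[OF f b a h, of x]
      by (simp add: algebra_simps)
    finally have e: "integral (cbox (0,0) (h,h)) (\<lambda>(s,r). dd (dd f b) a (x + s *\<^sub>R a + r *\<^sub>R b)) =
        integral (cbox (0,0) (h,h)) (\<lambda>(s,r). dd (dd f a) b (x + s *\<^sub>R a + r *\<^sub>R b))"
      by (simp add: i cab)
    show ?thesis unfolding G_def D_def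
      using e integral_diff[OF integrable_continuous[OF c[OF cab(1)]] integrable_continuous[OF c[OF cab(2)]]]
      unfolding case_prod_beta by simp
  qed
  have "D x = 0"
  proof (rule ccontr)
    assume "D x \<noteq> 0"
    define \<sigma> where "\<sigma> = sgn (D x)"
    have pos: "\<sigma> * G (0,0) > 0" using \<open>D x \<noteq> 0\<close> by (simp add: G_def \<sigma>_def sgn_if)
    have cs: "continuous_on UNIV (\<lambda>z. \<sigma> * G z)" by (intro continuous_intros cG)
    have "open {z. 0 < \<sigma> * G z}" by (rule open_Collect_less[OF continuous_on_const cs])
    with pos obtain e where e: "e > 0" "ball (0,0) e \<subseteq> {z. \<sigma> * G z > 0}"
      unfolding open_contains_ball by (metis mem_Collect_eq)
    \<comment> \<open>Points of the square have norm at most \<open>2 * h\<close>, hence lie in the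
      ball of radius \<open>e\<close>.\<close>
    define h where "h = e / 3"
    have sub: "cbox (0,0) (h,h) \<subseteq> {z. \<sigma> * G z > 0}"
    proof
      fix z :: "real \<times> real" assume "z \<in> cbox (0,0) (h,h)"
      then have "0 \<le> fst z" "fst z \<le> h" "0 \<le> snd z" "snd z \<le> h" by (auto simp: cbox_Pair_eq mem_Times_iff)
      then have "norm z \<le> h + h"
        using norm_Pair_le[of "fst z" "snd z"] by simp
      then show "z \<in> {z. \<sigma> * G z > 0}" using e by (cases z) (auto simp: h_def subset_iff dist_norm zero_prod_def[symmetric])
    qed
    have ne: "box (0::real,0::real) (h,h) \<noteq> {}"
      using e by (auto simp: box_ne_empty Basis_prod_def h_def)
    have "integral (cbox (0,0) (h,h)) (\<lambda>z. \<sigma> * G z) = 0" using int0[of h] e by (simp add: h_def)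
    then have "\<forall>z\<in>cbox (0,0) (h,h). \<sigma> * G z = 0"
      using sub integral_cbox_eq_0_iff[of "(0,0)" "(h,h)" "\<lambda>z. \<sigma> * G z"] continuous_on_subset[OF cs] ne
      by (auto simp: subset_iff less_imp_le)
    then show False using pos sub e by (auto simp: h_def cbox_Pair_eq)
  qed
  then show ?thesis by (simp add: D_def)
qed

subsection \<open>Integration over the torus\<close>

lemma periodic_floor:
  fixes f :: "'a::real_vector \<Rightarrow> 'b"
  assumes "\<And>x. f (x + b) = f x"
  shows "f (x + of_int k *\<^sub>R b) = f x"
proof -
  have nat: "f (x + real n *\<^sub>R b) = f x" for n x
  proof (induction n)
    case (Suc n)
    have "x + real (Suc n) *\<^sub>R b = (x + real n *\<^sub>R b) + b" by (simp add: algebra_simps)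
    then show ?case using Suc assms by metis
  qed simp
  show ?thesis
  proof (cases "k \<ge> 0")
    case True
    then show ?thesis using nat[of x "nat k"] by simp
  next
    case False
    then show ?thesis using nat[of "x + of_int k *\<^sub>R b" "nat (-k)"] by (simp add: algebra_simps)
  qed
qed

text \<open>Extend the cube by \<open>s\<close> in direction \<open>b\<close> and cut the long box
  once at height \<open>s\<close> and once at height 1. The two leftover slabs are translates of
  each other by \<open>b\<close>, so the two cubes carry the same integral; general shifts reduce to
  \<open>frac s\<close>.\<close>

lemma integral_unit_cube_shift_basis:
  fixes f :: "'a::euclidean_space \<Rightarrow> real"
  assumes f: "continuous_on UNIV f" and b: "b \<in> Basis" and per: "\<And>x. f (x + b) = f x"
  shows "integral (cbox 0 One) (\<lambda>x. f (x + s *\<^sub>R b)) = integral (cbox 0 One) f"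
proof -
  have unit: "integral (cbox 0 One) (\<lambda>x. f (x + s *\<^sub>R b)) = integral (cbox 0 One) f"
    if s: "0 \<le> s" "s \<le> 1" for s
  proof -
    have fi: "f integrable_on cbox u v" for u v
      by (rule integrable_continuous) (rule continuous_on_subset[OF f], simp)
    let ?L = "cbox 0 (One + s *\<^sub>R b)"
    have b': "b \<bullet> i = (if i = b then 1 else 0)" if "i \<in> Basis" for i
      using that b by (simp add: inner_Basis)
    have 1: "?L \<inter> {x. x \<bullet> b \<le> s} = cbox 0 (One + (s - 1) *\<^sub>R b)"
      using s b by (fastforce simp: mem_box inner_simps b' split: if_splits)
    have 2: "?L \<inter> {x. x \<bullet> b \<ge> s} = cbox (s *\<^sub>R b) (One + s *\<^sub>R b)"
      using s b by (fastforce simp: mem_box inner_simps b' split: if_splits)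
    have 3: "?L \<inter> {x. x \<bullet> b \<le> 1} = cbox 0 One"
      using s b by (fastforce simp: mem_box inner_simps b' split: if_splits)
    have 4: "?L \<inter> {x. x \<bullet> b \<ge> 1} = cbox b (One + s *\<^sub>R b)"
      using s b by (fastforce simp: mem_box inner_simps b' split: if_splits)
    have "integral ?L f = integral (cbox 0 (One + (s - 1) *\<^sub>R b)) f
        + integral (cbox (s *\<^sub>R b) (One + s *\<^sub>R b)) f"
      using integral_split[OF fi b, of 0 "One + s *\<^sub>R b" s] by (simp add: 1 2)
    moreover have "integral ?L f = integral (cbox 0 One) f + integral (cbox b (One + s *\<^sub>R b)) f"
      using integral_split[OF fi b, of 0 "One + s *\<^sub>R b" 1] by (simp add: 3 4)
    moreover have "integral (cbox b (One + s *\<^sub>R b)) f = integral (cbox 0 (One + (s - 1) *\<^sub>R b)) f"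
      using integral_shift_cbox[of b b "One + s *\<^sub>R b" f] by (simp add: per algebra_simps)
    moreover have "integral (cbox 0 One) (\<lambda>x. f (x + s *\<^sub>R b)) = integral (cbox (s *\<^sub>R b) (One + s *\<^sub>R b)) f"
      using integral_shift_cbox[of "s *\<^sub>R b" "s *\<^sub>R b" "One + s *\<^sub>R b" f] by simp
    ultimately show ?thesis by simp
  qed
  have "(\<lambda>x. f (x + s *\<^sub>R b)) = (\<lambda>x. f (x + frac s *\<^sub>R b))"
  proof
    fix x
    have "x + s *\<^sub>R b = (x + frac s *\<^sub>R b) + of_int \<lfloor>s\<rfloor> *\<^sub>R b"
      by (simp add: frac_def algebra_simps)
    then show "f (x + s *\<^sub>R b) = f (x + frac s *\<^sub>R b)"
      using periodic_floor[of f b "x + frac s *\<^sub>R b" "\<lfloor>s\<rfloor>"] per by metis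
  qed
  then show ?thesis using unit[of "frac s"] by (simp add: frac_ge_0 frac_lt_1 less_imp_le)
qed

definition cper :: "(real^'d \<Rightarrow> real) \<Rightarrow> bool" where
  "cper f \<longleftrightarrow> continuous_on UNIV f \<and> periodic f"

abbreviation tint :: "(real^'d \<Rightarrow> real) \<Rightarrow> real" where
  "tint f \<equiv> integral torus_cell f"

lemma axis_Basis: "axis i (1::real) \<in> Basis" by simp

lemma sum_Basis_axis: "(\<Sum>c\<in>(Basis::(real^'d) set). g c) = (\<Sum>i\<in>UNIV. g (axis i 1))"
proof -
  have 1: "(Basis::(real^'d) set) = range (\<lambda>i. axis i 1)" by (auto simp: Basis_vec_def)
  have "inj (\<lambda>i::'d. axis i (1::real))" by (auto simp: inj_def axis_eq_axis)
  from sum.reindex[OF this, of g] show ?thesis unfolding 1 by (simp add: o_def)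
qed

lemma cperI: "continuous_on UNIV f \<Longrightarrow> (\<And>i x. f (x + axis i 1) = f x) \<Longrightarrow> cper f"
  by (simp add: cper_def periodic_def)

lemma cper_cont: "cper f \<Longrightarrow> continuous_on S f"
  by (auto simp: cper_def intro: continuous_on_subset)

lemma cper_per: "cper f \<Longrightarrow> f (x + axis i 1) = f x"
  by (auto simp: cper_def periodic_def)

lemma cper_const: "cper (\<lambda>x. c)" by (simp add: cper_def periodic_def)
lemma cper_add: "cper f \<Longrightarrow> cper g \<Longrightarrow> cper (\<lambda>x. f x + g x)"
  by (auto simp: cper_def periodic_def intro!: continuous_intros)
lemma cper_diff: "cper f \<Longrightarrow> cper g \<Longrightarrow> cper (\<lambda>x. f x - g x)"
  by (auto simp: cper_def periodic_def intro!: continuous_intros)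
lemma cper_uminus: "cper f \<Longrightarrow> cper (\<lambda>x. - f x)"
  by (auto simp: cper_def periodic_def intro!: continuous_intros)
lemma cper_mult: "cper f \<Longrightarrow> cper g \<Longrightarrow> cper (\<lambda>x. f x * g x)"
  by (auto simp: cper_def periodic_def intro!: continuous_intros)
lemma cper_abs: "cper f \<Longrightarrow> cper (\<lambda>x. \<bar>f x\<bar>)"
  by (auto simp: cper_def periodic_def intro!: continuous_intros)
lemma cper_power: "cper f \<Longrightarrow> cper (\<lambda>x. f x ^ n)"
  by (auto simp: cper_def periodic_def intro!: continuous_intros)
lemma cper_sum: "(\<And>i. i \<in> A \<Longrightarrow> cper (f i)) \<Longrightarrow> cper (\<lambda>x. \<Sum>i\<in>A. f i x)"
  by (auto simp: cper_def periodic_def intro!: continuous_intros sum.cong)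
lemma cper_prod: "(\<And>i. i \<in> A \<Longrightarrow> cper (f i)) \<Longrightarrow> cper (\<lambda>x. \<Prod>i\<in>A. f i x)"
  by (auto simp: cper_def periodic_def intro!: continuous_intros prod.cong)
lemma cper_powr: "cper f \<Longrightarrow> (\<And>x. 0 < f x) \<Longrightarrow> cper (\<lambda>x. f x powr a)"
  by (auto simp: cper_def periodic_def intro!: continuous_intros) (metis less_irrefl)
lemma cper_shift: "cper f \<Longrightarrow> cper (\<lambda>x. f (x + y))"
proof (rule cperI)
  assume f: "cper f"
  show "continuous_on UNIV (\<lambda>x. f (x + y))"
    by (intro continuous_on_compose2[OF cper_cont[OF f, of UNIV]] continuous_intros) auto
  show "f (x + axis i 1 + y) = f (x + y)" for i x
    using cper_per[OF f, of "x + y" i] by (simp add: algebra_simps)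
qed
lemma cper_shift_diff: "cper f \<Longrightarrow> cper (\<lambda>x. f (x - y))"
  using cper_shift[of f "-y"] by simp

lemmas cper_intros = cper_const cper_add cper_diff cper_uminus cper_mult cper_abs cper_sum cper_prod
  cper_shift cper_shift_diff cper_power

lemma compact_torus_cell: "compact (torus_cell :: (real^'d) set)"
  by (simp add: torus_cell_def compact_cbox)

lemma zero_in_torus_cell: "0 \<in> (torus_cell :: (real^'d) set)"
  by (simp add: torus_cell_def mem_box)

lemma torus_cell_representative:
  fixes x :: "real^'d"
  obtains y where "y \<in> torus_cell" "\<And>f::real^'d \<Rightarrow> 'b. periodic f \<Longrightarrow> f x = f y"
proof -
  let ?v = "\<lambda>S. (\<Sum>i\<in>S. of_int \<lfloor>x $ i\<rfloor> *\<^sub>R axis i (1::real))"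
  have *: "f (z + ?v S) = f z" if f: "periodic f" and "finite S" for f :: "real^'d \<Rightarrow> 'b" and z S
    using \<open>finite S\<close>
  proof (induction S arbitrary: z)
    case (insert i S)
    have "z + ?v (insert i S) = (z + of_int \<lfloor>x $ i\<rfloor> *\<^sub>R axis i 1) + ?v S"
      using insert by simp
    then have "f (z + ?v (insert i S)) = f (z + of_int \<lfloor>x $ i\<rfloor> *\<^sub>R axis i 1)"
      by (simp only: insert.IH)
    also have "\<dots> = f z"
      by (rule periodic_floor) (use f in \<open>auto simp: periodic_def\<close>)
    finally show ?case .
  qed simp
  have comp: "?v UNIV $ j = of_int \<lfloor>x $ j\<rfloor>" for j
    by (simp add: sum_component axis_def if_distrib cong: if_cong)
  have "x - ?v UNIV \<in> torus_cell"
    unfolding torus_cell_def mem_box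
  proof (intro ballI)
    fix i :: "real^'d" assume i: "i \<in> Basis"
    then obtain k where k: "i = axis k 1" by (auto simp: Basis_vec_def)
    have "(x - ?v UNIV) \<bullet> i = x $ k - of_int \<lfloor>x $ k\<rfloor>"
      unfolding k by (simp only: inner_axis vector_minus_component comp) simp
    moreover have "0 \<le> x $ k - of_int \<lfloor>x $ k\<rfloor>" "x $ k - of_int \<lfloor>x $ k\<rfloor> \<le> 1" by linarith+
    ultimately show "0 \<bullet> i \<le> (x - ?v UNIV) \<bullet> i \<and> (x - ?v UNIV) \<bullet> i \<le> One \<bullet> i"
      using i by simp
  qed
  moreover have "f x = f (x - ?v UNIV)" if "periodic f" for f :: "real^'d \<Rightarrow> 'b"
    using *[OF that, of UNIV "x - ?v UNIV"] by simp
  ultimately show ?thesis by (rule that)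
qed

lemma cper_attains_min:
  assumes "cper f"
  obtains x0 where "x0 \<in> torus_cell" "\<And>x. f x0 \<le> f x"
proof -
  have "torus_cell \<noteq> ({}::(real^'a) set)" using zero_in_torus_cell by blast
  then obtain x0 where x0: "x0 \<in> torus_cell" "\<And>y. y \<in> torus_cell \<Longrightarrow> f x0 \<le> f y"
    using continuous_attains_inf[OF compact_torus_cell _ cper_cont[OF assms]] by blast
  have "f x0 \<le> f x" for x
  proof -
    obtain y where "y \<in> torus_cell" "f x = f y"
      using torus_cell_representative[where x=x and 'b=real] assms by (metis cper_def)
    then show ?thesis using x0 by simp
  qed
  then show ?thesis using that x0 by blast
qed

lemma cper_bounded:
  assumes "cper f"
  obtains K where "0 < K" "\<And>x. \<bar>f x\<bar> \<le> K"
proof -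
  obtain x0 where x0: "\<And>x. - \<bar>f x0\<bar> \<le> - \<bar>f x\<bar>"
    using cper_attains_min[OF cper_uminus[OF cper_abs[OF assms]]] by auto
  have "\<bar>f x\<bar> \<le> \<bar>f x0\<bar> + 1" for x using x0[of x] by linarith
  then show ?thesis using that[of "\<bar>f x0\<bar> + 1"] by auto
qed

lemma tint_integrable: "cper f \<Longrightarrow> f integrable_on torus_cell"
  unfolding torus_cell_def by (intro integrable_continuous cper_cont)

lemma tint_shift:
  assumes "cper f"
  shows "tint (\<lambda>x. f (x + y)) = tint f"
proof -
  have "tint (\<lambda>x. f (x + (\<Sum>i\<in>S. y $ i *\<^sub>R axis i 1))) = tint f" if "finite S" for S
    using that
  proof (induction S)
    case (insert i S)
    let ?v = "(\<Sum>i\<in>S. y $ i *\<^sub>R axis i 1)"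
    have g: "cper (\<lambda>x. f (x + ?v))" by (rule cper_shift[OF assms])
    have "tint (\<lambda>x. f (x + (\<Sum>i\<in>insert i S. y $ i *\<^sub>R axis i 1))) = tint (\<lambda>x. f ((x + y $ i *\<^sub>R axis i 1) + ?v))"
      using insert by (simp add: algebra_simps)
    also have "\<dots> = tint (\<lambda>x. f (x + ?v))"
      unfolding torus_cell_def
      by (rule integral_unit_cube_shift_basis[OF cper_cont[OF g] axis_Basis cper_per[OF g]])
    finally show ?case using insert by simp
  qed simp
  from this[of UNIV] show ?thesis
    using basis_expansion[of y] by (simp add: scalar_mult_eq_scaleR)
qed

lemma tint_const: "tint (\<lambda>x::real^'d. c) = c"
  unfolding torus_cell_def by (simp add: content_unit)

lemma tint_add: "cper f \<Longrightarrow> cper g \<Longrightarrow> tint (\<lambda>x. f x + g x) = tint f + tint g"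
  by (intro integral_add tint_integrable)
lemma tint_diff: "cper f \<Longrightarrow> cper g \<Longrightarrow> tint (\<lambda>x. f x - g x) = tint f - tint g"
  by (intro integral_diff tint_integrable)
lemma tint_sum: "(\<And>i. i \<in> A \<Longrightarrow> cper (f i)) \<Longrightarrow> finite A \<Longrightarrow> tint (\<lambda>x. \<Sum>i\<in>A. f i x) = (\<Sum>i\<in>A. tint (f i))"
  by (intro integral_sum tint_integrable)
lemma tint_cmult: "tint (\<lambda>x. c * f x) = c * tint f"
  by (rule integral_mult_right)
lemma tint_mono: "cper f \<Longrightarrow> cper g \<Longrightarrow> (\<And>x. f x \<le> g x) \<Longrightarrow> tint f \<le> tint g"
  by (intro integral_le tint_integrable)
lemma tint_nonneg: "cper f \<Longrightarrow> (\<And>x. 0 \<le> f x) \<Longrightarrow> 0 \<le> tint f"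
  by (intro integral_nonneg tint_integrable)

lemma tint_pos:
  assumes "cper f" "\<And>x. 0 < f x"
  shows "0 < tint f"
proof -
  obtain x0 where x0: "\<And>x. f x0 \<le> f x" using cper_attains_min[OF assms(1)] by auto
  then have "f x0 \<le> tint f" using tint_mono[OF cper_const assms(1), of "f x0"] by (simp add: tint_const)
  with assms(2)[of x0] show ?thesis by simp
qed

lemma tint_swap:
  fixes F :: "real^'d \<Rightarrow> 'a::euclidean_space \<Rightarrow> real"
  assumes "continuous_on UNIV (\<lambda>(x, y). F x y)"
  shows "tint (\<lambda>x. integral (cbox a b) (F x)) = integral (cbox a b) (\<lambda>y. tint (\<lambda>x. F x y))"
  unfolding torus_cell_def
  by (rule integral_swap_continuous) (rule continuous_on_subset[OF assms], simp)

text \<open>One coordinate is integrated out while the result stays a function on the whole torus,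
  now constant in direction \<open>j\<close>. Partial integrals thereby need no splitting of the
  space into factors.\<close>

definition avg :: "'d::finite \<Rightarrow> (real^'d \<Rightarrow> real) \<Rightarrow> real^'d \<Rightarrow> real" where
  "avg j f x = integral {0..1} (\<lambda>s. f (x + s *\<^sub>R axis j 1))"

lemma continuous_on_line: "cper f \<Longrightarrow> continuous_on S (\<lambda>s. f (x + s *\<^sub>R v))"
  by (intro continuous_on_compose2[OF cper_cont[of f UNIV]] continuous_intros) auto

lemma line_integrable: "cper f \<Longrightarrow> (\<lambda>s. f (x + s *\<^sub>R v)) integrable_on {a..b}"
  by (intro integrable_continuous_interval continuous_on_line)

lemma cper_avg:
  assumes "cper f"
  shows "cper (avg j f)"
proof (rule cperI)
  have "continuous_on UNIV (\<lambda>x. integral (cbox 0 1) (\<lambda>s::real. f (x + s *\<^sub>R axis j 1)))"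
    by (rule integral_continuous_on_param)
       (auto simp: case_prod_beta intro!: continuous_intros continuous_on_compose2[OF cper_cont[OF assms, of UNIV]])
  then show "continuous_on UNIV (avg j f)" by (simp add: avg_def[abs_def])
  show "avg j f (x + axis i 1) = avg j f x" for i x
    unfolding avg_def by (simp add: add.assoc add.commute[of "axis i 1"])
       (simp add: cper_per[OF assms] flip: add.assoc)
qed

lemma avg_shift:
  assumes "cper f"
  shows "avg j f (x + r *\<^sub>R axis j 1) = avg j f x"
proof -
  have "integral (cbox 0 One) (\<lambda>s::real. f (x + (s + r *\<^sub>R 1) *\<^sub>R axis j 1)) = integral (cbox 0 One) (\<lambda>s::real. f (x + s *\<^sub>R axis j 1))"
    by (rule integral_unit_cube_shift_basis[OF continuous_on_line[OF assms]])
       (simp_all add: scaleR_add_left cper_per[OF assms] flip: add.assoc)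
  then show ?thesis by (simp add: avg_def algebra_simps)
qed

lemma tint_avg:
  assumes "cper f"
  shows "tint (avg j f) = tint f"
proof -
  have "tint (\<lambda>x. integral (cbox (0::real) 1) (\<lambda>s. f (x + s *\<^sub>R axis j 1))) =
      integral (cbox 0 1) (\<lambda>s. tint (\<lambda>x. f (x + s *\<^sub>R axis j 1)))"
    by (rule tint_swap)
       (auto simp: case_prod_beta intro!: continuous_intros continuous_on_compose2[OF cper_cont[OF assms, of UNIV]])
  then show ?thesis by (simp add: avg_def[abs_def] tint_shift[OF assms])
qed

lemma avg_mono:
  assumes "cper f" "cper g" "\<And>x. f x \<le> g x"
  shows "avg j f x \<le> avg j g x"
  unfolding avg_def by (intro integral_le line_integrable assms)

lemma line_derivative_shift:
  fixes f :: "'a::real_vector \<Rightarrow> real"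
  assumes "\<And>x. ((\<lambda>s. f (x + s *\<^sub>R v)) has_real_derivative f' x) (at 0)"
  shows "((\<lambda>s. f (x + s *\<^sub>R v)) has_real_derivative f' (x + r *\<^sub>R v)) (at r within S)"
proof -
  have "((\<lambda>s. f ((x + r *\<^sub>R v) + s *\<^sub>R v)) has_real_derivative f' (x + r *\<^sub>R v)) (at 0)" by (rule assms)
  then have "((\<lambda>s. f (x + (r + s) *\<^sub>R v)) has_real_derivative f' (x + r *\<^sub>R v)) (at 0)"
    by (simp add: algebra_simps)
  then have "((\<lambda>s. f (x + s *\<^sub>R v)) has_real_derivative f' (x + r *\<^sub>R v)) (at r)"
    using DERIV_at_within_shift[of "\<lambda>s. f (x + s *\<^sub>R v)" "f' (x + r *\<^sub>R v)" r 0 UNIV] by simp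
  then show ?thesis by (rule has_field_derivative_at_within)
qed

text \<open>Averaging a derivative along its own direction gives a difference of values one period
  apart, and averaging preserves the integral. Only a directional derivative is assumed, so real
  powers of the density are covered without being shown to be \<open>smooth_fun\<close>.\<close>

lemma tint_derivative_eq_0:
  assumes f: "cper f" and f': "cper f'"
    and d: "\<And>x. ((\<lambda>s. f (x + s *\<^sub>R axis j 1)) has_real_derivative f' x) (at 0)"
  shows "tint f' = 0"
proof -
  have "avg j f' x = 0" for x
  proof -
    have "((\<lambda>s. f' (x + s *\<^sub>R axis j 1)) has_integral f (x + 1 *\<^sub>R axis j 1) - f (x + 0 *\<^sub>R axis j 1)) {0..1}"
      by (rule fundamental_theorem_of_calculus)
         (auto simp: has_real_derivative_iff_has_vector_derivative[symmetric] intro!: line_derivative_shift d)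
    then show ?thesis using cper_per[OF f] by (simp add: avg_def integral_unique)
  qed
  then show ?thesis using tint_avg[OF f', of j] by (simp add: tint_const cong: integral_cong)
qed

subsection \<open>Hoelder and Gagliardo--Nirenberg inequalities on the torus\<close>

text \<open>Convexity of \<open>exp\<close> at the points \<open>ln (x i)\<close>.\<close>

lemma weighted_AM_GM:
  fixes x w :: "'i \<Rightarrow> real"
  assumes "finite S" "S \<noteq> {}" "\<And>i. i \<in> S \<Longrightarrow> 0 < x i" "\<And>i. i \<in> S \<Longrightarrow> 0 \<le> w i" "(\<Sum>i\<in>S. w i) = 1"
  shows "(\<Prod>i\<in>S. x i powr w i) \<le> (\<Sum>i\<in>S. w i * x i)"
proof -
  have "(\<Prod>i\<in>S. x i powr w i) = exp (\<Sum>i\<in>S. w i *\<^sub>R ln (x i))"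
    using assms by (simp add: exp_sum powr_def less_imp_neq[symmetric])
  also have "\<dots> \<le> (\<Sum>i\<in>S. w i * exp (ln (x i)))"
    by (rule convex_on_sum[where C=UNIV]) (use assms in \<open>auto simp: exp_convex\<close>)
  also have "\<dots> = (\<Sum>i\<in>S. w i * x i)" using assms by simp
  finally show ?thesis .
qed

text \<open>Divide every \<open>f i\<close> by its integral, apply \<open>weighted_AM_GM\<close>
  pointwise and integrate: the sum on the right becomes the sum of the weights. Strict positivity
  keeps clear of the convention \<open>0 powr 0 = 0\<close>, since weights may vanish.\<close>

lemma Holder_integral_pos:
  fixes f :: "'i \<Rightarrow> 'a::euclidean_space \<Rightarrow> real"
  assumes S: "finite S" "S \<noteq> {}" and c: "\<And>i. i \<in> S \<Longrightarrow> continuous_on (cbox a b) (f i)"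
    and pos: "\<And>i x. i \<in> S \<Longrightarrow> x \<in> cbox a b \<Longrightarrow> 0 < f i x"
    and w: "\<And>i. i \<in> S \<Longrightarrow> 0 \<le> w i" "(\<Sum>i\<in>S. w i) = 1" and ne: "box a b \<noteq> {}"
  shows "integral (cbox a b) (\<lambda>x. \<Prod>i\<in>S. f i x powr w i) \<le> (\<Prod>i\<in>S. integral (cbox a b) (f i) powr w i)"
proof -
  define A where "A i = integral (cbox a b) (f i)" for i
  have int: "f i integrable_on cbox a b" if "i \<in> S" for i using c[OF that] by (rule integrable_continuous)
  have A: "0 < A i" if "i \<in> S" for i
  proof -
    have "integral (cbox a b) (\<lambda>x. 0) < A i" unfolding A_def
      using integral_less[of a b "\<lambda>x. 0" "f i"] c[OF that] ne pos[OF that] box_subset_cbox by auto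
    then show ?thesis by simp
  qed
  let ?P = "\<Prod>i\<in>S. A i powr w i"
  have P: "0 < ?P" using A by (auto intro!: prod_pos simp: less_imp_neq[symmetric])
  have "integral (cbox a b) (\<lambda>x. \<Prod>i\<in>S. f i x powr w i) \<le> integral (cbox a b) (\<lambda>x. ?P * (\<Sum>i\<in>S. w i * (f i x / A i)))"
  proof (rule integral_le)
    show "(\<lambda>x. \<Prod>i\<in>S. f i x powr w i) integrable_on cbox a b"
      using pos by (auto intro!: integrable_continuous continuous_intros c) (metis less_irrefl)
    show "(\<lambda>x. ?P * (\<Sum>i\<in>S. w i * (f i x / A i))) integrable_on cbox a b"
      using A by (auto intro!: integrable_continuous continuous_intros c) (metis less_irrefl)
    fix x assume x: "x \<in> cbox a b"
    have "(\<Prod>i\<in>S. f i x powr w i) = (\<Prod>i\<in>S. A i powr w i * (f i x / A i) powr w i)"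
      using A pos x by (auto intro!: prod.cong simp: powr_divide less_imp_le) (metis less_irrefl)
    also have "\<dots> = ?P * (\<Prod>i\<in>S. (f i x / A i) powr w i)" by (simp add: prod.distrib)
    also have "\<dots> \<le> ?P * (\<Sum>i\<in>S. w i * (f i x / A i))"
      using P A pos x by (intro mult_left_mono weighted_AM_GM S w) auto
    finally show "(\<Prod>i\<in>S. f i x powr w i) \<le> ?P * (\<Sum>i\<in>S. w i * (f i x / A i))" .
  qed
  also have "\<dots> = ?P * (\<Sum>i\<in>S. w i * (A i / A i))"
  proof -
    have "integral (cbox a b) (\<lambda>x. \<Sum>i\<in>S. w i * (f i x / A i)) = (\<Sum>i\<in>S. w i * (A i / A i))"
    proof (subst integral_sum)
      show "(\<lambda>x. w i * (f i x / A i)) integrable_on cbox a b" if "i \<in> S" for i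
        using A[OF that] by (auto intro!: integrable_continuous continuous_intros c that)
    qed (auto simp: S A_def intro!: sum.cong)
    then show ?thesis by simp
  qed
  also have "\<dots> = ?P" using A w(2) by (simp add: less_imp_neq[symmetric] cong: sum.cong)
  finally show ?thesis by (simp add: A_def)
qed

lemma torus_box_ne: "box 0 (One::real^'d) \<noteq> {}"
  by (auto simp: box_ne_empty)

lemma Holder_tint:
  fixes f g :: "real^'d \<Rightarrow> real"
  assumes f: "cper f" "\<And>x. 0 < f x" and g: "cper g" "\<And>x. 0 < g x" and w: "0 \<le> w" "w \<le> 1"
  shows "tint (\<lambda>x. f x powr w * g x powr (1 - w)) \<le> tint f powr w * tint g powr (1 - w)"
  using Holder_integral_pos[of "UNIV::bool set" 0 "One::real^'d" "\<lambda>b. if b then f else g" "\<lambda>b. if b then w else 1 - w"]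
    cper_cont[OF f(1), of torus_cell] cper_cont[OF g(1), of torus_cell] f(2) g(2) w
  by (simp add: UNIV_bool torus_box_ne torus_cell_def[symmetric] mult.commute split: if_splits)

text \<open>The factor \<open>a k\<close> does not vary along direction \<open>k\<close> and comes
  out of the integral; exactly \<open>n\<close> factors remain, so Hoelder applies with equal
  weights \<open>1/n\<close>.\<close>

lemma avg_powr_prod_le:
  fixes a :: "'d::finite \<Rightarrow> real^'d \<Rightarrow> real"
  assumes a: "\<And>j. cper (a j)" "\<And>j x. 0 < a j x"
    and indep: "\<And>x r. a k (x + r *\<^sub>R axis k 1) = a k x"
    and card: "2 \<le> CARD('d)" and n: "n = real CARD('d) - 1"
  shows "avg k (\<lambda>x. \<Prod>j\<in>UNIV. a j x powr (1/n)) x \<le> (\<Prod>j\<in>UNIV. avg k (a j) x powr (1/n))"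
proof -
  let ?S = "UNIV - {k}"
  have n0: "n > 0" using card n by simp
  have cS: "real (card ?S) = n" using n card by (simp add: of_nat_diff)
  then have S: "?S \<noteq> {}" using n0 by (metis card.empty less_irrefl of_nat_0)
  have split: "(\<Prod>j\<in>UNIV. g j) = g k * (\<Prod>j\<in>?S. g j)" for g :: "'d \<Rightarrow> real"
    by (simp add: prod.remove)
  have "avg k (\<lambda>x. \<Prod>j\<in>UNIV. a j x powr (1/n)) x
      = a k x powr (1/n) * integral (cbox 0 1) (\<lambda>s. \<Prod>j\<in>?S. a j (x + s *\<^sub>R axis k 1) powr (1/n))"
    by (simp add: avg_def split indep)
  also have "\<dots> \<le> a k x powr (1/n) * (\<Prod>j\<in>?S. integral (cbox 0 1) (\<lambda>s. a j (x + s *\<^sub>R axis k 1)) powr (1/n))"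
    using S n0 cS
    by (intro mult_left_mono Holder_integral_pos) (auto intro!: continuous_on_line a)
  also have "a k x = avg k (a k) x" by (simp add: avg_def indep)
  finally show ?thesis by (simp add: split avg_def)
qed

lemma avg_pos:
  assumes "cper f" "\<And>x. 0 < f x"
  shows "0 < avg j f x"
proof -
  obtain x0 where x0: "\<And>x. f x0 \<le> f x" using cper_attains_min[OF assms(1)] by auto
  have "avg j (\<lambda>_. f x0) x \<le> avg j f x" by (intro avg_mono cper_const assms x0)
  with assms(2)[of x0] show ?thesis by (simp add: avg_def)
qed

text \<open>Replacing every \<open>a j\<close> by its average in one further direction keeps the
  integrals of the \<open>a j\<close> and, by \<open>avg_powr_prod_le\<close>, does not decrease the
  left-hand side. Once all directions are averaged the functions are constants and both sides
  coincide.\<close>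

theorem Loomis_Whitney_torus:
  fixes a :: "'d::finite \<Rightarrow> real^'d \<Rightarrow> real"
  assumes a: "\<And>j. cper (a j)" "\<And>j x. 0 < a j x"
    and indep: "\<And>j x r. a j (x + r *\<^sub>R axis j 1) = a j x"
    and card: "2 \<le> CARD('d)" and n: "n = real CARD('d) - 1"
  shows "tint (\<lambda>x. \<Prod>j\<in>UNIV. a j x powr (1/n)) \<le> (\<Prod>j\<in>UNIV. tint (a j) powr (1/n))"
proof -
  define P where "P a = (\<lambda>x. \<Prod>j\<in>UNIV. a j x powr (1/n))" for a :: "'d \<Rightarrow> real^'d \<Rightarrow> real"
  have cP: "cper (P a)" if "\<And>j. cper (a j)" "\<And>j x. 0 < a j x" for a
    unfolding P_def using that by (intro cper_prod cper_powr)
  \<comment> \<open>\<open>insert j S\<close> records that the function with index \<open>j\<close>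
    is constant in direction \<open>j\<close> from the outset; averaging in other directions must
    preserve this, as \<open>avg_powr_prod_le\<close> relies on it.\<close>
  have "\<exists>a'. (\<forall>j. cper (a' j) \<and> (\<forall>x. 0 < a' j x) \<and> tint (a' j) = tint (a j) \<and>
            (\<forall>k\<in>insert j S. \<forall>x r. a' j (x + r *\<^sub>R axis k 1) = a' j x)) \<and> tint (P a) \<le> tint (P a')"
    if "finite S" for S
    using that
  proof (induction S)
    case empty
    show ?case by (rule exI[of _ a]) (use a indep in auto)
  next
    case (insert k S)
    then obtain a' where a': "\<And>j. cper (a' j)" "\<And>j x. 0 < a' j x" "\<And>j. tint (a' j) = tint (a j)"
        "\<And>j k x r. k \<in> insert j S \<Longrightarrow> a' j (x + r *\<^sub>R axis k 1) = a' j x" "tint (P a) \<le> tint (P a')"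
      by blast
    have ind: "avg k (a' j) (x + r *\<^sub>R axis l 1) = avg k (a' j) x" if "l \<in> insert j (insert k S)" for l j x r
    proof (cases "l = k")
      case True then show ?thesis by (simp add: avg_shift a')
    next
      case False
      with that have "l \<in> insert j S" by auto
      then have "a' j (x + r *\<^sub>R axis l 1 + s *\<^sub>R axis k 1) = a' j (x + s *\<^sub>R axis k 1)" for s
        using a'(4)[of l j "x + s *\<^sub>R axis k 1" r] by (simp add: algebra_simps)
      then show ?thesis by (simp add: avg_def)
    qed
    have "tint (P a') = tint (avg k (P a'))" by (simp add: tint_avg cP a')
    also have "\<dots> \<le> tint (P (\<lambda>j. avg k (a' j)))"
    proof (rule tint_mono)
      show "avg k (P a') x \<le> P (\<lambda>j. avg k (a' j)) x" for x
        unfolding P_def by (intro avg_powr_prod_le a' card n) simp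
    qed (intro cper_avg cP a' avg_pos)+
    finally show ?case
      using a' ind by (intro exI[of _ "\<lambda>j. avg k (a' j)"]) (auto intro!: cper_avg avg_pos simp: tint_avg)
  qed
  from this[of UNIV, OF finite_class.finite_UNIV] obtain a' where a': "\<And>j. cper (a' j)" "\<And>j x. 0 < a' j x" "\<And>j. tint (a' j) = tint (a j)"
        "\<And>j k x r. a' j (x + r *\<^sub>R axis k 1) = a' j x" "tint (P a) \<le> tint (P a')"
    by blast
  have const: "a' j x = a' j 0" for j x
  proof -
    have "a' j (\<Sum>i\<in>S. x $ i *\<^sub>R axis i 1) = a' j 0" if "finite S" for S
      using that
    proof (induction S)
      case (insert i S)
      then show ?case using a'(4)[of j "\<Sum>i\<in>S. x $ i *\<^sub>R axis i 1" "x $ i" i] by (simp add: add.commute)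
    qed simp
    from this[of UNIV] show ?thesis using basis_expansion[of x] by (simp add: scalar_mult_eq_scaleR)
  qed
  have "tint (a' j) = tint (\<lambda>x::real^'d. a' j 0)" for j
    by (intro integral_cong) (rule const)
  then have "tint (a' j) = a' j 0" for j by (simp only: tint_const)
  moreover have "tint (P a') = tint (\<lambda>x::real^'d. P a' 0)"
    unfolding P_def by (intro integral_cong prod.cong refl arg_cong[where f="\<lambda>y. y powr _"] const)
  then have "tint (P a') = P a' 0" by (simp only: tint_const)
  ultimately have "tint (P a') = (\<Prod>j\<in>UNIV. tint (a j) powr (1/n))"
    using a'(3) by (simp add: P_def)
  with a'(5) show ?thesis by (simp add: P_def)
qed

text \<open>Along the segment from \<open>x\<close> to \<open>x + s *\<^sub>R axis j 1\<close> the
  function drops by at most the integral of \<open>\<bar>F'\<bar>\<close> over a full period,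
  whatever \<open>s\<close>; then average over \<open>s\<close>.\<close>

lemma le_avg_add_abs_derivative:
  assumes F: "cper F" and F': "cper F'"
    and d: "\<And>x. ((\<lambda>s. F (x + s *\<^sub>R axis j 1)) has_real_derivative F' x) (at 0)"
  shows "F x \<le> avg j (\<lambda>x. F x + \<bar>F' x\<bar>) x"
proof -
  let ?e = "axis j 1"
  let ?B = "integral {0..1} (\<lambda>s. \<bar>F' (x + s *\<^sub>R ?e)\<bar>)"
  have le: "F x - ?B \<le> F (x + s *\<^sub>R ?e)" if s: "s \<in> {0..1}" for s
  proof -
    have "((\<lambda>s. F' (x + s *\<^sub>R ?e)) has_integral F (x + s *\<^sub>R ?e) - F (x + 0 *\<^sub>R ?e)) {0..s}"
      using s by (intro fundamental_theorem_of_calculus)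
         (auto simp: has_real_derivative_iff_has_vector_derivative[symmetric] intro!: line_derivative_shift d)
    then have "F x - F (x + s *\<^sub>R ?e) = integral {0..s} (\<lambda>s. - F' (x + s *\<^sub>R ?e))"
      by (simp add: integral_unique)
    also have "\<dots> \<le> integral {0..s} (\<lambda>s. \<bar>F' (x + s *\<^sub>R ?e)\<bar>)"
      by (intro integral_le line_integrable[of "\<lambda>x. - F' x"] line_integrable[of "\<lambda>x. \<bar>F' x\<bar>"] cper_intros F') auto
    also have "\<dots> \<le> ?B"
      using s by (intro integral_subset_le line_integrable[of "\<lambda>x. \<bar>F' x\<bar>"] cper_intros F') auto
    finally show ?thesis by simp
  qed
  have "integral {0..1} (\<lambda>s::real. F x - ?B) \<le> integral {0..1} (\<lambda>s. F (x + s *\<^sub>R ?e))"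
    by (intro integral_le line_integrable[OF F] integrable_const_ivl le) auto
  then have "F x \<le> integral {0..1} (\<lambda>s. F (x + s *\<^sub>R ?e)) + ?B" by simp
  also have "\<dots> = avg j (\<lambda>x. F x + \<bar>F' x\<bar>) x"
    unfolding avg_def
    by (rule integral_add[symmetric]) (intro line_integrable[of F] line_integrable[of "\<lambda>x. \<bar>F' x\<bar>"] cper_intros F F')+
  finally show ?thesis .
qed

text \<open>Each of the \<open>CARD('d)\<close> averages \<open>a j\<close> dominates
  \<open>F\<close>, so \<open>F powr (CARD('d) / n)\<close> is at most the product of the
  \<open>a j powr (1/n)\<close>, and \<open>Loomis_Whitney_torus\<close> applies to that
  product.\<close>

theorem Gagliardo_Nirenberg_Sobolev_torus:
  fixes F :: "real^'d \<Rightarrow> real"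
  assumes F: "cper F" "\<And>x. 0 < F x" and F': "\<And>j. cper (F' j)"
    and d: "\<And>j x. ((\<lambda>s. F (x + s *\<^sub>R axis j 1)) has_real_derivative F' j x) (at 0)"
    and card: "2 \<le> CARD('d)" and n: "n = real CARD('d) - 1"
  shows "tint (\<lambda>x. F x powr (real CARD('d) / n)) \<le> (\<Prod>j\<in>UNIV. tint (\<lambda>x. F x + \<bar>F' j x\<bar>) powr (1/n))"
proof -
  define a where "a j = avg j (\<lambda>x. F x + \<bar>F' j x\<bar>)" for j
  have c: "cper (\<lambda>x. F x + \<bar>F' j x\<bar>)" for j by (intro cper_intros F F')
  have n0: "n > 0" using card n by simp
  have le: "F x \<le> a j x" for j x unfolding a_def by (rule le_avg_add_abs_derivative[OF F(1) F' d])
  have ca: "cper (a j)" for j unfolding a_def by (intro cper_avg c)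
  have pa: "0 < a j x" for j x using F(2)[of x] le[of x j] by simp
  have "tint (\<lambda>x. F x powr (real CARD('d) / n)) \<le> tint (\<lambda>x. \<Prod>j\<in>UNIV. a j x powr (1/n))"
  proof (rule tint_mono)
    fix x
    have "F x powr (real CARD('d) / n) = (\<Prod>j\<in>(UNIV::'d set). F x powr (1/n))"
      using F(2)[of x] by (simp add: powr_power)
    also have "\<dots> \<le> (\<Prod>j\<in>UNIV. a j x powr (1/n))"
      using n0 F(2)[of x] by (intro prod_mono) (auto intro!: powr_mono2 le)
    finally show "F x powr (real CARD('d) / n) \<le> (\<Prod>j\<in>UNIV. a j x powr (1/n))" .
  qed (intro cper_powr cper_prod F ca pa)+
  also have "\<dots> \<le> (\<Prod>j\<in>UNIV. tint (a j) powr (1/n))"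
    by (rule Loomis_Whitney_torus[OF ca pa _ card n]) (simp add: a_def avg_shift c)
  also have "\<dots> = (\<Prod>j\<in>UNIV. tint (\<lambda>x. F x + \<bar>F' j x\<bar>) powr (1/n))"
    by (simp add: a_def tint_avg c)
  finally show ?thesis .
qed

lemma tint_Cauchy_Schwarz_pos:
  assumes f: "cper f" "\<And>x. 0 < f x" and g: "cper g" "\<And>x. 0 < g x"
  shows "tint (\<lambda>x. f x * g x) \<le> sqrt (tint (\<lambda>x. f x ^ 2)) * sqrt (tint (\<lambda>x. g x ^ 2))"
proof -
  have fpos: "f x \<noteq> 0" and gpos: "g x \<noteq> 0" for x using f(2)[of x] g(2)[of x] by simp_all
  have "(f x ^ 2) powr (1/2) = f x" "(g x ^ 2) powr (1/2) = g x" for x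
    using f(2)[of x] g(2)[of x] by (simp_all add: powr_half_sqrt less_imp_le)
  then have "tint (\<lambda>x. f x * g x) = tint (\<lambda>x. (f x ^ 2) powr (1/2) * (g x ^ 2) powr (1 - 1/2))" by simp
  also have "\<dots> \<le> tint (\<lambda>x. f x ^ 2) powr (1/2) * tint (\<lambda>x. g x ^ 2) powr (1 - 1/2)"
    by (rule Holder_tint) (auto intro!: cper_intros f g simp: fpos gpos)
  also have "\<dots> = sqrt (tint (\<lambda>x. f x ^ 2)) * sqrt (tint (\<lambda>x. g x ^ 2))"
    by (simp add: powr_half_sqrt tint_nonneg cper_power f g)
  finally show ?thesis .
qed

text \<open>The Sobolev inequality is applied to a power of \<open>f\<close> chosen so that the left-hand side
  becomes the integral of \<open>f powr (2 + 4/d)\<close>; the remaining power on the right interpolates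
  between that exponent and \<open>2\<close> and is absorbed.\<close>
theorem Gagliardo_Nirenberg_torus:
  fixes f :: "real^'d \<Rightarrow> real"
  assumes f: "cper f" "\<And>x. 0 < f x" and f': "\<And>j. cper (f' j)"
    and d: "\<And>j x. ((\<lambda>s. f (x + s *\<^sub>R axis j 1)) has_real_derivative f' j x) (at 0)"
    and card: "2 \<le> CARD('d)" and N: "N = real CARD('d)"
  shows "tint (\<lambda>x. f x powr (2 + 4/N)) \<le>
    18 * tint (\<lambda>x. f x ^ 2) powr (2/N) * (tint (\<lambda>x. f x ^ 2) + tint (\<lambda>x. \<Sum>j\<in>UNIV. f' j x ^ 2))"
proof -
  define n where "n = N - 1"
  \<comment> \<open>The solution of \<open>\<gamma> * N / n = 2 + 4/N\<close>; indeed
    \<open>\<gamma> * N^2 = 2 * (N + 2) * (N - 1)\<close>.\<close>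
  define \<gamma> where "\<gamma> = 2 + 2/N - 4/N^2"
  define X where "X = tint (\<lambda>x. f x ^ 2)"
  define Y where "Y = tint (\<lambda>x. \<Sum>j\<in>UNIV. f' j x ^ 2)"
  define Z where "Z = tint (\<lambda>x. f x powr (2 + 4/N))"
  define W where "W = tint (\<lambda>x. f x powr (2*\<gamma> - 2))"
  have N2: "N \<ge> 2" using card N by simp
  have nz: "f x \<noteq> 0" for x using f(2)[of x] by simp
  have n0: "n > 0" using N2 by (simp add: n_def)
  have \<gamma>: "2 \<le> \<gamma>" "\<gamma> \<le> 3"
  proof -
    have "\<gamma> = 2 + 2 * (N - 2) / N^2" using N2 by (simp add: \<gamma>_def field_simps power2_eq_square)
    moreover have "2 * (N - 2) / N^2 \<ge> 0" using N2 by simp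
    moreover have "2 * (N - 2) \<le> 1 * N^2" using zero_le_power2[of "N - 1"] by (simp add: power2_eq_square algebra_simps)
    then have "2 * (N - 2) / N^2 \<le> 1" using N2 by (simp add: divide_le_eq)
    ultimately show "2 \<le> \<gamma>" "\<gamma> \<le> 3" by auto
  qed
  have XZ: "0 < X" "0 < Z" "0 < W" unfolding X_def Z_def W_def
    by (auto intro!: tint_pos cper_powr cper_power f simp: nz)
  have Y: "0 \<le> Y" unfolding Y_def by (auto intro!: tint_nonneg cper_intros f' sum_nonneg)
  define F' where "F' j x = \<gamma> * f x powr (\<gamma> - 1) * f' j x" for j x
  have cF': "cper (F' j)" for j unfolding F'_def[abs_def] by (intro cper_intros cper_powr f f')
  have dF: "((\<lambda>s. f (x + s *\<^sub>R axis j 1) powr \<gamma>) has_real_derivative F' j x) (at 0)" for j x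
    unfolding F'_def using DERIV_fun_powr[OF d[of x j], of \<gamma>] f(2)[of x] by (simp add: mult_ac)
  have "Z = tint (\<lambda>x. (f x powr \<gamma>) powr (real CARD('d) / n))"
  proof -
    have "\<gamma> * (N / n) = 2 + 4/N"
    proof -
      have "\<gamma> * N^2 = (2 * N + 4) * n"
        using N2 by (simp add: \<gamma>_def n_def field_simps power2_eq_square)
      then show ?thesis using N2 n0 by (simp add: field_simps power2_eq_square)
    qed
    then show ?thesis by (simp add: Z_def powr_powr N)
  qed
  also have "\<dots> \<le> (\<Prod>j\<in>UNIV. tint (\<lambda>x. f x powr \<gamma> + \<bar>F' j x\<bar>) powr (1/n))"
    by (rule Gagliardo_Nirenberg_Sobolev_torus[OF _ _ cF' dF card])
       (use f n_def N in \<open>auto intro!: cper_powr simp: nz\<close>)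
  also have "\<dots> \<le> (\<Prod>j\<in>(UNIV::'d set). (3 * (sqrt W * sqrt (2 * (X + Y)))) powr (1/n))"
  proof (intro prod_mono conjI powr_mono2)
    fix j :: 'd
    have c1: "cper (\<lambda>x. f x powr \<gamma> + \<bar>F' j x\<bar>)" by (intro cper_intros cper_powr f cF')
    show "0 \<le> tint (\<lambda>x. f x powr \<gamma> + \<bar>F' j x\<bar>)" by (rule tint_nonneg[OF c1]) simp
    have "tint (\<lambda>x. f x powr \<gamma> + \<bar>F' j x\<bar>) \<le> tint (\<lambda>x. \<gamma> * (f x powr (\<gamma> - 1) * (f x + \<bar>f' j x\<bar>)))"
    proof (rule tint_mono[OF c1])
      show "cper (\<lambda>x. \<gamma> * (f x powr (\<gamma> - 1) * (f x + \<bar>f' j x\<bar>)))" by (intro cper_intros cper_powr f f')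
      fix x
      have "f x powr \<gamma> = f x powr (\<gamma> - 1) * f x" using powr_mult_base[of "f x" "\<gamma> - 1"] f(2)[of x] by (simp add: mult.commute less_imp_le)
      moreover have "\<dots> \<le> \<gamma> * (f x powr (\<gamma> - 1) * f x)"
        using \<gamma> f(2)[of x] mult_right_mono[of 1 \<gamma> "f x powr (\<gamma> - 1) * f x"] by simp
      moreover have "\<bar>F' j x\<bar> = \<gamma> * (f x powr (\<gamma> - 1) * \<bar>f' j x\<bar>)" using \<gamma> by (simp add: F'_def abs_mult)
      ultimately show "f x powr \<gamma> + \<bar>F' j x\<bar> \<le> \<gamma> * (f x powr (\<gamma> - 1) * (f x + \<bar>f' j x\<bar>))"
        by (simp add: algebra_simps)
    qed
    also have "\<dots> = \<gamma> * tint (\<lambda>x. f x powr (\<gamma> - 1) * (f x + \<bar>f' j x\<bar>))" by (rule tint_cmult)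
    also have "\<dots> \<le> \<gamma> * (sqrt (tint (\<lambda>x. (f x powr (\<gamma> - 1))^2)) * sqrt (tint (\<lambda>x. (f x + \<bar>f' j x\<bar>)^2)))"
      using \<gamma>
      by (intro mult_left_mono tint_Cauchy_Schwarz_pos cper_intros cper_powr f f')
         (auto simp: nz f intro: add_pos_nonneg)
    also have "tint (\<lambda>x. (f x powr (\<gamma> - 1))^2) = W"
      by (simp add: W_def powr_power algebra_simps nz)
    also have "tint (\<lambda>x. (f x + \<bar>f' j x\<bar>)^2) \<le> tint (\<lambda>x. 2 * (f x ^ 2 + (\<Sum>j\<in>UNIV. f' j x ^ 2)))"
    proof (rule tint_mono)
      fix x
      have le: "(f x + \<bar>f' j x\<bar>)^2 \<le> 2 * (f x ^ 2 + f' j x ^ 2)"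
        using zero_le_power2[of "f x - \<bar>f' j x\<bar>"] by (simp add: power2_eq_square algebra_simps)
      have "f' j x ^ 2 \<le> (\<Sum>j\<in>UNIV. f' j x ^ 2)" by (rule member_le_sum) auto
      then show "(f x + \<bar>f' j x\<bar>)^2 \<le> 2 * (f x ^ 2 + (\<Sum>j\<in>UNIV. f' j x ^ 2))"
        by (intro order_trans[OF le]) simp
    qed (intro cper_intros f f')+
    also have "\<dots> = 2 * (X + Y)"
      unfolding X_def Y_def tint_cmult by (subst tint_add) (intro cper_intros f f' refl)+
    finally have "tint (\<lambda>x. f x powr \<gamma> + \<bar>F' j x\<bar>) \<le> \<gamma> * (sqrt W * sqrt (2 * (X + Y)))"
      using \<gamma> XZ by (auto intro: order_trans mult_left_mono)
    also have "\<dots> \<le> 3 * (sqrt W * sqrt (2 * (X + Y)))"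
      using \<gamma> XZ Y by (intro mult_right_mono) auto
    finally show "tint (\<lambda>x. f x powr \<gamma> + \<bar>F' j x\<bar>) \<le> 3 * (sqrt W * sqrt (2 * (X + Y)))" .
  qed (use n0 in auto)
  also have "\<dots> = (3 * (sqrt W * sqrt (2 * (X + Y)))) powr (N / n)"
    using XZ Y by (simp add: powr_power N)
  finally have 1: "Z \<le> (3 * (sqrt W * sqrt (2 * (X + Y)))) powr (N / n)" .
  \<comment> \<open>\<open>2 * \<gamma> - 2\<close> is the convex combination of 2 and
    \<open>2 + 4/N\<close> with weights \<open>2/N\<close> and \<open>1 - 2/N\<close>.\<close>
  have "W \<le> X powr (2/N) * Z powr (1 - 2/N)"
  proof -
    have "f x powr (2*\<gamma> - 2) = (f x ^ 2) powr (2/N) * (f x powr (2 + 4/N)) powr (1 - 2/N)" for x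
    proof -
      have e1: "2*\<gamma> - 2 = 2 * (2/N) + (2 + 4/N) * (1 - 2/N)"
        using N2 by (simp add: \<gamma>_def field_simps power2_eq_square)
      have e2: "f x ^ 2 = f x powr 2" using f(2)[of x] by (simp add: powr_numeral)
      show ?thesis unfolding e1 e2 powr_powr by (rule powr_add)
    qed
    then show ?thesis
      unfolding W_def X_def Z_def
      using N2 by (simp only:) (intro Holder_tint cper_powr cper_power f; auto simp: nz)
  qed
  \<comment> \<open>The power \<open>2 * n / N\<close> turns the product of square roots into a
    square, whence \<open>18 = 3^2 * 2\<close>. Since \<open>2 * n / N = 1 + (1 - 2/N)\<close>, the
    factor \<open>Z powr (1 - 2/N)\<close> coming from \<open>W\<close> then cancels.\<close>
  then have "Z powr (2 * n / N) \<le> 18 * (X powr (2/N) * Z powr (1 - 2/N)) * (X + Y)"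
  proof -
    have "Z powr (2 * n / N) \<le> ((3 * (sqrt W * sqrt (2 * (X + Y)))) powr (N / n)) powr (2 * n / N)"
      using 1 XZ n0 N2 by (intro powr_mono2) auto
    also have "\<dots> = (3 * (sqrt W * sqrt (2 * (X + Y)))) powr 2" using n0 N2 by (simp add: powr_powr)
    also have "\<dots> = 18 * W * (X + Y)"
      using XZ Y by (simp add: powr_numeral power_mult_distrib)
    also have "\<dots> \<le> 18 * (X powr (2/N) * Z powr (1 - 2/N)) * (X + Y)"
      using \<open>W \<le> _\<close> XZ Y by (intro mult_right_mono mult_left_mono) auto
    finally show ?thesis .
  qed
  moreover have "2 * n / N = 1 + (1 - 2/N)" using N2 by (simp add: n_def field_simps)
  ultimately have "Z * Z powr (1 - 2/N) \<le> (18 * X powr (2/N) * (X + Y)) * Z powr (1 - 2/N)"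
    using XZ by (simp only: powr_add) (simp add: mult_ac)
  then have "Z \<le> 18 * X powr (2/N) * (X + Y)"
    by (rule mult_right_le_imp_le) (use XZ in simp)
  then show ?thesis by (simp add: X_def Y_def Z_def)
qed

subsection \<open>One-dimensional calculus and differential inequalities\<close>

lemma nonincreasing_within:
  fixes f :: "real \<Rightarrow> real"
  assumes d: "\<And>t. t \<in> {0..T} \<Longrightarrow> (f has_real_derivative f' t) (at t within {0..T})"
    and le: "\<And>t. t \<in> {0..T} \<Longrightarrow> f' t \<le> 0" and t: "t \<in> {0..T}"
  shows "f t \<le> f 0"
proof (rule DERIV_nonpos_imp_decreasing_open[of 0 t f])
  show "0 \<le> t" using t by simp
  have "continuous_on {0..T} f"
    unfolding continuous_on_eq_continuous_within by (intro ballI) (rule DERIV_continuous, rule d)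
  then show "continuous_on {0..t} f" by (rule continuous_on_subset) (use t in auto)
  fix x assume x: "0 < x" "x < t"
  then have "(f has_real_derivative f' x) (at x)"
    using d[of x] t by (simp add: at_within_Icc_at)
  then show "\<exists>y. (f has_real_derivative y) (at x) \<and> y \<le> 0" using le[of x] x t by auto
qed

text \<open>Only the time integral of \<open>a\<close> enters the conclusion; the energy estimates
  control such integrals, without a bound at single times.\<close>

lemma Gronwall:
  fixes X a :: "real \<Rightarrow> real"
  assumes d: "\<And>t. t \<in> {0..T} \<Longrightarrow> (X has_real_derivative X' t) (at t within {0..T})"
    and le: "\<And>t. t \<in> {0..T} \<Longrightarrow> X' t \<le> a t * X t"
    and a: "continuous_on {0..T} a" and t: "t \<in> {0..T}"
  shows "X t \<le> X 0 * exp (integral {0..t} a)"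
proof -
  define E where "E t = exp (- integral {0..t} a)" for t
  have "((\<lambda>t. X t * E t) has_real_derivative X' t * E t + - (a t) * E t * X t) (at t within {0..T})"
    if "t \<in> {0..T}" for t
    unfolding E_def
    by (rule derivative_eq_intros d that integral_has_real_derivative a refl)+ (simp add: algebra_simps)
  moreover have "X' t * E t + - (a t) * E t * X t \<le> 0" if "t \<in> {0..T}" for t
  proof -
    have "(X' t - a t * X t) * E t \<le> 0"
      using le[OF that] by (intro mult_nonpos_nonneg) (auto simp: E_def)
    then show ?thesis by (simp add: algebra_simps)
  qed
  ultimately have "X t * E t \<le> X 0 * E 0" by (rule nonincreasing_within[OF _ _ t])
  then show ?thesis by (simp add: E_def exp_minus field_simps)
qed

text \<open>The damping makes the bound affine in the forcing \<open>B\<close>; an exponential of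
  \<open>B\<close> would destroy the power of \<open>\<parallel>Du\<parallel>\<close> that is to be
  reached.\<close>

lemma Gronwall_damped:
  fixes X :: "real \<Rightarrow> real"
  assumes d: "\<And>t. t \<in> {0..T} \<Longrightarrow> (X has_real_derivative X' t) (at t within {0..T})"
    and le: "\<And>t. t \<in> {0..T} \<Longrightarrow> X' t + c * X t \<le> B" and c: "c > 0" and B: "B \<ge> 0" and t: "t \<in> {0..T}"
  shows "X t \<le> max 0 (X 0) + B / c"
proof -
  have "((\<lambda>t. exp (c * t) * (X t - B / c)) has_real_derivative
      exp (c * t) * X' t + exp (c * t) * c * (X t - B / c)) (at t within {0..T})" if "t \<in> {0..T}" for t
    by (rule derivative_eq_intros d that refl)+ (simp add: algebra_simps)
  moreover have "exp (c * t) * X' t + exp (c * t) * c * (X t - B / c) \<le> 0" if "t \<in> {0..T}" for t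
  proof -
    have "exp (c * t) * (X' t + c * X t - B) \<le> 0" using le[OF that] by (intro mult_nonneg_nonpos) auto
    then show ?thesis using c by (simp add: algebra_simps)
  qed
  ultimately have "exp (c * t) * (X t - B / c) \<le> exp (c * 0) * (X 0 - B / c)"
    by (rule nonincreasing_within[OF _ _ t])
  also have "\<dots> \<le> exp (c * t) * max 0 (X 0)"
  proof -
    have "X 0 - B / c \<le> max 0 (X 0)" using B c by (simp add: add_increasing2 max.coboundedI2)
    also have "\<dots> \<le> exp (c * t) * max 0 (X 0)"
      using c t mult_right_mono[of 1 "exp (c * t)" "max 0 (X 0)"] by simp
    finally show ?thesis by simp
  qed
  finally have "X t - B / c \<le> max 0 (X 0)" by simp
  then show ?thesis by simp
qed

lemma second_derivative_nonneg_at_min: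
  fixes f :: "real \<Rightarrow> real"
  assumes d: "\<And>s. (f has_real_derivative f' s) (at s)" and d2: "(f' has_real_derivative D) (at 0)"
    and min: "\<And>s. f 0 \<le> f s"
  shows "0 \<le> D" "f' 0 = 0"
proof -
  show f'0: "f' 0 = 0" by (rule DERIV_local_min[OF d, of 1]) (use min in auto)
  show "0 \<le> D"
  proof (rule ccontr)
    assume "\<not> 0 \<le> D"
    then obtain e where e: "e > 0" "\<And>h. 0 < h \<Longrightarrow> h < e \<Longrightarrow> f' h < f' 0"
      using DERIV_neg_dec_right[OF d2] by force
    obtain z where "0 < z" "z < e / 2" "f (e / 2) - f 0 = (e / 2 - 0) * f' z"
      using MVT2[of 0 "e / 2" f f'] d e by auto
    moreover have "f' z < 0" using e(2)[of z] calculation e f'0 by simp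
    ultimately show False using min[of "e / 2"] e by (smt (verit) half_gt_zero mult_pos_neg)
  qed
qed

text \<open>Young's inequality with an arbitrarily small coefficient. Compare \<open>b\<close> with
  \<open>N * a\<close>, where \<open>N powr (- (1 - k)) = \<delta>\<close>: if
  \<open>b \<le> N * a\<close> the product is at most \<open>C * a\<close>, otherwise at most
  \<open>\<delta> * b\<close>.\<close>

lemma powr_interpolation_absorb:
  fixes \<delta> k :: real
  assumes \<delta>: "\<delta> > 0" and k: "0 \<le> k" "k < 1"
  obtains C where "C > 0" "\<And>a b. 0 < a \<Longrightarrow> 0 < b \<Longrightarrow> a powr (1 - k) * b powr k \<le> \<delta> * b + C * a"
proof -
  define N where "N = \<delta> powr (- 1 / (1 - k))"
  have N: "N > 0" using \<delta> by (simp add: N_def)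
  have "a powr (1 - k) * b powr k \<le> \<delta> * b + N powr k * a" if ab: "0 < a" "0 < b" for a b
  proof (cases "b \<le> N * a")
    case True
    then have "a powr (1 - k) * b powr k \<le> a powr (1 - k) * (N * a) powr k"
      using ab k by (intro mult_left_mono powr_mono2) auto
    also have "\<dots> = N powr k * (a powr (1 - k) * a powr k)" using ab N by (simp add: powr_mult)
    also have "\<dots> = N powr k * a" using ab by (simp add: powr_add[symmetric])
    finally show ?thesis using ab \<delta> by (simp add: add_increasing)
  next
    case False
    then have "a \<le> b / N" using N by (simp add: field_simps)
    then have "a powr (1 - k) * b powr k \<le> (b / N) powr (1 - k) * b powr k"
      using ab k by (intro mult_right_mono powr_mono2) auto
    also have "\<dots> = N powr (- (1 - k)) * (b powr (1 - k) * b powr k)"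
      using ab N by (simp only: powr_divide powr_minus_divide) simp
    also have "\<dots> = N powr (- (1 - k)) * b" using ab by (simp add: powr_add[symmetric])
    also have "N powr (- (1 - k)) = \<delta>"
    proof -
      have "- 1 / (1 - k) * - (1 - k) = 1" using k by (simp add: field_simps)
      then show ?thesis using \<delta> by (simp only: N_def powr_powr) simp
    qed
    finally show ?thesis using ab N by (simp add: add_increasing2)
  qed
  then show ?thesis using that[of "N powr k"] N by simp
qed

lemma tint_has_real_derivative:
  fixes F :: "real^'d \<Rightarrow> real \<Rightarrow> real"
  assumes d: "\<And>x t. t \<in> S \<Longrightarrow> ((\<lambda>s. F x s) has_real_derivative F' x t) (at t within S)"
    and F: "\<And>t. t \<in> S \<Longrightarrow> cper (\<lambda>x. F x t)"
    and F': "continuous_on (UNIV \<times> S) (\<lambda>(x, t). F' x t)"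
    and S: "convex S" "t \<in> S"
  shows "((\<lambda>t. tint (\<lambda>x. F x t)) has_real_derivative tint (\<lambda>x. F' x t)) (at t within S)"
  unfolding torus_cell_def
proof (rule leibniz_rule_field_derivative[where f="\<lambda>t x. F x t" and fx="\<lambda>t x. F' x t"])
  show "(\<lambda>x. F x t) integrable_on cbox 0 One" if "t \<in> S" for t
    using tint_integrable[OF F[OF that]] by (simp add: torus_cell_def)
  have "continuous_on (S \<times> cbox 0 One) (\<lambda>z. (\<lambda>(x, t). F' x t) (snd z, fst z))"
    by (intro continuous_on_compose2[OF F'] continuous_intros) auto
  then show "continuous_on (S \<times> cbox 0 One) (\<lambda>(t, x). F' x t)" by (simp add: case_prod_beta)
qed (use d S in auto)

lemma tint_continuous_on:
  fixes F :: "real^'d \<Rightarrow> 'a::euclidean_space \<Rightarrow> real"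
  assumes F: "continuous_on (UNIV \<times> S) (\<lambda>(x, t). F x t)"
  shows "continuous_on S (\<lambda>t. tint (\<lambda>x. F x t))"
  unfolding torus_cell_def
proof (rule integral_continuous_on_param[where f="\<lambda>t x. F x t"])
  have "continuous_on (S \<times> cbox 0 One) (\<lambda>z. (\<lambda>(x, t). F x t) (snd z, fst z))"
    by (intro continuous_on_compose2[OF F] continuous_intros) auto
  then show "continuous_on (S \<times> cbox 0 One) (\<lambda>(t, x). F x t)" by (simp add: case_prod_beta)
qed

subsection \<open>The weak parabolic minimum principle\<close>

text \<open>At a negative minimum of the discounted function the space gradient vanishes and the
  second derivatives are nonnegative, so the zero-order term forces a strictly positive time
  derivative and slightly earlier values would be smaller. Time 0 is excluded by
  \<open>init\<close>.\<close>

lemma parabolic_min_principle: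
  fixes v :: "real^'d \<Rightarrow> real \<Rightarrow> real"
  assumes cont: "continuous_on (UNIV \<times> {0..T}) (\<lambda>(x, t). v x t)"
    and per: "\<And>t. t \<in> {0..T} \<Longrightarrow> periodic (\<lambda>x. v x t)"
    and dt: "\<And>x t. t \<in> {0..T} \<Longrightarrow> ((\<lambda>s. v x s) has_real_derivative vt x t) (at t within {0..T})"
    and d1: "\<And>x t j. t \<in> {0..T} \<Longrightarrow> ((\<lambda>s. v (x + s *\<^sub>R axis j 1) t) has_real_derivative v1 j x t) (at 0)"
    and d2: "\<And>x t j. t \<in> {0..T} \<Longrightarrow> ((\<lambda>s. v1 j (x + s *\<^sub>R axis j 1) t) has_real_derivative v2 j x t) (at 0)"
    and ge: "\<And>x t. t \<in> {0..T} \<Longrightarrow> vt x t \<ge> (\<Sum>j\<in>UNIV. v2 j x t) + (\<Sum>j\<in>UNIV. b j x t * v1 j x t) + c x t * v x t"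
    and c: "\<And>x t. t \<in> {0..T} \<Longrightarrow> c x t \<le> K"
    and init: "\<And>x. 0 \<le> v x 0" and t: "t \<in> {0..T}"
  shows "0 \<le> v x t"
proof -
  \<comment> \<open>A discount rate above the bound \<open>K\<close> makes the zero-order
    coefficient \<open>c - k\<close> strictly negative.\<close>
  define k where "k = K + 1"
  define w where "w = (\<lambda>(x, t). exp (- k * t) * v x t)"
  have cw: "continuous_on (torus_cell \<times> {0..T}) w"
    unfolding w_def case_prod_beta
    by (intro continuous_intros continuous_on_subset[OF cont[unfolded case_prod_beta]]) auto
  have "compact (torus_cell \<times> {0..T})" by (intro compact_Times compact_torus_cell) simp
  moreover have "torus_cell \<times> {0..T} \<noteq> ({} :: ((real^'d) \<times> real) set)"
    using zero_in_torus_cell t by auto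
  ultimately obtain z0 where z0: "z0 \<in> torus_cell \<times> {0..T}" "\<And>z. z \<in> torus_cell \<times> {0..T} \<Longrightarrow> w z0 \<le> w z"
    using continuous_attains_inf[OF _ _ cw] by blast
  obtain x0 t0 where x0: "z0 = (x0, t0)" by (cases z0)
  have t0: "t0 \<in> {0..T}" using z0 x0 by auto
  have min: "w (x0, t0) \<le> w (x, t)" if t: "t \<in> {0..T}" for x t
  proof -
    obtain y where "y \<in> torus_cell" "v x t = v y t"
      using torus_cell_representative[where x=x and 'b=real] per[OF t] by metis
    then show ?thesis using z0(2)[of "(y, t)"] t by (simp add: w_def x0)
  qed
  have "0 \<le> w (x0, t0)"
  proof (rule ccontr)
    assume neg: "\<not> 0 \<le> w (x0, t0)"
    then have v0: "v x0 t0 < 0" by (simp add: w_def zero_le_mult_iff)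
    have vmin: "v x0 t0 \<le> v x t0" for x using min[OF t0, of x] by (simp add: w_def)
    have s: "((\<lambda>s. v (x0 + s *\<^sub>R axis j 1) t0) has_real_derivative v1 j (x0 + s *\<^sub>R axis j 1) t0) (at s)" for j s
      by (rule line_derivative_shift[OF d1[OF t0]])
    have "0 \<le> v2 j x0 t0" "v1 j x0 t0 = 0" for j
      using second_derivative_nonneg_at_min[OF s[of j] d2[OF t0, of j x0]] vmin by simp_all
    then have "vt x0 t0 \<ge> c x0 t0 * v x0 t0"
      using ge[OF t0, of x0] sum_nonneg[of UNIV "\<lambda>j. v2 j x0 t0"] by simp
    moreover have "c x0 t0 * v x0 t0 > k * v x0 t0" using c[OF t0, of x0] v0 by (simp add: k_def)
    ultimately have pos: "exp (- k * t0) * (vt x0 t0 - k * v x0 t0) > 0" by simp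
    have D: "((\<lambda>s. exp (- k * s) * v x0 s) has_real_derivative exp (- k * t0) * (vt x0 t0 - k * v x0 t0)) (at t0 within {0..T})"
      by (rule derivative_eq_intros dt t0 refl)+ (simp add: algebra_simps)
    obtain d where d: "d > 0" "\<And>h. 0 < h \<Longrightarrow> t0 - h \<in> {0..T} \<Longrightarrow> h < d \<Longrightarrow> w (x0, t0 - h) < w (x0, t0)"
      using has_real_derivative_pos_inc_left[OF D pos] unfolding w_def by auto
    have "t0 \<noteq> 0" using init[of x0] v0 by auto
    then have "t0 > 0" using t0 by simp
    define h where "h = min (d / 2) t0"
    have "0 < h" "h < d" "t0 - h \<in> {0..T}" using d \<open>t0 > 0\<close> t0 by (auto simp: h_def min_def)
    then show False using d(2)[of h] min[of "t0 - h" x0] by force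
  qed
  then have "0 \<le> w (x, t)" using min[OF t, of x] by linarith
  then show ?thesis by (simp add: w_def zero_le_mult_iff)
qed

subsection \<open>Convolution with a symmetric kernel\<close>

text \<open>Integration is over a compact box, in the application one that contains the support of
  the mollifier, so that integrals of continuous functions exist and can be exchanged. Apart from
  continuity the estimates use only positivity, symmetry and unit mass, which is why they do not see
  \<epsilon>.\<close>

locale sym_kernel =
  fixes k :: "real^'d \<Rightarrow> real" and r :: "real^'d"
  assumes cont: "continuous_on UNIV k" and nonneg: "\<And>y. 0 \<le> k y" and even: "\<And>y. k (- y) = k y"
    and int: "integral (cbox (- r) r) k = 1"
begin

definition conv :: "(real^'d \<Rightarrow> real) \<Rightarrow> real^'d \<Rightarrow> real" where
  "conv f x = integral (cbox (- r) r) (\<lambda>y. k y * f (x - y))"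

lemma conv_continuous: "cper f \<Longrightarrow> continuous_on S (\<lambda>y. k y * f (x - y))"
  by (intro continuous_intros continuous_on_subset[OF cont] continuous_on_compose2[OF cper_cont[of f UNIV]]) auto

lemma conv_integrable: "cper f \<Longrightarrow> (\<lambda>y. k y * f (x - y)) integrable_on cbox (- r) r"
  by (intro integrable_continuous conv_continuous)

lemma cper_conv:
  assumes f: "cper f"
  shows "cper (conv f)"
proof (rule cperI)
  show "continuous_on UNIV (conv f)"
    unfolding conv_def[abs_def]
    by (rule integral_continuous_on_param)
       (auto simp: case_prod_beta intro!: continuous_intros continuous_on_compose2[OF cont]
          continuous_on_compose2[OF cper_cont[OF f, of UNIV]])
  have "f (x + axis i 1 - y) = f (x - y)" for x i y
    using cper_per[OF f, of "x - y" i] by (simp add: algebra_simps)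
  then show "conv f (x + axis i 1) = conv f x" for i x by (simp add: conv_def)
qed

lemma conv_const: "conv (\<lambda>x. c) x = c"
  by (simp add: conv_def int)

lemma conv_mono:
  assumes "cper f" "cper g" "\<And>x. f x \<le> g x"
  shows "conv f x \<le> conv g x"
  unfolding conv_def by (intro integral_le conv_integrable assms mult_left_mono nonneg)

lemma conv_shift: "conv (\<lambda>x. f (x + h)) x = conv f (x + h)"
  by (simp add: conv_def algebra_simps)

lemma conv_cmult: "conv (\<lambda>x. c * f x) x = c * conv f x"
  by (simp add: conv_def mult.left_commute)

lemma conv_add: "cper f \<Longrightarrow> cper g \<Longrightarrow> conv (\<lambda>x. f x + g x) x = conv f x + conv g x"
  unfolding conv_def by (simp add: distrib_left integral_add[OF conv_integrable conv_integrable])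

lemma conv_pos:
  assumes f: "cper f" "\<And>x. 0 < f x"
  shows "0 < conv f x"
proof -
  obtain x0 where x0: "\<And>x. f x0 \<le> f x" using cper_attains_min[OF f(1)] by auto
  have "conv (\<lambda>_. f x0) x \<le> conv f x" by (intro conv_mono cper_const f x0)
  with f(2)[of x0] show ?thesis by (simp add: conv_const)
qed

text \<open>Exchange the integrals, translate in \<open>x\<close> by \<open>y\<close>, and reflect
  \<open>y\<close>, which is where evenness of \<open>k\<close> enters.\<close>

lemma conv_self_adjoint:
  assumes f: "cper f" and g: "cper g"
  shows "tint (\<lambda>x. conv f x * g x) = tint (\<lambda>x. f x * conv g x)"
proof -
  let ?B = "cbox (- r) r"
  have c: "continuous_on UNIV (\<lambda>(x, y). k y * f (x - y) * g x)" "continuous_on UNIV (\<lambda>(x, y). f x * (k y * g (x + y)))"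
    unfolding case_prod_beta
    by (intro continuous_intros continuous_on_compose2[OF cont] continuous_on_compose2[OF cper_cont[OF f, of UNIV]]
       continuous_on_compose2[OF cper_cont[OF g, of UNIV]]; simp)+
  have "tint (\<lambda>x. conv f x * g x) = tint (\<lambda>x. integral ?B (\<lambda>y. k y * f (x - y) * g x))"
    by (simp add: conv_def)
  also have "\<dots> = integral ?B (\<lambda>y. tint (\<lambda>x. k y * f (x - y) * g x))" by (rule tint_swap[OF c(1)])
  also have "\<dots> = integral ?B (\<lambda>y. tint (\<lambda>x. f x * (k y * g (x + y))))"
  proof (rule integral_cong)
    fix y
    have h: "cper (\<lambda>x. k y * f (x - y) * g x)" by (intro cper_intros f g)
    show "tint (\<lambda>x. k y * f (x - y) * g x) = tint (\<lambda>x. f x * (k y * g (x + y)))"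
      using tint_shift[OF h, of y] by (simp add: mult_ac)
  qed
  also have "\<dots> = tint (\<lambda>x. integral ?B (\<lambda>y. f x * (k y * g (x + y))))" by (rule tint_swap[OF c(2), symmetric])
  also have "\<dots> = tint (\<lambda>x. f x * conv g x)"
  proof (rule integral_cong)
    fix x
    have "integral ?B (\<lambda>y. k y * g (x + y)) = conv g x"
      using integral_reflect[of r "- r" "\<lambda>y. k y * g (x - y)"] by (simp add: even conv_def)
    then show "integral ?B (\<lambda>y. f x * (k y * g (x + y))) = f x * conv g x" by simp
  qed
  finally show ?thesis .
qed

lemma tint_conv: "cper f \<Longrightarrow> tint (conv f) = tint f"
  using conv_self_adjoint[of f "\<lambda>_. 1"] by (simp add: cper_const conv_const)

text \<open>With \<open>F\<close> the value of the convolution at the fixed point, Young's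
  inequality bounds \<open>F powr (p - 1) * f y\<close> by \<open>f y powr p\<close> and the
  constant \<open>F powr p\<close>. Convolving in \<open>y\<close> reproduces
  \<open>F powr p\<close> on the left, and unit mass lets the constant be absorbed there.\<close>

lemma conv_Jensen:
  assumes f: "cper f" "\<And>x. 0 < f x" and p: "1 \<le> p"
  shows "conv f x powr p \<le> conv (\<lambda>x. f x powr p) x"
proof -
  define F where "F = conv f x"
  have F: "0 < F" unfolding F_def by (rule conv_pos[OF f])
  have nz: "f x \<noteq> 0" for x using f(2)[of x] by simp
  have c: "cper (\<lambda>x. f x powr p)" by (intro cper_powr f)
  have "F powr p = conv (\<lambda>y. F powr (p - 1) * f y) x"
    using powr_mult_base[of F "p - 1"] F by (simp only: conv_cmult F_def[symmetric]) (simp add: mult.commute less_imp_le)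
  also have "\<dots> \<le> conv (\<lambda>y. (1/p) * f y powr p + (1 - 1/p) * F powr p) x"
  proof (rule conv_mono)
    fix y
    have "(f y powr p) powr (1/p) * (F powr p) powr (1 - 1/p) \<le> (1/p) * f y powr p + (1 - 1/p) * F powr p"
      using p f(2)[of y] F by (intro Youngs_inequality_0) auto
    moreover have "p * (1 - 1/p) = p - 1" using p by (simp add: field_simps)
    ultimately show "F powr (p - 1) * f y \<le> (1/p) * f y powr p + (1 - 1/p) * F powr p"
      using p f(2)[of y] by (simp add: powr_powr mult.commute)
  qed (intro cper_intros c f)+
  also have "\<dots> = conv (\<lambda>y. (1/p) * f y powr p) x + conv (\<lambda>y. (1 - 1/p) * F powr p) x"
    by (intro conv_add cper_intros c)
  also have "\<dots> = (1/p) * conv (\<lambda>y. f y powr p) x + (1 - 1/p) * F powr p"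
    by (simp only: conv_const conv_cmult)
  finally have "(1/p) * F powr p \<le> (1/p) * conv (\<lambda>y. f y powr p) x" by (simp add: algebra_simps)
  then show ?thesis using p unfolding F_def by (simp add: divide_le_cancel)
qed

text \<open>Discrete form of the negativity of \<open>\<integral> m \<Delta>g\<^sub>\<epsilon>(m)\<close>: it only uses that \<open>z \<mapsto> z\<^sup>\<alpha>\<close> is monotone.\<close>
lemma tint_second_difference_le:
  assumes m: "cper m" "\<And>x. 0 < m x" and \<alpha>: "\<alpha> > 0"
  defines "G \<equiv> conv (\<lambda>y. conv m y powr \<alpha>)"
  shows "tint (\<lambda>x. m x * G (x + e)) + tint (\<lambda>x. m x * G (x - e)) \<le> 2 * tint (\<lambda>x. m x * G x)"
proof -
  define z where "z = conv m"
  define w where "w x = z x powr \<alpha>" for x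
  have z: "cper z" "\<And>x. 0 < z x" unfolding z_def by (auto intro: cper_conv conv_pos m)
  have w: "cper w" unfolding w_def[abs_def] by (intro cper_powr z)
  have G: "tint (\<lambda>x. m x * G (x + h)) = tint (\<lambda>x. z x * w (x + h))" for h
  proof -
    have "conv (\<lambda>x. w (x + h)) x = G (x + h)" for x
      unfolding G_def w_def z_def by (rule conv_shift)
    then show ?thesis
      using conv_self_adjoint[OF m(1) cper_shift[OF w, of h]] by (simp add: z_def)
  qed
  have "tint (\<lambda>x. z x * w (x - e)) = tint (\<lambda>x. z (x + e) * w x)"
    using tint_shift[of "\<lambda>x. z x * w (x - e)" e] by (simp add: cper_intros z w)
  moreover have "tint (\<lambda>x. z x * w x) = tint (\<lambda>x. z (x + e) * w (x + e))"
    using tint_shift[of "\<lambda>x. z x * w x" e] by (simp add: cper_intros z w)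
  \<comment> \<open>The claim is this inequality, expanded and rearranged by translations: the
    increments of \<open>z\<close> and of \<open>z powr \<alpha>\<close> have the same sign.\<close>
  moreover have "0 \<le> tint (\<lambda>x. (z (x + e) - z x) * (w (x + e) - w x))"
  proof (rule tint_nonneg)
    show "cper (\<lambda>x. (z (x + e) - z x) * (w (x + e) - w x))" by (intro cper_intros z w)
    fix x
    show "0 \<le> (z (x + e) - z x) * (w (x + e) - w x)"
      using powr_mono2[of \<alpha> "z x" "z (x + e)"] powr_mono2[of \<alpha> "z (x + e)" "z x"] z(2)[of x] z(2)[of "x + e"] \<alpha>
      by (cases "z x \<le> z (x + e)") (auto simp: w_def intro!: mult_nonneg_nonneg mult_nonpos_nonpos)
  qed
  moreover have "tint (\<lambda>x. (z (x + e) - z x) * (w (x + e) - w x)) =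
      (tint (\<lambda>x. z (x + e) * w (x + e)) - tint (\<lambda>x. z x * w (x + e))) - (tint (\<lambda>x. z (x + e) * w x) - tint (\<lambda>x. z x * w x))"
    by (subst tint_diff[symmetric], (intro cper_intros z w)+)+ (simp add: algebra_simps)
  ultimately show ?thesis using G[of e] G[of "- e"] G[of 0] by simp
qed

end

text \<open>The kernel vanishes outside the box of half-width \<epsilon> because the unit ball lies
  in the cube of half-width 1; its mass comes from the dilation by \<epsilon>.\<close>

lemma mollifier_kernel:
  fixes \<eta> :: "real^'d \<Rightarrow> real"
  assumes \<eta>: "mollifier \<eta>" and \<epsilon>: "\<epsilon> > 0"
  defines "k \<equiv> \<lambda>y. (1 / \<epsilon> ^ CARD('d)) * \<eta> ((1 / \<epsilon>) *\<^sub>R y)" and "r \<equiv> \<epsilon> *\<^sub>R (One::real^'d)"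
  shows "sym_kernel k r" "moll \<eta> \<epsilon> = sym_kernel.conv k r"
proof -
  have supp: "k y = 0" if y: "y \<notin> cbox (- r) r" for y
  proof -
    obtain i where i: "i \<in> Basis" "\<epsilon> < \<bar>y \<bullet> i\<bar>" using y by (force simp: mem_box r_def)
    then have "\<epsilon> < norm y" using Basis_le_norm[OF i(1), of y] by simp
    then have "norm ((1 / \<epsilon>) *\<^sub>R y) > 1" using \<epsilon> by simp
    then show ?thesis using \<eta> by (simp add: k_def mollifier_def)
  qed
  have supp\<eta>: "\<eta> y = 0" if y: "y \<notin> cbox (- One) One" for y
  proof -
    obtain i where i: "i \<in> Basis" "1 < \<bar>y \<bullet> i\<bar>" using y by (force simp: mem_box)
    then have "1 < norm y" using Basis_le_norm[OF i(1), of y] by simp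
    then show ?thesis using \<eta> by (simp add: mollifier_def)
  qed
  have c\<eta>: "continuous_on S \<eta>" for S using \<eta> by (auto simp: mollifier_def intro: smooth_fun_continuous_on)
  have restrict: "integral UNIV g = integral S g" if "\<And>y. y \<notin> S \<Longrightarrow> g y = 0" for g :: "real^'d \<Rightarrow> real" and S
  proof -
    have "(\<lambda>x. if x \<in> S then g x else 0) = g" using that by auto
    then show ?thesis using integral_restrict_UNIV[of S g] by simp
  qed
  show "sym_kernel k r"
  proof
    show "continuous_on UNIV k" unfolding k_def
      by (intro continuous_intros continuous_on_compose2[OF c\<eta>[of UNIV]]) auto
    show "0 \<le> k y" "k (- y) = k y" for y using \<eta> \<epsilon> by (auto simp: k_def mollifier_def)
    have "integral (cbox (- One) One) \<eta> = 1"
      using restrict[of "cbox (- One) One" \<eta>, OF supp\<eta>] \<eta> by (simp add: mollifier_def)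
    then have "(\<eta> has_integral 1) (cbox (- One) One)"
      using integrable_integral[OF integrable_continuous[OF c\<eta>, of "- One" One]] by simp
    from has_integral_affinity'[OF this, of "1/\<epsilon>" 0] \<epsilon>
    have "((\<lambda>x. \<eta> ((1/\<epsilon>) *\<^sub>R x)) has_integral \<epsilon> ^ CARD('d)) (cbox (- r) r)"
      by (simp add: r_def field_simps power_divide)
    from integral_unique[OF this] \<epsilon>
    show "integral (cbox (- r) r) k = 1" by (simp add: k_def)
  qed
  note K = this
  show "moll \<eta> \<epsilon> = sym_kernel.conv k r"
  proof (intro ext)
    fix f x
    have "integral UNIV (\<lambda>y. k y * f (x - y)) = integral (cbox (- r) r) (\<lambda>y. k y * f (x - y))"
      by (intro restrict) (simp add: supp)
    then show "moll \<eta> \<epsilon> f x = sym_kernel.conv k r f x"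
      unfolding moll_def sym_kernel.conv_def[OF K] unfolding k_def .
  qed
qed

subsection \<open>Periodic functions on space-time\<close>

definition dx :: "'d \<Rightarrow> ((real^'d) \<times> real \<Rightarrow> real) \<Rightarrow> (real^'d) \<times> real \<Rightarrow> real" where
  "dx i w = dd w (axis i 1, 0)"

definition dt :: "((real^'d) \<times> real \<Rightarrow> real) \<Rightarrow> (real^'d) \<times> real \<Rightarrow> real" where
  "dt w = dd w (0, 1)"

definition Lap :: "((real^'d) \<times> real \<Rightarrow> real) \<Rightarrow> (real^'d) \<times> real \<Rightarrow> real" where
  "Lap w z = (\<Sum>i\<in>UNIV. dx i (dx i w) z)"

text \<open>Smoothness is required at all times, since a solution is given with a smooth extension;
  only the equations are confined to \<open>[0,T]\<close>.\<close>

definition stp :: "((real^'d) \<times> real \<Rightarrow> real) \<Rightarrow> bool" where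
  "stp w \<longleftrightarrow> smooth_fun w \<and> (\<forall>i z. w (z + (axis i 1, 0)) = w z)"

lemma Basis_space: "(axis i 1, 0) \<in> (Basis :: ((real^'d) \<times> 'a::euclidean_space) set)"
  by (auto simp: Basis_prod_def)

lemma Basis_time: "(0, 1) \<in> (Basis :: ((real^'d) \<times> real) set)"
  by (auto simp: Basis_prod_def)

lemma dd_periodic:
  assumes "\<And>z. w (z + e) = w z"
  shows "dd w v (z + e) = dd w v z"
proof -
  have "w (z + e + s *\<^sub>R v) = w (z + s *\<^sub>R v)" for s
    using assms[of "z + s *\<^sub>R v"] by (simp add: algebra_simps)
  then show ?thesis by (simp add: dd_def)
qed

lemma stp_smooth: "stp w \<Longrightarrow> smooth_fun w" by (simp add: stp_def)
lemma stp_diffable: "stp w \<Longrightarrow> w differentiable (at z)"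
  by (simp add: stp_def smooth_fun_differentiable)

lemma stp_dd: "stp w \<Longrightarrow> v \<in> Basis \<Longrightarrow> stp (dd w v)"
  unfolding stp_def by (intro conjI allI smooth_fun_dd dd_periodic) auto

lemma stp_dx: "stp w \<Longrightarrow> stp (dx i w)" unfolding dx_def by (intro stp_dd Basis_space)
lemma stp_dt: "stp w \<Longrightarrow> stp (dt w)" unfolding dt_def by (intro stp_dd Basis_time)
lemma stp_const: "stp (\<lambda>z. c)" by (simp add: stp_def smooth_fun_const)
lemma stp_add: "stp v \<Longrightarrow> stp w \<Longrightarrow> stp (\<lambda>z. v z + w z)" by (simp add: stp_def smooth_fun_add)
lemma stp_diff: "stp v \<Longrightarrow> stp w \<Longrightarrow> stp (\<lambda>z. v z - w z)" by (simp add: stp_def smooth_fun_diff)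
lemma stp_uminus: "stp v \<Longrightarrow> stp (\<lambda>z. - v z)" by (simp add: stp_def smooth_fun_uminus)
lemma stp_mult: "stp v \<Longrightarrow> stp w \<Longrightarrow> stp (\<lambda>z. v z * w z)" by (simp add: stp_def smooth_fun_mult)
lemma stp_sum: "(\<And>i. i \<in> A \<Longrightarrow> stp (f i)) \<Longrightarrow> stp (\<lambda>z. \<Sum>i\<in>A. f i z)"
  by (auto simp: stp_def intro!: smooth_fun_sum sum.cong)
lemma stp_Lap: "stp w \<Longrightarrow> stp (Lap w)" unfolding Lap_def[abs_def] by (intro stp_sum stp_dx)

lemmas stp_intros = stp_dx stp_dt stp_const stp_add stp_diff stp_uminus stp_mult stp_sum stp_Lap

lemma stp_continuous: "stp w \<Longrightarrow> continuous_on S w"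
  by (intro smooth_fun_continuous_on stp_smooth)

lemma stp_cper: "stp w \<Longrightarrow> cper (\<lambda>x. w (x, t))"
proof (rule cperI)
  assume w: "stp w"
  show "continuous_on UNIV (\<lambda>x. w (x, t))"
    by (intro continuous_on_compose2[OF stp_continuous[OF w, of UNIV]] continuous_intros) auto
  show "w (x + axis i 1, t) = w (x, t)" for i x
    using w[unfolded stp_def, THEN conjunct2, rule_format, of "(x, t)" i] by simp
qed

lemma stp_bounded:
  assumes "stp w"
  obtains K where "0 < K" "\<And>x t. t \<in> {0..T} \<Longrightarrow> \<bar>w (x, t)\<bar> \<le> K"
proof -
  have "compact (torus_cell \<times> {0..T})" by (intro compact_Times compact_torus_cell) simp
  then have "compact (w ` (torus_cell \<times> {0..T}))"
    by (intro compact_continuous_image stp_continuous assms)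
  then have "bounded (w ` (torus_cell \<times> {0..T}))" by (rule compact_imp_bounded)
  then obtain K where K: "0 < K" "\<And>z. z \<in> torus_cell \<times> {0..T} \<Longrightarrow> \<bar>w z\<bar> \<le> K"
    unfolding bounded_pos by auto
  have "\<bar>w (x, t)\<bar> \<le> K" if "t \<in> {0..T}" for x t
  proof -
    obtain y where "y \<in> torus_cell" "w (x, t) = w (y, t)"
      using torus_cell_representative[where x=x and 'b=real] stp_cper[OF assms, of t] unfolding cper_def by metis
    then show ?thesis using K(2)[of "(y, t)"] that by simp
  qed
  with K show ?thesis using that by blast
qed

lemma dx_add: "stp v \<Longrightarrow> stp w \<Longrightarrow> dx i (\<lambda>z. v z + w z) z = dx i v z + dx i w z"
  unfolding dx_def by (intro dd_add stp_diffable)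
lemma dx_mult: "stp v \<Longrightarrow> stp w \<Longrightarrow> dx i (\<lambda>z. v z * w z) z = v z * dx i w z + dx i v z * w z"
  unfolding dx_def by (intro dd_mult stp_diffable)
lemma dt_mult: "stp v \<Longrightarrow> stp w \<Longrightarrow> dt (\<lambda>z. v z * w z) z = v z * dt w z + dt v z * w z"
  unfolding dt_def by (intro dd_mult stp_diffable)
lemma dx_const: "dx i (\<lambda>z. c) z = 0"
  unfolding dx_def by (simp add: dd_const)
lemma dx_cmult: "stp w \<Longrightarrow> dx i (\<lambda>z. c * w z) z = c * dx i w z"
  using dx_mult[OF stp_const, of w i c z] by (simp add: dx_const)
lemma dx_uminus: "stp w \<Longrightarrow> dx i (\<lambda>z. - w z) z = - dx i w z"
  using dx_cmult[of w i "-1" z] by simp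
lemma dx_diff: "stp v \<Longrightarrow> stp w \<Longrightarrow> dx i (\<lambda>z. v z - w z) z = dx i v z - dx i w z"
  using dx_add[of v "\<lambda>z. - w z" i z] by (simp add: stp_uminus dx_uminus)
lemma dx_sum: "finite A \<Longrightarrow> (\<And>j. j \<in> A \<Longrightarrow> stp (f j)) \<Longrightarrow> dx i (\<lambda>z. \<Sum>j\<in>A. f j z) z = (\<Sum>j\<in>A. dx i (f j) z)"
  by (induction A rule: finite_induct) (simp_all add: dx_const dx_add stp_sum)

lemma dt_sum: "finite A \<Longrightarrow> (\<And>j. j \<in> A \<Longrightarrow> stp (f j)) \<Longrightarrow> dt (\<lambda>z. \<Sum>j\<in>A. f j z) z = (\<Sum>j\<in>A. dt (f j) z)"
  by (induction A rule: finite_induct) (simp_all add: dt_def dd_const dd_add stp_diffable stp_sum)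

lemma dx_commute: "stp w \<Longrightarrow> dx i (dx j w) z = dx j (dx i w) z"
  unfolding dx_def by (intro dd_commute stp_smooth Basis_space)
lemma dx_dt_commute: "stp w \<Longrightarrow> dx i (dt w) z = dt (dx i w) z"
  unfolding dx_def dt_def by (intro dd_commute stp_smooth Basis_space Basis_time)

lemma dx_has_derivative:
  assumes "stp w"
  shows "((\<lambda>s. w (x + s *\<^sub>R axis i 1, t)) has_real_derivative dx i w (x, t)) (at 0)"
  using smooth_fun_has_field_derivative[OF stp_smooth[OF assms], of "(x, t)" "(axis i 1, 0)" 0 UNIV]
  by (simp add: dx_def)

lemma dt_has_derivative:
  assumes "stp w"
  shows "((\<lambda>s. w (x, s)) has_real_derivative dt w (x, t)) (at t within S)"
  using smooth_fun_has_field_derivative[OF stp_smooth[OF assms], of "(x, 0)" "(0, 1)" t S]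
  by (simp add: dt_def)

lemma tint_dx_eq_0: "stp w \<Longrightarrow> tint (\<lambda>x. dx i w (x, t)) = 0"
  by (rule tint_derivative_eq_0[of "\<lambda>x. w (x, t)" _ i]) (auto intro: stp_cper dx_has_derivative stp_intros)

lemma tint_by_parts:
  assumes v: "stp v" and w: "stp w"
  shows "tint (\<lambda>x. dx i v (x, t) * w (x, t)) = - tint (\<lambda>x. v (x, t) * dx i w (x, t))"
proof -
  have "0 = tint (\<lambda>x. dx i (\<lambda>z. v z * w z) (x, t))"
    by (rule tint_dx_eq_0[symmetric]) (intro stp_intros v w)
  also have "\<dots> = tint (\<lambda>x. v (x, t) * dx i w (x, t)) + tint (\<lambda>x. dx i v (x, t) * w (x, t))"
    unfolding dx_mult[OF v w] by (intro tint_add cper_intros stp_cper stp_intros v w)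
  finally show ?thesis by simp
qed

lemma tint_Lap_by_parts:
  assumes v: "stp v" and w: "stp w"
  shows "tint (\<lambda>x. Lap v (x, t) * w (x, t)) = - tint (\<lambda>x. \<Sum>i\<in>UNIV. dx i v (x, t) * dx i w (x, t))"
proof -
  have "tint (\<lambda>x. Lap v (x, t) * w (x, t)) = (\<Sum>i\<in>UNIV. tint (\<lambda>x. dx i (dx i v) (x, t) * w (x, t)))"
    unfolding Lap_def sum_distrib_right by (intro tint_sum cper_intros stp_cper stp_intros v w) simp
  also have "\<dots> = - (\<Sum>i\<in>UNIV. tint (\<lambda>x. dx i v (x, t) * dx i w (x, t)))"
    by (simp add: tint_by_parts stp_dx v w sum_negf)
  also have "(\<Sum>i\<in>UNIV. tint (\<lambda>x. dx i v (x, t) * dx i w (x, t))) = tint (\<lambda>x. \<Sum>i\<in>UNIV. dx i v (x, t) * dx i w (x, t))"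
    by (intro tint_sum[symmetric] cper_intros stp_cper stp_intros v w) simp
  finally show ?thesis .
qed

lemma tint_Lap_commute:
  assumes v: "stp v" and w: "stp w"
  shows "tint (\<lambda>x. Lap v (x, t) * w (x, t)) = tint (\<lambda>x. v (x, t) * Lap w (x, t))"
  using tint_Lap_by_parts[OF v w, of t] tint_Lap_by_parts[OF w v, of t] by (simp add: mult.commute)

lemma tint_stp_has_derivative:
  assumes "stp w" "t \<in> {0..T}"
  shows "((\<lambda>t. tint (\<lambda>x. w (x, t))) has_real_derivative tint (\<lambda>x. dt w (x, t))) (at t within {0..T})"
  by (rule tint_has_real_derivative[of "{0..T}" "\<lambda>x t. w (x, t)" "\<lambda>x t. dt w (x, t)"])
     (use assms in \<open>auto intro!: dt_has_derivative stp_cper stp_continuous stp_intros\<close>)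

lemma tint_stp_continuous: "stp w \<Longrightarrow> continuous_on S (\<lambda>t. tint (\<lambda>x. w (x, t)))"
  by (rule tint_continuous_on[of S "\<lambda>x t. w (x, t)"]) (auto intro: stp_continuous)

lemma tint_stp_FTC:
  assumes w: "stp w" and T: "0 \<le> T"
  shows "integral {0..T} (\<lambda>t. tint (\<lambda>x. dt w (x, t))) = tint (\<lambda>x. w (x, T)) - tint (\<lambda>x. w (x, 0))"
  by (rule integral_unique, rule fundamental_theorem_of_calculus[OF T])
     (auto simp: has_real_derivative_iff_has_vector_derivative[symmetric] intro!: tint_stp_has_derivative w)

lemma dd_slice: "dd (\<lambda>x. w (x, t)) (axis i 1) = (\<lambda>x. dx i w (x, t))"
  by (simp add: dd_def dx_def fun_eq_iff)

lemma deriv_slice: "stp w \<Longrightarrow> deriv (\<lambda>s. w (x, s)) t = dt w (x, t)"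
  by (rule DERIV_imp_deriv) (rule dt_has_derivative)

lemma grad_slice: "grad (\<lambda>x. w (x, t)) x = (\<chi> i. dx i w (x, t))"
  unfolding grad_def dd_slice[of w t] ..

lemma lap_slice: "lap (\<lambda>x. w (x, t)) x = Lap w (x, t)"
  unfolding lap_def Lap_def dd_slice[of w t] dd_slice[of "dx _ w" t] ..

text \<open>Lets time-independent weights take part in the space-time integrations by parts.\<close>

lemma stp_static:
  fixes f :: "real^'d \<Rightarrow> real"
  assumes "smooth_fun f" "periodic f"
  shows "stp (\<lambda>z. f (fst z))" "dt (\<lambda>z. f (fst z)) z = 0" "dx i (\<lambda>z. f (fst z)) z = dd f (axis i 1) (fst z)"
proof -
  have "smooth_fun (\<lambda>z::(real^'d) \<times> real. fst z \<bullet> c)" for c :: "real^'d"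
    by (intro smooth_fun_linear bounded_linear_inner_left_comp bounded_linear_fst)
  then have "smooth_fun (\<lambda>z::(real^'d) \<times> real. f (fst z))"
    by (intro smooth_fun_compose[where F=f and \<Phi>=fst] assms)
  then show "stp (\<lambda>z. f (fst z))"
    unfolding stp_def using assms(2) by (simp add: periodic_def)
  show "dt (\<lambda>z. f (fst z)) z = 0" "dx i (\<lambda>z. f (fst z)) z = dd f (axis i 1) (fst z)"
    by (simp_all add: dt_def dx_def dd_def)
qed

subsection \<open>Composition of the Hamiltonian with the gradient\<close>

definition Hx :: "'d \<Rightarrow> ((real^'d) \<times> (real^'d) \<Rightarrow> real) \<Rightarrow> (real^'d) \<times> (real^'d) \<Rightarrow> real" where
  "Hx i F = dd F (axis i 1, 0)"

definition Hp :: "'d \<Rightarrow> ((real^'d) \<times> (real^'d) \<Rightarrow> real) \<Rightarrow> (real^'d) \<times> (real^'d) \<Rightarrow> real" where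
  "Hp i F = dd F (0, axis i 1)"

lemma Basis_momentum: "(0, axis i 1) \<in> (Basis :: ('a::euclidean_space \<times> (real^'d)) set)"
  by (auto simp: Basis_prod_def)

lemma smooth_Hx: "smooth_fun F \<Longrightarrow> smooth_fun (Hx i F)"
  and smooth_Hp: "smooth_fun F \<Longrightarrow> smooth_fun (Hp i F)"
  unfolding Hx_def Hp_def by (simp_all add: smooth_fun_dd Basis_space Basis_momentum)

lemma Hx_Hp_commute: "smooth_fun F \<Longrightarrow> Hx i (Hp j F) z = Hp j (Hx i F) z"
  unfolding Hx_def Hp_def by (intro dd_commute Basis_space Basis_momentum)

definition xper :: "((real^'d) \<times> (real^'d) \<Rightarrow> real) \<Rightarrow> bool" where
  "xper F \<longleftrightarrow> (\<forall>i z. F (z + (axis i 1, 0)) = F z)"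

lemma xper_Hx: "xper F \<Longrightarrow> xper (Hx i F)" and xper_Hp: "xper F \<Longrightarrow> xper (Hp i F)"
proof -
  have "xper (dd F v)" if "xper F" for F and v :: "(real^'d) \<times> (real^'d)"
    using that unfolding xper_def by (intro allI dd_periodic) blast
  then show "xper F \<Longrightarrow> xper (Hx i F)" "xper F \<Longrightarrow> xper (Hp i F)" by (simp_all add: Hx_def Hp_def)
qed

definition Du :: "((real^'d) \<times> real \<Rightarrow> real) \<Rightarrow> (real^'d) \<times> real \<Rightarrow> real^'d" where
  "Du U z = (\<chi> i. dx i U z)"

definition along :: "((real^'d) \<times> real \<Rightarrow> real) \<Rightarrow> ((real^'d) \<times> (real^'d) \<Rightarrow> real) \<Rightarrow> (real^'d) \<times> real \<Rightarrow> real" where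
  "along U F z = F (fst z, Du U z)"

lemma sum_Basis_prod_axis:
  "(\<Sum>c\<in>(Basis::((real^'d) \<times> (real^'d)) set). g c) = (\<Sum>i\<in>UNIV. g (axis i 1, 0)) + (\<Sum>i\<in>UNIV. g (0, axis i 1))"
proof -
  have "(\<Sum>c\<in>(Basis::((real^'d) \<times> (real^'d)) set). g c) =
      (\<Sum>c\<in>(\<lambda>u. (u, 0)) ` (Basis::(real^'d) set). g c) + (\<Sum>c\<in>(\<lambda>u. (0, u)) ` (Basis::(real^'d) set). g c)"
    unfolding Basis_prod_def by (rule sum.union_disjoint) auto
  then show ?thesis
    by (simp add: sum.reindex inj_on_def sum_Basis_axis[of "\<lambda>c. g (c, 0)"] sum_Basis_axis[of "\<lambda>c. g (0, c)"])
qed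

lemma along_component:
  assumes c: "c \<in> (Basis :: ((real^'d) \<times> (real^'d)) set)"
  obtains i where "c = (axis i 1, 0)" "\<And>z. (fst z, Du U z) \<bullet> c = fst z $ i"
  | i where "c = (0, axis i 1)" "\<And>z. (fst z, Du U z) \<bullet> c = dx i U z"
proof -
  from c consider i where "c = (axis i 1, 0)" | i where "c = (0, axis i 1)"
    by (auto simp: Basis_prod_def Basis_vec_def)
  then show ?thesis
  proof cases
    case 1
    then show ?thesis by (rule that(1)) (simp add: 1 inner_axis)
  next
    case 2
    then show ?thesis by (rule that(2)) (simp add: 2 inner_axis Du_def)
  qed
qed

lemma smooth_fst_nth: "smooth_fun (\<lambda>z::(real^'d) \<times> real. fst z $ i)"
  by (intro smooth_fun_linear bounded_linear_compose[OF bounded_linear_vec_nth bounded_linear_fst])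

lemma stp_along:
  assumes F: "smooth_fun F" "xper F" and U: "stp U"
  shows "stp (along U F)"
proof -
  have "smooth_fun (\<lambda>z. F (fst z, Du U z))"
  proof (rule smooth_fun_compose[where \<Phi>="\<lambda>z. (fst z, Du U z)"])
    fix c :: "(real^'a) \<times> (real^'a)" assume "c \<in> Basis"
    then show "smooth_fun (\<lambda>z. (fst z, Du U z) \<bullet> c)"
      by (rule along_component[where U=U]) (auto intro: smooth_fst_nth stp_smooth[OF stp_dx[OF U]])
  qed (rule F)
  moreover have "along U F (z + (axis i 1, 0)) = along U F z" for i z
  proof -
    have "Du U (z + (axis i 1, 0)) = Du U z"
      unfolding Du_def by (simp only: stp_dx[OF U, unfolded stp_def, THEN conjunct2, rule_format])
    then show ?thesis using F(2)[unfolded xper_def, rule_format, of "(fst z, Du U z)" i] by (simp add: along_def)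
  qed
  ultimately show ?thesis by (simp add: stp_def along_def[abs_def])
qed

lemma dx_along:
  assumes F: "smooth_fun F" and U: "stp U"
  shows "dx i (along U F) z = along U (Hx i F) z + (\<Sum>j\<in>UNIV. along U (Hp j F) z * dx i (dx j U) z)"
proof -
  let ?\<Phi> = "\<lambda>z. (fst z, Du U z)"
  have c: "(\<lambda>y. ?\<Phi> y \<bullet> c) differentiable (at z)" if "c \<in> Basis" for c
    using that by (rule along_component[where U=U])
      (auto intro!: smooth_fun_differentiable smooth_fst_nth stp_smooth[OF stp_dx[OF U]])
  have "dx i (along U F) z = (\<Sum>c\<in>Basis. dd F c (?\<Phi> z) * dd (\<lambda>y. ?\<Phi> y \<bullet> c) (axis i 1, 0) z)"
    unfolding dx_def along_def[abs_def] by (rule dd_compose[OF smooth_fun_differentiable[OF F] c])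
  also have "\<dots> = (\<Sum>j\<in>UNIV. along U (Hx j F) z * (if j = i then 1 else 0)) + (\<Sum>j\<in>UNIV. along U (Hp j F) z * dx i (dx j U) z)"
  proof -
    have "dd (\<lambda>y::(real^'a) \<times> real. fst y $ j) (axis i 1, 0) z = (if j = i then 1 else 0)" for j
    proof -
      have "bounded_linear (\<lambda>y::(real^'a) \<times> real. fst y $ j)"
        by (rule bounded_linear_compose[OF bounded_linear_vec_nth bounded_linear_fst])
      from dd_eqI[OF bounded_linear_imp_has_derivative[OF this]] show ?thesis by (simp add: axis_def)
    qed
    then show ?thesis
      by (simp add: sum_Basis_prod_axis inner_axis Du_def along_def Hx_def Hp_def dx_def)
  qed
  finally show ?thesis by (simp add: if_distrib[of "(*) _"] cong: if_cong)
qed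

lemma Hamiltonian_derivatives:
  fixes H :: "real^'d \<Rightarrow> real^'d \<Rightarrow> real"
  defines "F \<equiv> \<lambda>z. H (fst z) (snd z)"
  shows "DpH H x p $ i = Hp i F (x, p)" "DxH H x p $ i = Hx i F (x, p)"
    "D2ppH H x p $ i $ j = Hp i (Hp j F) (x, p)" "D2xxH H x p $ i $ j = Hx i (Hx j F) (x, p)"
    "D2pxH H x p $ i $ j = Hp i (Hx j F) (x, p)" "D2xpH H x p $ i $ j = Hx i (Hp j F) (x, p)"
proof -
  have P: "dd (\<lambda>q. f (x, q)) (axis i 1) = (\<lambda>p. Hp i f (x, p))" for f :: "(real^'d) \<times> (real^'d) \<Rightarrow> real" and x i
    by (simp add: dd_def Hp_def fun_eq_iff)
  have X: "dd (\<lambda>y. f (y, p)) (axis i 1) = (\<lambda>x. Hx i f (x, p))" for f :: "(real^'d) \<times> (real^'d) \<Rightarrow> real" and p i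
    by (simp add: dd_def Hx_def fun_eq_iff)
  have P': "dd (H x) (axis i 1) = (\<lambda>p. Hp i F (x, p))" for x i
    using P[of F x i] unfolding F_def by simp
  have X': "dd (\<lambda>y. H y p) (axis i 1) = (\<lambda>x. Hx i F (x, p))" for p i
    using X[of F p i] unfolding F_def by simp
  show "DpH H x p $ i = Hp i F (x, p)" by (simp only: DpH_def grad_def vec_lambda_beta P')
  show "DxH H x p $ i = Hx i F (x, p)" by (simp only: DxH_def grad_def vec_lambda_beta X')
  show "D2ppH H x p $ i $ j = Hp i (Hp j F) (x, p)"
    by (simp only: D2ppH_def hess_def vec_lambda_beta P' P[of "Hp j F" x i])
  show "D2xxH H x p $ i $ j = Hx i (Hx j F) (x, p)"
    by (simp only: D2xxH_def hess_def vec_lambda_beta X' X[of "Hx j F" p i])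
  show "D2pxH H x p $ i $ j = Hp i (Hx j F) (x, p)"
    by (simp only: D2pxH_def vec_lambda_beta X' P[of "Hx j F" x i])
  show "D2xpH H x p $ i $ j = Hx i (Hp j F) (x, p)"
    by (simp only: D2xpH_def vec_lambda_beta P' X[of "Hp j F" p i])
qed

subsection \<open>Solutions of the regularized system\<close>

text \<open>One fixed solution. The constants of the growth conditions are not parameters here but
  hypotheses of the individual lemmas, so that they can be chosen before \<epsilon>,
  \<open>u\<close> and \<open>m\<close>.\<close>

locale mfg_solution =
  fixes H :: "real^'d \<Rightarrow> real^'d \<Rightarrow> real" and \<eta> uT m0 :: "real^'d \<Rightarrow> real"
    and T \<alpha> \<kappa>0 \<epsilon> :: real and u m :: "real^'d \<Rightarrow> real \<Rightarrow> real"
  assumes T_pos: "T > 0" and mollifier: "mollifier \<eta>"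
    and H_smooth: "smooth_fun (\<lambda>z. H (fst z) (snd z))" and H_periodic: "\<And>p. periodic (\<lambda>x. H x p)"
    and uT_smooth: "smooth_fun uT" "periodic uT"
    and m0_smooth: "smooth_fun m0" "periodic m0" and m0_mass: "tint m0 = 1"
    and \<alpha>_pos: "\<alpha> > 0" and \<kappa>0: "\<kappa>0 > 0" "\<And>x. \<kappa>0 \<le> m0 x" and \<epsilon>_pos: "\<epsilon> > 0"
    and sol: "reg_solution H \<eta> \<alpha> T \<epsilon> uT m0 u m"
begin

definition HH where "HH z = H (fst z) (snd z)"
definition U where "U z = u (fst z) (snd z)"
definition M where "M z = m (fst z) (snd z)"
definition b where "b i = along U (Hp i HH)"
definition Hc where "Hc = along U HH"
text \<open>By the first equation this is \<open>g\<^sub>\<epsilon>(m)\<close> on \<open>[0,T]\<close>; in this form its smoothness is evident.\<close>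
definition G where "G z = Hc z - dt U z - Lap U z"
definition divb where "divb z = (\<Sum>i\<in>UNIV. dx i (b i) z)"
definition Lh where "Lh z = (\<Sum>i\<in>UNIV. b i z * dx i U z) - Hc z"
text \<open>\<open>Q\<close> is the trace of \<open>D\<^sub>p\<^sub>pH (D\<^sup>2u)\<^sup>2\<close>;
  \<open>R\<close> collects the other terms of the Laplacian of \<open>H(x,Du)\<close> that contain
  no third derivatives of \<open>u\<close>.\<close>

definition Q where "Q z = (\<Sum>i\<in>UNIV. \<Sum>j\<in>UNIV. \<Sum>k\<in>UNIV. along U (Hp k (Hp j HH)) z * dx i (dx k U) z * dx i (dx j U) z)"
definition R where "R z = (\<Sum>i\<in>UNIV. along U (Hx i (Hx i HH)) z) + 2 * (\<Sum>i\<in>UNIV. \<Sum>j\<in>UNIV. along U (Hp j (Hx i HH)) z * dx i (dx j U) z)"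

lemma smooth_HH: "smooth_fun HH" and xper_HH: "xper HH"
  using H_smooth H_periodic unfolding HH_def[abs_def] by (simp_all add: xper_def periodic_def)

lemma stp_U: "stp U" and stp_M: "stp M"
  using sol by (simp_all add: reg_solution_def stp_def U_def[abs_def] M_def[abs_def] periodic_def)

lemma stp_along_HH: "smooth_fun F \<Longrightarrow> xper F \<Longrightarrow> stp (along U F)"
  by (intro stp_along stp_U)

lemma stp_b: "stp (b i)" unfolding b_def by (intro stp_along_HH smooth_Hp xper_Hp smooth_HH xper_HH)
lemma stp_Hc: "stp Hc" unfolding Hc_def by (intro stp_along_HH smooth_HH xper_HH)
lemma stp_G: "stp G" unfolding G_def[abs_def] by (intro stp_intros stp_Hc stp_U)
lemma stp_divb: "stp divb" unfolding divb_def[abs_def] by (intro stp_intros stp_b)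
lemma stp_Lh: "stp Lh" unfolding Lh_def[abs_def] by (intro stp_intros stp_b stp_U stp_Hc)
lemma stp_Q: "stp Q"
  unfolding Q_def[abs_def] by (intro stp_intros stp_U stp_along_HH smooth_Hp xper_Hp smooth_HH xper_HH)
lemma stp_R: "stp R"
  unfolding R_def[abs_def] by (intro stp_intros stp_U stp_along_HH smooth_Hp xper_Hp smooth_Hx xper_Hx smooth_HH xper_HH)

lemmas stp_sol = stp_intros stp_U stp_M stp_b stp_Hc stp_G stp_divb stp_Lh stp_Q stp_R
lemmas cper_sol = cper_intros stp_cper stp_sol

lemma u_slice: "(\<lambda>x. u x t) = (\<lambda>x. U (x, t))" and m_slice: "(\<lambda>x. m x t) = (\<lambda>x. M (x, t))"
  by (simp_all add: U_def M_def)

lemma Du_eq: "grad (\<lambda>y. u y t) x = Du U (x, t)"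
  unfolding u_slice grad_slice Du_def ..

lemma b_eq: "b i (x, t) = DpH H x (Du U (x, t)) $ i"
  using Hamiltonian_derivatives(1)[of H] by (simp add: b_def along_def HH_def[abs_def])

lemma terminal: "U (x, T) = uT x" and initial: "M (x, 0) = m0 x"
  using sol by (simp_all add: reg_solution_def U_def M_def)

lemma dt_U: "dt U z = Hc z - Lap U z - G z"
  by (simp add: G_def)

lemma G_eq: "t \<in> {0..T} \<Longrightarrow> G (x, t) = g_eps \<eta> \<alpha> \<epsilon> (\<lambda>y. m y t) x"
proof -
  assume t: "t \<in> {0..T}"
  have d: "deriv (\<lambda>s. u x s) t = dt U (x, t)"
    using deriv_slice[OF stp_U, of x t] by (simp add: U_def)
  have l: "lap (\<lambda>y. u y t) x = Lap U (x, t)" unfolding u_slice by (rule lap_slice)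
  have h: "H x (grad (\<lambda>y. u y t) x) = Hc (x, t)" by (simp add: Hc_def along_def HH_def Du_eq)
  have "- deriv (\<lambda>s. u x s) t + H x (grad (\<lambda>y. u y t) x) = lap (\<lambda>y. u y t) x + g_eps \<eta> \<alpha> \<epsilon> (\<lambda>y. m y t) x"
    using sol t by (simp add: reg_solution_def)
  then show ?thesis unfolding d l h G_def by simp
qed

lemma Fokker_Planck:
  assumes t: "t \<in> {0..T}"
  shows "dt M (x, t) = (\<Sum>i\<in>UNIV. dx i (\<lambda>z. b i z * M z) (x, t)) + Lap M (x, t)"
proof -
  have d: "deriv (\<lambda>s. m x s) t = dt M (x, t)"
    using deriv_slice[OF stp_M, of x t] by (simp add: M_def)
  have l: "lap (\<lambda>y. m y t) x = Lap M (x, t)" unfolding m_slice by (rule lap_slice)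
  have "(\<lambda>y. (m y t *\<^sub>R DpH H y (grad (\<lambda>z. u z t) y)) $ i) = (\<lambda>y. (\<lambda>z. b i z * M z) (y, t))" for i
    by (simp add: Du_eq b_eq M_def mult.commute)
  then have v: "divg (\<lambda>y. m y t *\<^sub>R DpH H y (grad (\<lambda>z. u z t) y)) x = (\<Sum>i\<in>UNIV. dx i (\<lambda>z. b i z * M z) (x, t))"
    using dd_slice[of "\<lambda>z. b _ z * M z" t] by (simp add: divg_def)
  have "deriv (\<lambda>s. m x s) t - divg (\<lambda>y. m y t *\<^sub>R DpH H y (grad (\<lambda>z. u z t) y)) x = lap (\<lambda>y. m y t) x"
    using sol t unfolding reg_solution_def by blast
  then show ?thesis unfolding d l v by simp
qed

text \<open>Comparison with \<open>\<kappa>0 * exp (- K * t)\<close>, whose rate \<open>K\<close>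
  bounds \<open>\<bar>div b\<bar>\<close>. The rate depends on the solution and hence on \<epsilon>,
  which is harmless: only the sign of \<open>M\<close> is retained.\<close>

lemma M_pos:
  assumes t: "t \<in> {0..T}"
  shows "0 < M (x, t)"
proof -
  obtain K where K: "0 < K" "\<And>x t. t \<in> {0..T} \<Longrightarrow> \<bar>divb (x, t)\<bar> \<le> K" using stp_bounded[OF stp_divb, of T] by blast
  have "0 \<le> M (x, t) - \<kappa>0 * exp (- K * t)"
  proof (rule parabolic_min_principle[where v="\<lambda>x t. M (x, t) - \<kappa>0 * exp (- K * t)" and T=T and
        vt="\<lambda>x t. dt M (x, t) + K * \<kappa>0 * exp (- K * t)" and ?v1.0="\<lambda>j x t. dx j M (x, t)" and
        ?v2.0="\<lambda>j x t. dx j (dx j M) (x, t)" and b="\<lambda>j x t. b j (x, t)" and c="\<lambda>x t. divb (x, t)" and K=K])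
    show "continuous_on (UNIV \<times> {0..T}) (\<lambda>(x, t). M (x, t) - \<kappa>0 * exp (- K * t))"
      unfolding case_prod_beta prod.collapse by (intro continuous_intros stp_continuous stp_M)
    show "periodic (\<lambda>x. M (x, t) - \<kappa>0 * exp (- K * t))" for t
      using cper_diff[OF stp_cper[OF stp_M] cper_const] by (simp add: cper_def)
    show "((\<lambda>s. M (x, s) - \<kappa>0 * exp (- K * s)) has_real_derivative dt M (x, t) + K * \<kappa>0 * exp (- K * t)) (at t within {0..T})" for x t
      by (rule derivative_eq_intros dt_has_derivative stp_M refl)+ simp
    show "((\<lambda>s. M (x + s *\<^sub>R axis j 1, t) - \<kappa>0 * exp (- K * t)) has_real_derivative dx j M (x, t)) (at 0)" for x t j
      by (rule derivative_eq_intros dx_has_derivative stp_M refl)+ simp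
    show "((\<lambda>s. dx j M (x + s *\<^sub>R axis j 1, t)) has_real_derivative dx j (dx j M) (x, t)) (at 0)" for x t j
      by (intro dx_has_derivative stp_sol)
    show "divb (x, t) \<le> K" if "t \<in> {0..T}" for x t using K(2)[OF that, of x] by simp
    show "0 \<le> M (x, 0) - \<kappa>0 * exp (- K * 0)" for x using \<kappa>0(2)[of x] by (simp add: initial)
    fix x t assume t: "t \<in> {0..T}"
    have "dt M (x, t) = (\<Sum>j\<in>UNIV. dx j (dx j M) (x, t)) + (\<Sum>j\<in>UNIV. b j (x, t) * dx j M (x, t)) + divb (x, t) * M (x, t)"
      by (simp add: Fokker_Planck[OF t] Lap_def dx_mult stp_sol divb_def sum.distrib sum_distrib_right)
    moreover have "0 \<le> (K + divb (x, t)) * (\<kappa>0 * exp (- K * t))"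
      using K(2)[OF t, of x] \<kappa>0 by (intro mult_nonneg_nonneg) auto
    ultimately show "(\<Sum>j\<in>UNIV. dx j (dx j M) (x, t)) + (\<Sum>j\<in>UNIV. b j (x, t) * dx j M (x, t)) +
        divb (x, t) * (M (x, t) - \<kappa>0 * exp (- K * t)) \<le> dt M (x, t) + K * \<kappa>0 * exp (- K * t)"
      by (simp add: algebra_simps)
  qed (rule t)
  moreover have "0 < \<kappa>0 * exp (- K * t)" using \<kappa>0 by simp
  ultimately show ?thesis by linarith
qed

text \<open>The second equation is the adjoint of the linearised first one. Hence for
  \<open>w = U\<close> and \<open>w = Lap U\<close> the diffusion terms cancel against those of the
  first equation, for \<open>Lap U\<close> also the transport terms; \<open>w = 1\<close> gives
  conservation of mass.\<close>

lemma tint_dt_M_mult: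
  assumes t: "t \<in> {0..T}" and w: "stp w"
  shows "tint (\<lambda>x. dt M (x, t) * w (x, t)) =
    tint (\<lambda>x. M (x, t) * Lap w (x, t)) - tint (\<lambda>x. M (x, t) * (\<Sum>i\<in>UNIV. b i (x, t) * dx i w (x, t)))"
proof -
  have "tint (\<lambda>x. dt M (x, t) * w (x, t)) =
      tint (\<lambda>x. (\<Sum>i\<in>UNIV. dx i (\<lambda>z. b i z * M z) (x, t) * w (x, t)) + Lap M (x, t) * w (x, t))"
    by (simp add: Fokker_Planck[OF t] sum_distrib_right distrib_right)
  also have "\<dots> = (\<Sum>i\<in>UNIV. tint (\<lambda>x. dx i (\<lambda>z. b i z * M z) (x, t) * w (x, t))) + tint (\<lambda>x. Lap M (x, t) * w (x, t))"
    by (subst tint_add) (auto intro!: tint_sum cper_sol w)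
  also have "(\<Sum>i\<in>UNIV. tint (\<lambda>x. dx i (\<lambda>z. b i z * M z) (x, t) * w (x, t))) =
      - (\<Sum>i\<in>UNIV. tint (\<lambda>x. M (x, t) * (b i (x, t) * dx i w (x, t))))"
    unfolding sum_negf[symmetric]
    by (intro sum.cong refl, subst tint_by_parts) (auto intro!: stp_sol w simp: mult_ac)
  also have "(\<Sum>i\<in>UNIV. tint (\<lambda>x. M (x, t) * (b i (x, t) * dx i w (x, t)))) =
      tint (\<lambda>x. M (x, t) * (\<Sum>i\<in>UNIV. b i (x, t) * dx i w (x, t)))"
    unfolding sum_distrib_left by (intro tint_sum[symmetric] cper_sol w) simp
  also have "tint (\<lambda>x. Lap M (x, t) * w (x, t)) = tint (\<lambda>x. M (x, t) * Lap w (x, t))"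
    by (rule tint_Lap_commute[OF stp_M w])
  finally show ?thesis by simp
qed

lemma mass: "t \<in> {0..T} \<Longrightarrow> tint (\<lambda>x. M (x, t)) = 1"
proof -
  assume t: "t \<in> {0..T}"
  have "tint (\<lambda>x. dt M (x, t)) = 0" if "t \<in> {0..T}" for t
    using tint_dt_M_mult[OF that stp_const[of 1]] by (simp add: Lap_def dx_def dd_const)
  then have "((\<lambda>t. tint (\<lambda>x. M (x, t))) has_real_derivative 0) (at t within {0..T})" if "t \<in> {0..T}" for t
    using tint_stp_has_derivative[OF stp_M that] that by simp
  then obtain c where "\<And>t. t \<in> {0..T} \<Longrightarrow> tint (\<lambda>x. M (x, t)) = c"
    using has_field_derivative_zero_constant[of "{0..T}" "\<lambda>t. tint (\<lambda>x. M (x, t))"] by auto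
  from this[OF t] this[of 0] T_pos show ?thesis by (simp add: initial m0_mass)
qed

lemma tint_dt_UM:
  assumes t: "t \<in> {0..T}"
  shows "tint (\<lambda>x. dt (\<lambda>z. U z * M z) (x, t)) = - tint (\<lambda>x. Lh (x, t) * M (x, t)) - tint (\<lambda>x. G (x, t) * M (x, t))"
proof -
  have "tint (\<lambda>x. dt (\<lambda>z. U z * M z) (x, t)) =
      tint (\<lambda>x. dt M (x, t) * U (x, t)) + tint (\<lambda>x. (Hc (x, t) - G (x, t)) * M (x, t) - M (x, t) * Lap U (x, t))"
    by (subst tint_add[symmetric]) (auto intro!: cper_sol simp: dt_mult stp_U stp_M dt_U algebra_simps)
  also have "\<dots> = - tint (\<lambda>x. M (x, t) * (\<Sum>i\<in>UNIV. b i (x, t) * dx i U (x, t))) + tint (\<lambda>x. (Hc (x, t) - G (x, t)) * M (x, t))"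
    unfolding tint_dt_M_mult[OF t stp_U]
    by (subst tint_diff[of _ "\<lambda>x. M (x, t) * Lap U (x, t)"]) (auto intro!: cper_sol)
  also have "tint (\<lambda>x. (Hc (x, t) - G (x, t)) * M (x, t)) = tint (\<lambda>x. Hc (x, t) * M (x, t)) - tint (\<lambda>x. G (x, t) * M (x, t))"
    by (subst tint_diff[symmetric]) (auto intro!: cper_sol simp: algebra_simps)
  also have "- tint (\<lambda>x. M (x, t) * (\<Sum>i\<in>UNIV. b i (x, t) * dx i U (x, t))) + (tint (\<lambda>x. Hc (x, t) * M (x, t)) - tint (\<lambda>x. G (x, t) * M (x, t)))
     = - (tint (\<lambda>x. M (x, t) * (\<Sum>i\<in>UNIV. b i (x, t) * dx i U (x, t))) - tint (\<lambda>x. Hc (x, t) * M (x, t))) - tint (\<lambda>x. G (x, t) * M (x, t))"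
    by simp
  also have "tint (\<lambda>x. M (x, t) * (\<Sum>i\<in>UNIV. b i (x, t) * dx i U (x, t))) - tint (\<lambda>x. Hc (x, t) * M (x, t)) = tint (\<lambda>x. Lh (x, t) * M (x, t))"
    by (subst tint_diff[symmetric]) (auto intro!: cper_sol simp: Lh_def algebra_simps)
  finally show ?thesis .
qed

lemma tint_dt_U_static:
  assumes w: "stp w" and static: "\<And>z. dt w z = 0"
  shows "tint (\<lambda>x. dt (\<lambda>z. U z * w z) (x, t)) =
    tint (\<lambda>x. Hc (x, t) * w (x, t) + (\<Sum>i\<in>UNIV. dx i U (x, t) * dx i w (x, t))) - tint (\<lambda>x. G (x, t) * w (x, t))"
proof -
  have "tint (\<lambda>x. dt (\<lambda>z. U z * w z) (x, t)) =
      tint (\<lambda>x. Hc (x, t) * w (x, t)) - tint (\<lambda>x. Lap U (x, t) * w (x, t)) - tint (\<lambda>x. G (x, t) * w (x, t))"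
    by (subst tint_diff[symmetric], (auto intro!: cper_sol w)[2])+ (simp add: dt_mult stp_U w static dt_U algebra_simps)
  also have "tint (\<lambda>x. Hc (x, t) * w (x, t)) - tint (\<lambda>x. Lap U (x, t) * w (x, t)) =
      tint (\<lambda>x. Hc (x, t) * w (x, t) + (\<Sum>i\<in>UNIV. dx i U (x, t) * dx i w (x, t)))"
    unfolding tint_Lap_by_parts[OF stp_U w]
    by (subst tint_add) (auto intro!: cper_sol w)
  finally show ?thesis .
qed

text \<open>Third derivatives of \<open>u\<close> occur only in the transport term
  \<open>b \<cdot> D(Lap U)\<close>, which the drift of the second equation cancels; what is left is
  the coercive \<open>Q\<close> and the remainder \<open>R\<close>.\<close>

lemma Lap_Hc: "Lap Hc z = R z + Q z + (\<Sum>j\<in>UNIV. b j z * dx j (Lap U) z)"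
proof -
  have Hp: "smooth_fun (Hp j HH)" "xper (Hp j HH)" and Hx: "smooth_fun (Hx j HH)" "xper (Hx j HH)" for j
    by (auto intro: smooth_Hp smooth_Hx xper_Hp xper_Hx smooth_HH xper_HH)
  have 1: "dx i Hc = (\<lambda>z. along U (Hx i HH) z + (\<Sum>j\<in>UNIV. b j z * dx i (dx j U) z))" for i
    unfolding Hc_def b_def by (intro ext dx_along smooth_HH stp_U)
  have 2: "dx i (dx i Hc) z = along U (Hx i (Hx i HH)) z + (\<Sum>j\<in>UNIV. along U (Hp j (Hx i HH)) z * dx i (dx j U) z)
      + (\<Sum>j\<in>UNIV. b j z * dx i (dx i (dx j U)) z
         + (along U (Hp j (Hx i HH)) z + (\<Sum>k\<in>UNIV. along U (Hp k (Hp j HH)) z * dx i (dx k U) z)) * dx i (dx j U) z)" for i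
    unfolding 1
    by (simp add: dx_add dx_sum dx_mult stp_sol stp_along_HH Hp Hx dx_along[OF Hx(1) stp_U]
        dx_along[OF Hp(1) stp_U, folded b_def] Hx_Hp_commute[OF smooth_HH] along_def[of U "Hx _ (Hp _ _)"] along_def[of U "Hp _ (Hx _ _)"])
  have 3: "dx i (dx i (dx j U)) z = dx j (dx i (dx i U)) z" for i j
  proof -
    have "dx i (dx j U) = dx j (dx i U)" by (intro ext dx_commute stp_U)
    then show ?thesis using dx_commute[OF stp_dx[OF stp_U], of i j i z] by simp
  qed
  have 4: "dx j (Lap U) z = (\<Sum>i\<in>UNIV. dx j (dx i (dx i U)) z)" for j
    unfolding Lap_def[abs_def] by (intro dx_sum stp_sol) simp
  have 5: "(\<Sum>j\<in>UNIV. b j z * dx j (Lap U) z) = (\<Sum>i\<in>UNIV. \<Sum>j\<in>UNIV. b j z * dx i (dx i (dx j U)) z)"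
    unfolding 4 sum_distrib_left
    by (rule trans[OF sum.swap]) (intro sum.cong refl arg_cong2[where f="(*)"] 3[symmetric])
  show ?thesis
    unfolding 5 unfolding Lap_def 2 R_def Q_def
    by (simp add: sum.distrib distrib_right sum_distrib_right sum_distrib_left)
qed

lemma tint_dt_Lap_UM:
  assumes t: "t \<in> {0..T}"
  shows "tint (\<lambda>x. dt (\<lambda>z. Lap U z * M z) (x, t)) = tint (\<lambda>x. (R (x, t) + Q (x, t)) * M (x, t)) - tint (\<lambda>x. Lap G (x, t) * M (x, t))"
proof -
  have dtLap: "dt (Lap U) z = Lap Hc z - Lap (Lap U) z - Lap G z" for z
  proof -
    have "dt (Lap U) z = (\<Sum>i\<in>UNIV. dt (dx i (dx i U)) z)"
      unfolding Lap_def[abs_def] by (intro dt_sum stp_sol) simp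
    also have "\<dots> = (\<Sum>i\<in>UNIV. dx i (dx i (dt U)) z)"
    proof (rule sum.cong)
      fix i
      have "dx i (dt U) = dt (dx i U)" by (intro ext dx_dt_commute stp_U)
      then show "dt (dx i (dx i U)) z = dx i (dx i (dt U)) z"
        using dx_dt_commute[OF stp_dx[OF stp_U], of i i z] by simp
    qed simp
    also have "\<dots> = (\<Sum>i\<in>UNIV. dx i (dx i Hc) z - dx i (dx i (Lap U)) z - dx i (dx i G) z)"
    proof (rule sum.cong)
      fix i
      have eq: "dt U = (\<lambda>z. Hc z - Lap U z - G z)" by (intro ext dt_U)
      have "dx i (dt U) = (\<lambda>z. dx i Hc z - dx i (Lap U) z - dx i G z)"
        unfolding eq by (intro ext) (simp add: dx_diff stp_sol)
      then show "dx i (dx i (dt U)) z = dx i (dx i Hc) z - dx i (dx i (Lap U)) z - dx i (dx i G) z"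
        by (simp add: dx_diff stp_sol)
    qed simp
    finally show ?thesis by (simp add: Lap_def[of "Lap U"] Lap_def[of Hc] Lap_def[of G] sum_subtractf)
  qed
  have LU: "stp (Lap U)" by (intro stp_sol)
  have "tint (\<lambda>x. dt (\<lambda>z. Lap U z * M z) (x, t)) =
      tint (\<lambda>x. dt M (x, t) * Lap U (x, t)) + tint (\<lambda>x. M (x, t) * (Lap Hc (x, t) - Lap (Lap U) (x, t) - Lap G (x, t)))"
    by (subst tint_add[symmetric]) (auto intro!: cper_sol simp: dt_mult stp_sol dtLap algebra_simps)
  also have "\<dots> = (tint (\<lambda>x. M (x, t) * Lap (Lap U) (x, t)) - tint (\<lambda>x. M (x, t) * (\<Sum>i\<in>UNIV. b i (x, t) * dx i (Lap U) (x, t))))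
      + tint (\<lambda>x. M (x, t) * (Lap Hc (x, t) - Lap (Lap U) (x, t) - Lap G (x, t)))"
    by (simp only: tint_dt_M_mult[OF t LU])
  also have "\<dots> = tint (\<lambda>x. (R (x, t) + Q (x, t)) * M (x, t) - Lap G (x, t) * M (x, t))"
    unfolding Lap_Hc
    by (subst tint_diff[symmetric], (auto intro!: cper_sol)[2], subst tint_add[symmetric], (auto intro!: cper_sol)[2])
       (simp add: algebra_simps)
  also have "\<dots> = tint (\<lambda>x. (R (x, t) + Q (x, t)) * M (x, t)) - tint (\<lambda>x. Lap G (x, t) * M (x, t))"
    by (intro tint_diff cper_sol)
  finally show ?thesis .
qed

definition kr where "kr = (\<lambda>y. (1 / \<epsilon> ^ CARD('d)) * \<eta> ((1 / \<epsilon>) *\<^sub>R y))"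
definition rr where "rr = \<epsilon> *\<^sub>R (One::real^'d)"

sublocale ker: sym_kernel kr rr
  unfolding kr_def rr_def by (rule mollifier_kernel(1)[OF mollifier \<epsilon>_pos])

lemma moll_eq: "moll \<eta> \<epsilon> = ker.conv"
  unfolding kr_def rr_def by (rule mollifier_kernel(2)[OF mollifier \<epsilon>_pos])

lemma G_conv: "t \<in> {0..T} \<Longrightarrow> G (x, t) = ker.conv (\<lambda>y. ker.conv (\<lambda>x. M (x, t)) y powr \<alpha>) x"
  by (simp add: G_eq g_eps_def moll_eq m_slice)

text \<open>Let \<phi>(h) pair \<open>m\<close> with \<open>G\<close> translated by \<open>h\<close>
  along a coordinate axis. By \<open>tint_second_difference_le\<close> the sum \<phi>(h) +
  \<phi>(-h) is largest at 0, and its second derivative there is twice the contribution of that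
  direction. Thus neither the power nor the convolution has to be differentiated.\<close>

lemma tint_Lap_G_nonpos:
  assumes t: "t \<in> {0..T}"
  shows "tint (\<lambda>x. Lap G (x, t) * M (x, t)) \<le> 0"
proof -
  have "tint (\<lambda>x. M (x, t) * dx i (dx i G) (x, t)) \<le> 0" for i
  proof -
    let ?e = "\<lambda>h. h *\<^sub>R axis i (1::real)"
    define \<phi> where "\<phi> w h = tint (\<lambda>x. M (x, t) * w (x + ?e h, t))" for w h
    have d: "(\<phi> w has_real_derivative \<phi> (dx i w) h) (at h)" if w: "stp w" for w h
      unfolding \<phi>_def[abs_def]
    proof (rule tint_has_real_derivative[where S=UNIV and F="\<lambda>x h. M (x, t) * w (x + ?e h, t)"
          and F'="\<lambda>x h. M (x, t) * dx i w (x + ?e h, t)"])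
      fix x h
      have "((\<lambda>s. w (x + s *\<^sub>R axis i 1, t)) has_real_derivative dx i w (x + ?e h, t)) (at h)"
        by (rule line_derivative_shift[where f="\<lambda>x. w (x, t)", OF dx_has_derivative[OF w]])
      then show "((\<lambda>h. M (x, t) * w (x + ?e h, t)) has_real_derivative M (x, t) * dx i w (x + ?e h, t)) (at h)"
        by (rule DERIV_cmult)
    next
      show "cper (\<lambda>x. M (x, t) * w (x + ?e h, t))" for h
        using cper_mult[OF stp_cper[OF stp_M] cper_shift[OF stp_cper[OF w], of "?e h" t]] .
      show "continuous_on (UNIV \<times> UNIV) (\<lambda>(x, h). M (x, t) * dx i w (x + ?e h, t))"
        unfolding case_prod_beta
        by (intro continuous_intros continuous_on_compose2[OF stp_continuous[OF stp_M, of UNIV]]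
            continuous_on_compose2[OF stp_continuous[OF stp_dx[OF w], of UNIV]]) auto
    qed auto
    have d': "((\<lambda>h. \<phi> w (- h)) has_real_derivative - \<phi> (dx i w) (- h)) (at h)" if w: "stp w" for w h
      using DERIV_chain2[OF d[OF w] DERIV_minus[OF DERIV_ident], of h] by simp
    have le: "2 * \<phi> G 0 - \<phi> G 0 - \<phi> G (- 0) \<le> 2 * \<phi> G 0 - \<phi> G s - \<phi> G (- s)" for s
    proof -
      have "\<phi> G s + \<phi> G (- s) \<le> 2 * \<phi> G 0"
        using ker.tint_second_difference_le[OF stp_cper[OF stp_M, of t] M_pos[OF t] \<alpha>_pos, of "?e s"]
        by (simp add: \<phi>_def G_conv[OF t])
      then show ?thesis by simp
    qed
    have "0 \<le> - \<phi> (dx i (dx i G)) 0 - \<phi> (dx i (dx i G)) (- 0)"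
    proof (rule second_derivative_nonneg_at_min(1))
      show "((\<lambda>h. 2 * \<phi> G 0 - \<phi> G h - \<phi> G (- h)) has_real_derivative - \<phi> (dx i G) s + \<phi> (dx i G) (- s)) (at s)" for s
        by (rule derivative_eq_intros d d' stp_sol refl)+ simp
      show "((\<lambda>s. - \<phi> (dx i G) s + \<phi> (dx i G) (- s)) has_real_derivative - \<phi> (dx i (dx i G)) 0 - \<phi> (dx i (dx i G)) (- 0)) (at 0)"
        by (rule derivative_eq_intros d d' stp_sol refl)+ simp
    qed (rule le)
    then show ?thesis by (simp add: \<phi>_def)
  qed
  moreover have "tint (\<lambda>x. Lap G (x, t) * M (x, t)) = (\<Sum>i\<in>UNIV. tint (\<lambda>x. M (x, t) * dx i (dx i G) (x, t)))"
    unfolding Lap_def sum_distrib_right by (subst tint_sum) (auto intro!: cper_sol simp: mult.commute)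
  ultimately show ?thesis by (simp add: sum_nonpos)
qed

lemma G_pos:
  assumes "t \<in> {0..T}"
  shows "0 < G (x, t)"
  unfolding G_conv[OF assms]
  by (intro ker.conv_pos cper_powr ker.cper_conv cper_sol M_pos assms powr_gt_zero[THEN iffD2] less_imp_neq[symmetric])

text \<open>Move one mollification onto \<open>w\<close>, which stays below \<open>K\<close>. Where
  \<open>2 * K \<le> z\<close> the integrand is at most half of \<open>g * z\<close>, whose integral
  is that of \<open>G M\<close>; elsewhere \<open>g \<le> (2 * K) powr \<alpha>\<close>. The factor
  one half is what makes the term absorbable in the energy identity.\<close>

lemma tint_G_mult_le:
  assumes t: "t \<in> {0..T}" and w: "cper w" "\<And>x. w x \<le> K" and K: "0 < K"
  shows "tint (\<lambda>x. G (x, t) * w x) \<le> tint (\<lambda>x. G (x, t) * M (x, t)) / 2 + K * (2 * K) powr \<alpha>"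
proof -
  define z where "z = ker.conv (\<lambda>x. M (x, t))"
  define g where "g x = z x powr \<alpha>" for x
  have z: "cper z" "\<And>x. 0 < z x" unfolding z_def by (auto intro!: ker.cper_conv ker.conv_pos cper_sol M_pos t)
  have g: "cper g" "\<And>x. 0 \<le> g x" unfolding g_def[abs_def] by (auto intro!: cper_powr z)
  have G: "G (x, t) = ker.conv g x" for x unfolding G_conv[OF t] g_def[abs_def] z_def ..
  have "tint (\<lambda>x. G (x, t) * w x) = tint (\<lambda>x. g x * ker.conv w x)"
    unfolding G by (rule ker.conv_self_adjoint[OF g(1) w(1)])
  also have "\<dots> \<le> tint (\<lambda>x. (1/2) * (g x * z x) + K * (2 * K) powr \<alpha>)"
  proof (rule tint_mono)
    fix x
    have "ker.conv w x \<le> K"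
      using ker.conv_mono[OF w(1) cper_const w(2)] by (simp add: ker.conv_const)
    then have "g x * ker.conv w x \<le> g x * K" by (intro mult_left_mono g)
    also have "\<dots> \<le> (1/2) * (g x * z x) + K * (2 * K) powr \<alpha>"
    proof (cases "2 * K \<le> z x")
      case True
      then have "g x * (2 * K) \<le> g x * z x" by (intro mult_left_mono g)
      moreover have "0 \<le> K * (2 * K) powr \<alpha>" using K by simp
      ultimately show ?thesis by simp
    next
      case False
      then have "g x \<le> (2 * K) powr \<alpha>" unfolding g_def using z(2)[of x] \<alpha>_pos by (intro powr_mono2) auto
      then have "g x * K \<le> K * (2 * K) powr \<alpha>" using K by (simp add: mult.commute)
      moreover have "0 \<le> g x * z x" using g(2)[of x] z(2)[of x] by simp
      ultimately show ?thesis by simp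
    qed
    finally show "g x * ker.conv w x \<le> (1/2) * (g x * z x) + K * (2 * K) powr \<alpha>" .
  qed (intro cper_intros g z ker.cper_conv w)+
  also have "\<dots> = (1/2) * tint (\<lambda>x. g x * z x) + K * (2 * K) powr \<alpha>"
    by (subst tint_add, (intro cper_intros g z)+) (simp only: tint_const tint_cmult)
  also have "tint (\<lambda>x. g x * z x) = tint (\<lambda>x. G (x, t) * M (x, t))"
    unfolding G z_def by (rule ker.conv_self_adjoint[symmetric]) (intro g cper_sol)+
  finally show ?thesis by simp
qed

end

subsection \<open>Structural bounds on the Hamiltonian\<close>

text \<open>The limit in (A1) is pointwise in \<open>x\<close>. A sequence violating the uniform
  claim has momenta tending to infinity; convexity along the segments to 0 bounds \<open>H\<close>
  by \<open>C0 + R * K\<close> at every fixed distance \<open>R\<close>, and compactness of the cell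
  times the unit sphere carries this bound to one limiting ray, where it contradicts
  superlinearity.\<close>

lemma uniform_superlinear:
  fixes H :: "real^'d \<Rightarrow> real^'d \<Rightarrow> real"
  assumes cont: "continuous_on UNIV (\<lambda>z. H (fst z) (snd z))"
    and per: "\<And>p. periodic (\<lambda>x. H x p)"
    and convex: "\<And>x. strict_convex_fun (H x)"
    and super: "\<And>x. filterlim (\<lambda>p. H x p / norm p) at_top at_infinity"
    and H0: "\<And>x. H x 0 \<le> C0" and H_nonneg: "\<And>x p. 0 \<le> H x p" and K: "K > 0"
  shows "\<exists>C. \<forall>x p. K * norm p \<le> H x p + C"
proof (rule ccontr)
  assume neg: "\<not> ?thesis"
  have "\<exists>q. fst q \<in> torus_cell \<and> K * norm (snd q) > H (fst q) (snd q) + real n" for n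
  proof -
    obtain x p where xp: "K * norm p > H x p + real n" using neg by (meson not_le)
    obtain y where "y \<in> torus_cell" "H x p = H y p"
      using torus_cell_representative[where x=x and 'b=real] per[of p] by metis
    with xp show ?thesis by (intro exI[of _ "(y, p)"]) simp
  qed
  then have "\<forall>n. \<exists>q. fst q \<in> torus_cell \<and> K * norm (snd q) > H (fst q) (snd q) + real n" by blast
  from choice[OF this] obtain q where
    q: "\<forall>n. fst (q n) \<in> torus_cell \<and> K * norm (snd (q n)) > H (fst (q n)) (snd (q n)) + real n" by blast
  define X P where "X n = fst (q n)" and "P n = snd (q n)" for n
  have XP: "X n \<in> torus_cell" "K * norm (P n) > H (X n) (P n) + real n" for n
    using q by (auto simp: X_def P_def)
  define e where "e n = P n /\<^sub>R norm (P n)" for n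
  have P_large: "norm (P n) > real n / K" for n
    using XP(2)[of n] H_nonneg[of "X n" "P n"] K by (simp add: divide_less_eq mult.commute)
  have P_pos: "norm (P n) > 0" for n
  proof -
    have "0 \<le> real n / K" using K by simp
    with P_large[of n] show ?thesis by linarith
  qed
  have mem: "\<forall>n. (X n, e n) \<in> torus_cell \<times> sphere 0 1"
    using XP(1) P_pos by (simp add: e_def)
  have "compact (torus_cell \<times> sphere (0::real^'d) 1 :: ((real^'d) \<times> (real^'d)) set)"
    by (intro compact_Times compact_torus_cell compact_sphere)
  then have "seq_compact (torus_cell \<times> sphere (0::real^'d) 1 :: ((real^'d) \<times> (real^'d)) set)"
    by (rule compact_imp_seq_compact)
  from seq_compactE[OF this mem] obtain l r where
    l: "l \<in> torus_cell \<times> sphere 0 1" "strict_mono r" "((\<lambda>n. (X n, e n)) \<circ> r) \<longlonglongrightarrow> l" by blast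
  obtain x d where xd: "l = (x, d)" by (cases l)
  have limX: "(\<lambda>n. X (r n)) \<longlonglongrightarrow> x" and lime: "(\<lambda>n. e (r n)) \<longlonglongrightarrow> d"
    using tendsto_fst[OF l(3)] tendsto_snd[OF l(3)] by (simp_all add: o_def xd)
  have d: "norm d = 1" using l(1) xd by simp
  have bound: "H x (R *\<^sub>R d) \<le> C0 + R * K" if R: "R > 0" for R
  proof -
    have ev: "\<forall>\<^sub>F n in sequentially. H (X (r n)) (R *\<^sub>R e (r n)) \<le> C0 + R * K"
    proof (rule eventually_sequentiallyI)
      fix n assume n: "nat \<lceil>R * K\<rceil> \<le> n"
      have "real n \<ge> R * K" using n by linarith
      moreover have "real (r n) \<ge> real n" using seq_suble[OF l(2), of n] by simp
      ultimately have "R \<le> real (r n) / K" using K by (simp add: le_divide_eq)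
      then have PR: "R < norm (P (r n))" using P_large[of "r n"] by linarith
      define s where "s = R / norm (P (r n))"
      have s: "0 < s" "s < 1" using R PR P_pos[of "r n"] by (auto simp: s_def divide_less_eq)
      have eq: "R *\<^sub>R e (r n) = (1 - s) *\<^sub>R 0 + s *\<^sub>R P (r n)" by (simp add: e_def s_def divide_inverse)
      have "H (X (r n)) (R *\<^sub>R e (r n)) < (1 - s) * H (X (r n)) 0 + s * H (X (r n)) (P (r n))"
        using convex[of "X (r n)", unfolded strict_convex_fun_def, rule_format, of 0 "P (r n)" s] s P_pos[of "r n"]
        unfolding eq by auto
      also have "\<dots> \<le> 1 * C0 + s * (K * norm (P (r n)))"
      proof (intro add_mono mult_left_mono)
        have "(1 - s) * H (X (r n)) 0 \<le> 1 * H (X (r n)) 0" using s H_nonneg by (intro mult_right_mono) auto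
        then show "(1 - s) * H (X (r n)) 0 \<le> 1 * C0" using H0[of "X (r n)"] by linarith
        show "H (X (r n)) (P (r n)) \<le> K * norm (P (r n))" using XP(2)[of "r n"] by linarith
      qed (use s in auto)
      also have "s * (K * norm (P (r n))) = R * K" using P_pos[of "r n"] by (simp add: s_def)
      finally show "H (X (r n)) (R *\<^sub>R e (r n)) \<le> C0 + R * K" by simp
    qed
    have "(\<lambda>n. (X (r n), R *\<^sub>R e (r n))) \<longlonglongrightarrow> (x, R *\<^sub>R d)"
      by (intro tendsto_intros limX lime)
    from continuous_on_tendsto_compose[OF cont this]
    have "(\<lambda>n. H (X (r n)) (R *\<^sub>R e (r n))) \<longlonglongrightarrow> H x (R *\<^sub>R d)" by simp
    from tendsto_upperbound[OF this ev] show ?thesis by simp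
  qed
  have "C0 \<ge> 0" using H0[of 0] H_nonneg[of 0 0] by linarith
  \<comment> \<open>A slope of \<open>K + C0 + 1\<close> overtakes the bound
    \<open>C0 + R * K\<close> on the ray as soon as \<open>R \<ge> 1\<close>.\<close>
  from super[of x] have "\<forall>\<^sub>F p in at_infinity. K + C0 + 1 \<le> H x p / norm p"
    unfolding filterlim_at_top by blast
  then obtain B where B: "\<And>p. norm p \<ge> B \<Longrightarrow> K + C0 + 1 \<le> H x p / norm p"
    unfolding eventually_at_infinity by blast
  define R where "R = max 1 B"
  have R: "R \<ge> 1" "R \<ge> B" by (auto simp: R_def)
  have "K + C0 + 1 \<le> H x (R *\<^sub>R d) / R" using B[of "R *\<^sub>R d"] R d by simp
  then have "(K + C0 + 1) * R \<le> H x (R *\<^sub>R d)" using R by (simp add: le_divide_eq)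
  also have "\<dots> \<le> C0 + R * K" using bound[of R] R by simp
  finally have "(C0 + 1) * R \<le> C0" by (simp add: algebra_simps)
  moreover have "(C0 + 1) * R \<ge> (C0 + 1) * 1" using R \<open>C0 \<ge> 0\<close> by (intro mult_left_mono) auto
  ultimately show False by simp
qed

lemma abs_trace_le: "\<bar>trace A\<bar> \<le> real CARD('d) * norm (A :: real^'d^'d)"
proof -
  have "\<bar>A $ i $ i\<bar> \<le> norm A" for i
    by (meson Finite_Cartesian_Product.norm_nth_le component_le_norm_cart order_trans)
  then have "(\<Sum>i\<in>UNIV. \<bar>A $ i $ i\<bar>) \<le> (\<Sum>i\<in>(UNIV::'d set). norm A)" by (intro sum_mono)
  then show ?thesis unfolding trace_def by (intro order_trans[OF sum_abs]) simp
qed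

subsection \<open>First and second order energy estimates\<close>

context mfg_solution
begin

abbreviation J where "J f \<equiv> integral {0..T} (\<lambda>t. tint (\<lambda>x. f (x, t) * M (x, t)))"

lemma J_integrable: "stp f \<Longrightarrow> (\<lambda>t. tint (\<lambda>x. f (x, t) * M (x, t))) integrable_on {0..T}"
  by (intro integrable_continuous_interval tint_stp_continuous[of "\<lambda>z. f z * M z", simplified] stp_sol)

lemma J_add: "stp f \<Longrightarrow> stp g \<Longrightarrow> J (\<lambda>z. f z + g z) = J f + J g"
  by (subst integral_add[symmetric], (intro J_integrable; assumption)+, intro integral_cong, subst tint_add[symmetric])
     (auto intro!: cper_sol simp: algebra_simps)

lemma J_cmult: "J (\<lambda>z. c * f z) = c * J f"
  by (simp add: mult.assoc)

lemma J_const: "J (\<lambda>z. c) = c * T"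
proof -
  have "J (\<lambda>z. c) = integral {0..T} (\<lambda>t. c)"
    by (intro integral_cong) (simp add: mass)
  then show ?thesis using T_pos by simp
qed

lemma J_mono:
  assumes "stp f" "stp g" "\<And>z. f z \<le> g z"
  shows "J f \<le> J g"
  by (intro integral_le J_integrable assms tint_mono cper_sol mult_right_mono less_imp_le M_pos) auto

lemma J_G_nonneg: "0 \<le> J G"
  by (intro integral_nonneg J_integrable stp_sol tint_nonneg cper_sol mult_nonneg_nonneg less_imp_le M_pos G_pos)

lemma abs_tint_mult_M:
  assumes t: "t \<in> {0..T}" and f: "cper f" "\<And>x. \<bar>f x\<bar> \<le> B"
  shows "\<bar>tint (\<lambda>x. f x * M (x, t))\<bar> \<le> B"
proof -
  have le: "- B \<le> f x" "f x \<le> B" for x using f(2)[of x] by auto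
  have "tint (\<lambda>x. f x * M (x, t)) \<le> tint (\<lambda>x. B * M (x, t))"
    by (intro tint_mono mult_right_mono cper_sol f le less_imp_le[OF M_pos] t)
  moreover have "tint (\<lambda>x. (- B) * M (x, t)) \<le> tint (\<lambda>x. f x * M (x, t))"
    by (intro tint_mono mult_right_mono cper_sol f le less_imp_le[OF M_pos] t)
  ultimately show ?thesis unfolding tint_cmult by (simp add: mass[OF t] abs_le_iff)
qed

text \<open>Pair the first equation with a fixed weight and integrate the Laplacian by parts: what
  remains is \<open>H w + Du \<cdot> Dw\<close>, bounded below by hypothesis, and the potential,
  which costs at most half of \<open>J G\<close>. It is applied to \<open>m0\<close> and to the
  corrected weight in \<open>energy_bound\<close>.\<close>

lemma tint_U0_upper:
  assumes w: "smooth_fun w" "periodic w" "\<And>x. w x \<le> K" "0 < K"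
    and lower: "\<And>x p. - Cw \<le> H x p * w x + (\<Sum>i\<in>UNIV. p $ i * dd w (axis i 1) x)"
    and B: "\<And>x. uT x * w x \<le> B"
  shows "tint (\<lambda>x. U (x, 0) * w x) \<le> B + T * (Cw + K * (2 * K) powr \<alpha>) + J G / 2"
proof -
  note W = stp_static[OF w(1,2)]
  have cw: "cper w" using w smooth_fun_continuous_on[of w UNIV] by (simp add: cper_def)
  have UW: "stp (\<lambda>z. U z * w (fst z))" by (intro stp_sol W)
  have ge: "- (Cw + K * (2 * K) powr \<alpha>) - (1/2) * tint (\<lambda>x. G (x, t) * M (x, t)) \<le> tint (\<lambda>x. dt (\<lambda>z. U z * w (fst z)) (x, t))"
    if t: "t \<in> {0..T}" for t
  proof -
    have "- Cw = tint (\<lambda>x::real^'d. - Cw)" by (rule tint_const[symmetric])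
    also have "\<dots> \<le> tint (\<lambda>x. Hc (x, t) * w x + (\<Sum>i\<in>UNIV. dx i U (x, t) * dd w (axis i 1) x))"
    proof (rule tint_mono)
      show "- Cw \<le> Hc (x, t) * w x + (\<Sum>i\<in>UNIV. dx i U (x, t) * dd w (axis i 1) x)" for x
        using lower[of x "Du U (x, t)"] by (simp add: Hc_def along_def HH_def Du_def)
      have "cper (\<lambda>x. dx i (\<lambda>z. w (fst z)) (x, t))" for i by (intro cper_sol W)
      then have "cper (\<lambda>x. dd w (axis i 1) x)" for i by (simp add: W)
      then show "cper (\<lambda>x. Hc (x, t) * w x + (\<Sum>i\<in>UNIV. dx i U (x, t) * dd w (axis i 1) x))"
        by (intro cper_sol cw)
    qed (rule cper_const)
    moreover have "tint (\<lambda>x. G (x, t) * w x) \<le> tint (\<lambda>x. G (x, t) * M (x, t)) / 2 + K * (2 * K) powr \<alpha>"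
      by (rule tint_G_mult_le[OF t cw w(3,4)])
    ultimately show ?thesis
      unfolding tint_dt_U_static[OF W(1,2)] W(3) by simp
  qed
  have "integral {0..T} (\<lambda>t. - (Cw + K * (2 * K) powr \<alpha>) - (1/2) * tint (\<lambda>x. G (x, t) * M (x, t)))
      \<le> integral {0..T} (\<lambda>t. tint (\<lambda>x. dt (\<lambda>z. U z * w (fst z)) (x, t)))"
    using ge
    by (intro integral_le integrable_continuous_interval continuous_intros tint_stp_continuous UW
        tint_stp_continuous[of "\<lambda>z. G z * M z", simplified] stp_sol) auto
  also have "\<dots> = tint (\<lambda>x. uT x * w x) - tint (\<lambda>x. U (x, 0) * w x)"
    using tint_stp_FTC[OF UW] T_pos by (simp add: terminal)
  also have "tint (\<lambda>x. uT x * w x) \<le> tint (\<lambda>x::real^'d. B)"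
  proof (rule tint_mono)
    have "cper uT" using uT_smooth smooth_fun_continuous_on[of uT UNIV] by (simp add: cper_def)
    then show "cper (\<lambda>x. uT x * w x)" by (intro cper_mult cw)
  qed (auto intro: cper_const B)
  also have "integral {0..T} (\<lambda>t. - (Cw + K * (2 * K) powr \<alpha>) - (1/2) * tint (\<lambda>x. G (x, t) * M (x, t)))
      = - T * (Cw + K * (2 * K) powr \<alpha>) - J G / 2"
  proof -
    have "(\<lambda>t. (1/2) * tint (\<lambda>x. G (x, t) * M (x, t))) integrable_on {0..T}"
      using integrable_on_cmult_left[OF J_integrable[OF stp_G], of "1/2"] by simp
    then show ?thesis using T_pos by (subst integral_diff) (auto simp del: times_divide_eq_left simp: algebra_simps)
  qed
  finally show ?thesis by (simp add: tint_const)
qed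

lemma energy_identity:
  "J Lh + J G = tint (\<lambda>x. U (x, 0) * m0 x) - tint (\<lambda>x. uT x * M (x, T))"
proof -
  have UM: "stp (\<lambda>z. U z * M z)" by (intro stp_sol)
  have "- (J Lh + J G) = integral {0..T} (\<lambda>t. - tint (\<lambda>x. Lh (x, t) * M (x, t)) - tint (\<lambda>x. G (x, t) * M (x, t)))"
    by (subst integral_diff) (auto intro!: J_integrable integrable_neg stp_sol)
  also have "\<dots> = integral {0..T} (\<lambda>t. tint (\<lambda>x. dt (\<lambda>z. U z * M z) (x, t)))"
    by (intro integral_cong) (simp add: tint_dt_UM)
  also have "\<dots> = tint (\<lambda>x. uT x * M (x, T)) - tint (\<lambda>x. U (x, 0) * m0 x)"
    using tint_stp_FTC[OF UM] T_pos by (simp add: terminal initial)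
  finally show ?thesis by simp
qed

lemma cper_uT: "cper uT" and cper_m0: "cper m0"
  using uT_smooth m0_smooth smooth_fun_continuous_on[of uT UNIV] smooth_fun_continuous_on[of m0 UNIV] by (simp_all add: cper_def)

text \<open>In \<open>energy_identity\<close> the full \<open>J G\<close> stands against the half
  conceded by \<open>tint_U0_upper\<close>, so half of it survives on the left. The lower bound for
  the pairing of \<open>u(0)\<close> with \<open>m0\<close> is kept for the second order
  estimate.\<close>

lemma first_order_estimate:
  assumes Lh: "\<And>z. c * Hc z - C \<le> Lh z" and uT: "\<And>x. \<bar>uT x\<bar> \<le> B" and "0 \<le> c" "\<And>z. 0 \<le> Hc z"
    and m0: "\<And>x. m0 x \<le> K" "0 < K"
    and lower: "\<And>x p. - Cw \<le> H x p * m0 x + (\<Sum>i\<in>UNIV. p $ i * dd m0 (axis i 1) x)"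
  shows "c * J Hc + J G / 2 \<le> B * K + B + T * (Cw + K * (2 * K) powr \<alpha> + C)"
    "- B - C * T \<le> tint (\<lambda>x. U (x, 0) * m0 x)"
proof -
  have uTM: "\<bar>tint (\<lambda>x. uT x * M (x, T))\<bar> \<le> B"
    using T_pos by (intro abs_tint_mult_M cper_uT uT) auto
  have Lh_lower: "c * J Hc - C * T \<le> J Lh"
  proof -
    have "J (\<lambda>z. c * Hc z + (- C)) \<le> J Lh" using Lh by (intro J_mono stp_sol) (simp add: algebra_simps)
    moreover have "J (\<lambda>z. c * Hc z + (- C)) = c * J Hc + (- C) * T"
      by (subst J_add, (intro stp_sol)+) (simp only: J_cmult J_const)
    ultimately show ?thesis by simp
  qed
  have "uT x * m0 x \<le> B * K" for x
  proof -
    have "uT x * m0 x \<le> B * m0 x" using uT[of x] \<kappa>0(1) \<kappa>0(2)[of x] by (intro mult_right_mono) auto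
    also have "\<dots> \<le> B * K" using uT[of x] m0(1)[of x] by (intro mult_left_mono) auto
    finally show ?thesis .
  qed
  from tint_U0_upper[OF m0_smooth m0 lower this] energy_identity uTM Lh_lower
  show "c * J Hc + J G / 2 \<le> B * K + B + T * (Cw + K * (2 * K) powr \<alpha> + C)" by (simp add: algebra_simps)
  have "0 \<le> J Hc"
    by (intro integral_nonneg J_integrable stp_sol tint_nonneg cper_sol mult_nonneg_nonneg less_imp_le[OF M_pos] assms) auto
  then have "0 \<le> c * J Hc" using \<open>0 \<le> c\<close> by simp
  with energy_identity uTM Lh_lower J_G_nonneg show "- B - C * T \<le> tint (\<lambda>x. U (x, 0) * m0 x)" by simp
qed

text \<open>The potential enters through the integral of \<open>m \<Delta>G\<close>, which has the
  favourable sign and is dropped; unit mass controls the terminal term, and integration by parts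
  moves the initial Laplacian onto the given \<open>m0\<close>.\<close>

lemma second_order_estimate:
  assumes RQ: "\<And>z. Q z / 2 - C * Hc z \<le> R z + Q z" and uT: "\<And>x. \<bar>lap uT x\<bar> \<le> B"
  shows "J Q / 2 \<le> C * J Hc + B - tint (\<lambda>x. U (x, 0) * lap m0 x)"
proof -
  have LUM: "stp (\<lambda>z. Lap U z * M z)" by (intro stp_sol)
  have uTeq: "(\<lambda>x. U (x, T)) = uT" by (intro ext terminal)
  have LT: "Lap U (x, T) = lap uT x" for x using lap_slice[of U T x] by (simp add: uTeq)
  have c: "cper (lap uT)" unfolding LT[symmetric, abs_def] by (intro cper_sol)
  note W = stp_static[OF m0_smooth]
  have "tint (\<lambda>x. Lap U (x, 0) * m0 x) = tint (\<lambda>x. U (x, 0) * Lap (\<lambda>z. m0 (fst z)) (x, 0))"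
    using tint_Lap_commute[OF stp_U W(1), of 0] by simp
  also have "(\<lambda>x. Lap (\<lambda>z. m0 (fst z)) (x, 0)) = lap m0"
    using lap_slice[of "\<lambda>z. m0 (fst z)" 0] by (auto simp: fun_eq_iff)
  then have "tint (\<lambda>x. U (x, 0) * Lap (\<lambda>z. m0 (fst z)) (x, 0)) = tint (\<lambda>x. U (x, 0) * lap m0 x)"
    by (simp add: fun_eq_iff)
  finally have L0: "tint (\<lambda>x. Lap U (x, 0) * m0 x) = tint (\<lambda>x. U (x, 0) * lap m0 x)" .
  have "J (\<lambda>z. Q z / 2 - C * Hc z) \<le> J (\<lambda>z. R z + Q z)"
  proof (rule J_mono)
    have "stp (\<lambda>z. (1/2) * Q z - C * Hc z)" by (intro stp_sol)
    then show "stp (\<lambda>z. Q z / 2 - C * Hc z)" by simp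
  qed (intro stp_sol RQ)+
  also have "\<dots> \<le> integral {0..T} (\<lambda>t. tint (\<lambda>x. dt (\<lambda>z. Lap U z * M z) (x, t)))"
  proof (rule integral_le)
    show "tint (\<lambda>x. (R (x, t) + Q (x, t)) * M (x, t)) \<le> tint (\<lambda>x. dt (\<lambda>z. Lap U z * M z) (x, t))"
      if "t \<in> {0..T}" for t
      using tint_Lap_G_nonpos[OF that] by (simp add: tint_dt_Lap_UM[OF that])
    show "(\<lambda>t. tint (\<lambda>x. (R (x, t) + Q (x, t)) * M (x, t))) integrable_on {0..T}"
      by (intro J_integrable[of "\<lambda>z. R z + Q z"] stp_sol)
    show "(\<lambda>t. tint (\<lambda>x. dt (\<lambda>z. Lap U z * M z) (x, t))) integrable_on {0..T}"
      by (intro integrable_continuous_interval tint_stp_continuous stp_sol)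
  qed
  also have "\<dots> = tint (\<lambda>x. lap uT x * M (x, T)) - tint (\<lambda>x. U (x, 0) * lap m0 x)"
    using tint_stp_FTC[OF LUM] T_pos by (simp add: LT initial L0)
  also have "\<dots> \<le> B - tint (\<lambda>x. U (x, 0) * lap m0 x)"
    using abs_tint_mult_M[of T "lap uT" B] T_pos c uT by (simp add: abs_le_iff)
  also have "J (\<lambda>z. Q z / 2 - C * Hc z) = J Q / 2 - C * J Hc"
  proof -
    have "J (\<lambda>z. (1/2) * Q z + (- C) * Hc z) = (1/2) * J Q + (- C) * J Hc"
      by (subst J_add, (intro stp_sol)+) (simp only: J_cmult)
    then show ?thesis by simp
  qed
  finally show ?thesis by simp
qed

end

section \<open>Matrix form of the second order terms and their bounds\<close>

lemma sum_reverse3: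
  "(\<Sum>i\<in>A. \<Sum>j\<in>B. \<Sum>k\<in>C. f i j k) = (\<Sum>k\<in>C. \<Sum>j\<in>B. \<Sum>i\<in>A. f i j k)"
proof -
  have "(\<Sum>i\<in>A. \<Sum>j\<in>B. \<Sum>k\<in>C. f i j k) = (\<Sum>i\<in>A. \<Sum>k\<in>C. \<Sum>j\<in>B. f i j k)"
    by (intro sum.cong refl sum.swap)
  also have "\<dots> = (\<Sum>k\<in>C. \<Sum>i\<in>A. \<Sum>j\<in>B. f i j k)" by (rule sum.swap)
  also have "\<dots> = (\<Sum>k\<in>C. \<Sum>j\<in>B. \<Sum>i\<in>A. f i j k)" by (intro sum.cong refl sum.swap)
  finally show ?thesis .
qed

text \<open>Testing with \<open>s *\<^sub>R M\<close> and \<open>- s *\<^sub>R M\<close> multiplies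
  the quadratic term by \<open>s^2\<close>, while the linear term on the left takes both signs. A
  negative quadratic term would violate one of the two inequalities for large
  \<open>s\<close>.\<close>

lemma trace_square_nonneg:
  fixes A P :: "real^'d^'d"
  assumes le: "\<And>M. symmetric_mat M \<Longrightarrow> trace (P ** M) \<le> \<delta> * trace (A ** (M ** M)) + K"
    and \<delta>: "\<delta> > 0" and M: "symmetric_mat M"
  shows "0 \<le> trace (A ** (M ** M))"
proof (rule ccontr)
  define q where "q = trace (A ** (M ** M))"
  assume "\<not> 0 \<le> trace (A ** (M ** M))"
  then have q: "q < 0" by (simp add: q_def)
  have scale: "trace (P ** (s *\<^sub>R M)) = s * trace (P ** M)" "trace (A ** ((s *\<^sub>R M) ** (s *\<^sub>R M))) = s^2 * q" for s
    by (simp_all add: q_def trace_def matrix_matrix_mult_def sum_distrib_left power2_eq_square mult_ac)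
  have sym: "symmetric_mat (s *\<^sub>R M)" for s
    using M by (simp add: symmetric_mat_def transpose_def vec_eq_iff)
  have le': "s * trace (P ** M) \<le> \<delta> * (s^2 * q) + K" for s
    using le[OF sym[of s]] unfolding scale .
  \<comment> \<open>Chosen so that \<open>\<delta> * (s^2 * q) = - (\<bar>K\<bar> + 1)\<close>,
    which makes the right-hand side negative for both signs.\<close>
  define s where "s = sqrt ((\<bar>K\<bar> + 1) / (- \<delta> * q))"
  have pos: "0 < - \<delta> * q" using \<delta> q by (simp add: mult_pos_neg)
  then have "0 \<le> (\<bar>K\<bar> + 1) / (- \<delta> * q)" by (intro divide_nonneg_pos) auto
  then have "s^2 = (\<bar>K\<bar> + 1) / (- \<delta> * q)" unfolding s_def by (rule real_sqrt_pow2)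
  then have "\<delta> * (s^2 * q) = - (\<bar>K\<bar> + 1)" using \<delta> q by (simp add: field_simps)
  with le'[of s] le'[of "- s"] show False by (simp add: abs_if split: if_splits)
qed

lemma powr_derivative:
  assumes "(g has_real_derivative D) (at s within S)" "0 < g s"
  shows "((\<lambda>s. g s powr \<gamma>) has_real_derivative \<gamma> * g s powr (\<gamma> - 1) * D) (at s within S)"
  using DERIV_chain2[OF has_real_derivative_powr[OF assms(2)] assms(1)] .

context mfg_solution
begin

definition D2U where "D2U z = (\<chi> i j. dx i (dx j U) z)"

lemma D2U_symmetric: "symmetric_mat (D2U z)"
  using dx_commute[OF stp_U] by (simp add: symmetric_mat_def transpose_def D2U_def vec_eq_iff)

lemma Hc_eq: "Hc z = H (fst z) (Du U z)"
  by (simp add: Hc_def along_def HH_def)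

lemma Lh_eq: "Lh z = Lhat H (fst z) (Du U z)"
  by (cases z) (simp add: Lh_def Lhat_def b_eq Hc_eq inner_vec_def Du_def)

lemma along_eq:
  "along U (Hp i (Hp j HH)) z = D2ppH H (fst z) (Du U z) $ i $ j"
  "along U (Hx i (Hx j HH)) z = D2xxH H (fst z) (Du U z) $ i $ j"
  "along U (Hp i (Hx j HH)) z = D2pxH H (fst z) (Du U z) $ i $ j"
  "along U (Hx i (Hp j HH)) z = D2xpH H (fst z) (Du U z) $ i $ j"
  using Hamiltonian_derivatives[of H] by (simp_all add: along_def HH_def[abs_def])

lemma Q_eq: "Q z = trace (D2ppH H (fst z) (Du U z) ** (D2U z ** D2U z))"
proof -
  let ?A = "D2ppH H (fst z) (Du U z)"
  have "Q z = (\<Sum>i\<in>UNIV. \<Sum>j\<in>UNIV. \<Sum>k\<in>UNIV. ?A $ k $ j * (D2U z $ j $ i * D2U z $ i $ k))"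
    unfolding Q_def along_eq
  proof (intro sum.cong refl)
    fix i j k
    have "dx i (dx j U) z = D2U z $ j $ i" using dx_commute[OF stp_U, of i j z] by (simp add: D2U_def)
    then show "?A $ k $ j * dx i (dx k U) z * dx i (dx j U) z = ?A $ k $ j * (D2U z $ j $ i * D2U z $ i $ k)"
      by (simp add: D2U_def)
  qed
  also have "\<dots> = (\<Sum>k\<in>UNIV. \<Sum>j\<in>UNIV. \<Sum>i\<in>UNIV. ?A $ k $ j * (D2U z $ j $ i * D2U z $ i $ k))"
    by (rule sum_reverse3)
  finally show ?thesis by (simp add: trace_def matrix_matrix_mult_def sum_distrib_left)
qed

lemma R_eq: "R z = trace (D2xxH H (fst z) (Du U z)) + 2 * trace (D2pxH H (fst z) (Du U z) ** D2U z)"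
proof -
  let ?P = "D2pxH H (fst z) (Du U z)"
  have "(\<Sum>i\<in>UNIV. \<Sum>j\<in>UNIV. ?P $ j $ i * dx i (dx j U) z) = trace (?P ** D2U z)"
    unfolding trace_def matrix_matrix_mult_def by (subst sum.swap) (simp add: D2U_def)
  then show ?thesis by (simp add: R_def along_eq trace_def[of "D2xxH _ _ _"])
qed

lemma divb_eq: "divb z = trace (D2xpH H (fst z) (Du U z)) + trace (D2ppH H (fst z) (Du U z) ** D2U z)"
proof -
  have Hp: "smooth_fun (Hp j HH)" for j by (intro smooth_Hp smooth_HH)
  have "divb z = (\<Sum>i\<in>UNIV. along U (Hx i (Hp i HH)) z) + (\<Sum>i\<in>UNIV. \<Sum>j\<in>UNIV. along U (Hp j (Hp i HH)) z * dx i (dx j U) z)"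
    unfolding divb_def b_def dx_along[OF Hp stp_U] by (rule sum.distrib)
  also have "(\<Sum>i\<in>UNIV. \<Sum>j\<in>UNIV. along U (Hp j (Hp i HH)) z * dx i (dx j U) z) = trace (D2ppH H (fst z) (Du U z) ** D2U z)"
    unfolding trace_def matrix_matrix_mult_def along_eq by (subst sum.swap) (simp add: D2U_def)
  finally show ?thesis by (simp add: along_eq trace_def[of "D2xpH _ _ _"])
qed

text \<open>Positivity of \<open>Q\<close> is extracted from (A5) by scaling rather than from convexity of \<open>H\<close>.\<close>
lemma Q_nonneg:
  assumes A5b: "\<And>M x p. symmetric_mat M \<Longrightarrow> trace (D2pxH H x p ** M) \<le> \<delta> * trace (D2ppH H x p ** (M ** M)) + C * H x p"
    and "\<delta> > 0"
  shows "0 \<le> Q z"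
  unfolding Q_eq by (rule trace_square_nonneg[OF A5b assms(2) D2U_symmetric])

text \<open>(A5) bounds the mixed trace from above; inserting the negative Hessian, whose square is
  the same, gives the bound from below. The mixed trace enters \<open>R\<close> twice, so the
  coefficient 1/4 costs half of \<open>Q\<close>.\<close>

lemma RQ_lower:
  assumes A5a: "\<And>x p. norm (D2xxH H x p) \<le> C * H x p + C"
    and A5b: "\<And>M x p. symmetric_mat M \<Longrightarrow> trace (D2pxH H x p ** M) \<le> (1/4) * trace (D2ppH H x p ** (M ** M)) + C' * H x p"
    and H1: "\<And>x p. 1 \<le> H x p"
  shows "Q z / 2 - (2 * real CARD('d) * \<bar>C\<bar> + 2 * C') * Hc z \<le> R z + Q z"
proof -
  let ?x = "fst z" and ?p = "Du U z"
  let ?h = "H ?x ?p"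
  have "\<bar>trace (D2xxH H ?x ?p)\<bar> \<le> real CARD('d) * (2 * \<bar>C\<bar> * ?h)"
  proof (rule order_trans[OF abs_trace_le mult_left_mono])
    have "norm (D2xxH H ?x ?p) \<le> C * ?h + C" by (rule A5a)
    also have "\<dots> \<le> \<bar>C\<bar> * ?h + \<bar>C\<bar> * ?h"
      using H1[of ?x ?p] by (intro add_mono mult_right_mono order_trans[OF abs_ge_self[of C]]) (auto intro: mult_left_mono[of 1 ?h "\<bar>C\<bar>", simplified])
    finally show "norm (D2xxH H ?x ?p) \<le> 2 * \<bar>C\<bar> * ?h" by simp
  qed simp
  moreover have "trace (D2pxH H ?x ?p ** (- D2U z)) \<le> (1/4) * trace (D2ppH H ?x ?p ** ((- D2U z) ** (- D2U z))) + C' * ?h"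
    using D2U_symmetric[of z] by (intro A5b) (simp add: symmetric_mat_def transpose_def vec_eq_iff)
  moreover have "(- D2U z) ** (- D2U z) = D2U z ** D2U z" "trace (D2pxH H ?x ?p ** (- D2U z)) = - trace (D2pxH H ?x ?p ** D2U z)"
    by (simp_all add: matrix_matrix_mult_def vec_eq_iff trace_def sum_negf)
  ultimately have "- trace (D2pxH H ?x ?p ** D2U z) \<le> Q z / 4 + C' * ?h"
      "- (real CARD('d) * (2 * \<bar>C\<bar> * ?h)) \<le> trace (D2xxH H ?x ?p)"
    by (simp_all add: Q_eq abs_le_iff)
  then show ?thesis unfolding R_eq Hc_eq by (simp add: algebra_simps)
qed

text \<open>With \<open>l = (1+\<mu>)/(2+\<mu>)\<close> and \<open>E = Hc + Q\<close>, both squares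
  in (A9) are of order \<open>E powr (2 * l)\<close>: the first exponent equals
  \<open>2 * l\<close>, and in the second the factor \<open>Q\<close> raises
  \<open>\<mu>/(2+\<mu>)\<close> to \<open>1 + \<mu>/(2+\<mu>) = 2 * l\<close>.\<close>

lemma divb_bound:
  assumes A9a: "\<And>x p. (norm (D2xpH H x p))\<^sup>2 \<le> C * H x p powr ((2 + 2 * \<mu>) / (2 + \<mu>))"
    and A9b: "\<And>M x p. symmetric_mat M \<Longrightarrow>
        (norm (D2ppH H x p ** M))\<^sup>2 \<le> C' * H x p powr (\<mu> / (2 + \<mu>)) * trace (D2ppH H x p ** M ** M)"
    and H1: "\<And>x p. 1 \<le> H x p" and Q: "0 \<le> Q z" and \<mu>: "0 < \<mu>"
  shows "\<bar>divb z\<bar> \<le> real CARD('d) * (sqrt \<bar>C\<bar> + sqrt \<bar>C'\<bar>) * (Hc z + Q z) powr ((1 + \<mu>) / (2 + \<mu>))"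
proof -
  let ?x = "fst z" and ?p = "Du U z"
  define h E l where "h = H ?x ?p" and "E = Hc z + Q z" and "l = (1 + \<mu>) / (2 + \<mu>)"
  have h: "1 \<le> h" "h \<le> E" using H1 Q by (simp_all add: h_def E_def Hc_eq)
  have QE: "Q z \<le> E" using h H1[of ?x ?p] by (simp add: E_def Hc_eq)
  have sq: "n \<le> sqrt \<bar>c\<bar> * E powr l" if "n^2 \<le> c * y" "y \<le> E powr (2 * l)" "0 \<le> y" for n c y :: real
  proof -
    have "n^2 \<le> \<bar>c\<bar> * E powr (2 * l)"
      using that by (meson abs_ge_self mult_mono order_trans abs_ge_zero)
    also have "\<dots> = (sqrt \<bar>c\<bar> * E powr l)^2"
      using h by (simp add: power_mult_distrib powr_power)
    finally show ?thesis by (rule power2_le_imp_le) simp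
  qed
  have "norm (D2xpH H ?x ?p) \<le> sqrt \<bar>C\<bar> * E powr l"
  proof (rule sq[OF A9a])
    have "(2 + 2 * \<mu>) / (2 + \<mu>) = 2 * l" by (simp add: l_def field_simps)
    then show "H ?x ?p powr ((2 + 2 * \<mu>) / (2 + \<mu>)) \<le> E powr (2 * l)"
      using h \<mu> by (simp add: h_def[symmetric] l_def powr_mono2)
  qed simp
  moreover have "norm (D2ppH H ?x ?p ** D2U z) \<le> sqrt \<bar>C'\<bar> * E powr l"
  proof (rule sq)
    show "(norm (D2ppH H ?x ?p ** D2U z))^2 \<le> C' * (H ?x ?p powr (\<mu> / (2 + \<mu>)) * Q z)"
      using A9b[OF D2U_symmetric, of ?x ?p z] by (simp add: Q_eq matrix_mul_assoc mult.assoc)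
    have "H ?x ?p powr (\<mu> / (2 + \<mu>)) * Q z \<le> E powr (\<mu> / (2 + \<mu>)) * E"
      using h QE Q \<mu> by (intro mult_mono powr_mono2) (auto simp: h_def[symmetric])
    also have "\<dots> = E powr (1 + \<mu> / (2 + \<mu>))" using h powr_mult_base[of E "\<mu> / (2 + \<mu>)"] by (simp add: mult.commute)
    also have "1 + \<mu> / (2 + \<mu>) = 2 * l" using \<mu> by (simp add: l_def field_simps)
    finally show "H ?x ?p powr (\<mu> / (2 + \<mu>)) * Q z \<le> E powr (2 * l)" .
    show "0 \<le> H ?x ?p powr (\<mu> / (2 + \<mu>)) * Q z" using Q by simp
  qed
  ultimately have "real CARD('d) * norm (D2xpH H ?x ?p) + real CARD('d) * norm (D2ppH H ?x ?p ** D2U z)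
      \<le> real CARD('d) * (sqrt \<bar>C\<bar> * E powr l) + real CARD('d) * (sqrt \<bar>C'\<bar> * E powr l)"
    by (intro add_mono mult_left_mono) auto
  moreover have "\<bar>divb z\<bar> \<le> real CARD('d) * norm (D2xpH H ?x ?p) + real CARD('d) * norm (D2ppH H ?x ?p ** D2U z)"
    unfolding divb_eq by (intro order_trans[OF abs_triangle_ineq] add_mono abs_trace_le)
  ultimately show ?thesis by (simp add: E_def l_def algebra_simps)
qed

subsection \<open>Evolution of the Lebesgue norms of the density\<close>

lemma cper_M_powr: "t \<in> {0..T} \<Longrightarrow> cper (\<lambda>x. M (x, t) powr \<gamma>)"
  by (rule cper_powr[OF stp_cper[OF stp_M] M_pos])

lemmas cper_slices = stp_cper[OF stp_M] stp_cper[OF stp_dx[OF stp_M]] stp_cper[OF stp_dx[OF stp_dx[OF stp_M]]]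
  stp_cper[OF stp_b] stp_cper[OF stp_dx[OF stp_b]] stp_cper[OF stp_dx[OF stp_mult[OF stp_b stp_M]]]
  stp_cper[OF stp_divb] stp_cper[OF stp_Hc] stp_cper[OF stp_Q] stp_cper[OF stp_dt[OF stp_M]]

lemmas cper_M_intros = cper_const cper_add cper_diff cper_uminus cper_mult cper_abs cper_sum cper_power
  cper_slices cper_M_powr

definition X where "X \<beta> t = tint (\<lambda>x. M (x, t) powr \<beta>)"
text \<open>The Dirichlet integral of \<open>M powr (\<beta> / 2)\<close>, with the derivative
  written out.\<close>

definition Y where "Y \<beta> t = tint (\<lambda>x. \<Sum>j\<in>UNIV. (\<beta> / 2 * M (x, t) powr (\<beta> / 2 - 1) * dx j M (x, t))\<^sup>2)"

lemma X_pos: "t \<in> {0..T} \<Longrightarrow> 0 < X \<beta> t"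
proof -
  assume t: "t \<in> {0..T}"
  have "M (x, t) \<noteq> 0" for x using M_pos[OF t, of x] by simp
  then show ?thesis unfolding X_def by (intro tint_pos cper_M_powr t) simp
qed

lemma Y_nonneg: "t \<in> {0..T} \<Longrightarrow> 0 \<le> Y \<beta> t"
  unfolding Y_def by (intro tint_nonneg cper_M_intros sum_nonneg) auto

lemma dx_M_powr:
  assumes t: "t \<in> {0..T}"
  shows "((\<lambda>s. M (x + s *\<^sub>R axis j 1, t) powr \<gamma>) has_real_derivative \<gamma> * M (x, t) powr (\<gamma> - 1) * dx j M (x, t)) (at 0)"
  using powr_derivative[OF dx_has_derivative[OF stp_M, of x j t]] M_pos[OF t, of x] by simp

lemma Gagliardo_Nirenberg_M:
  assumes t: "t \<in> {0..T}" and card: "2 \<le> CARD('d)"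
  shows "X (\<beta> * (1 + 2 / real CARD('d))) t \<le> 18 * X \<beta> t powr (2 / real CARD('d)) * (X \<beta> t + Y \<beta> t)"
proof -
  define f where "f x = M (x, t) powr (\<beta> / 2)" for x
  define f' where "f' j x = \<beta> / 2 * M (x, t) powr (\<beta> / 2 - 1) * dx j M (x, t)" for j x
  have 1: "cper f" unfolding f_def[abs_def] by (rule cper_M_powr[OF t])
  have 2: "0 < f x" for x using M_pos[OF t, of x] by (simp add: f_def)
  have 3: "cper (f' j)" for j unfolding f'_def[abs_def] by (intro cper_M_intros t)
  have 4: "((\<lambda>s. f (x + s *\<^sub>R axis j 1)) has_real_derivative f' j x) (at 0)" for j x
    unfolding f_def f'_def by (rule dx_M_powr[OF t])
  have 5: "f x ^ 2 = M (x, t) powr \<beta>" for x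
    using M_pos[OF t, of x] by (simp add: f_def powr_power)
  have e0: "\<beta> / 2 * (2 + 4 / real CARD('d)) = \<beta> * (1 + 2 / real CARD('d))" by (simp add: field_simps)
  have 6: "f x powr (2 + 4 / real CARD('d)) = M (x, t) powr (\<beta> * (1 + 2 / real CARD('d)))" for x
    unfolding f_def powr_powr e0 ..
  show ?thesis
    using Gagliardo_Nirenberg_torus[OF 1 2 3 4 card refl] unfolding 5 6 X_def Y_def f'_def .
qed

lemma X_interpolation:
  assumes t: "t \<in> {0..T}" and w: "0 \<le> w" "w \<le> 1" and \<beta>: "\<beta> = w * \<beta>1 + (1 - w) * \<beta>2"
  shows "X \<beta> t \<le> X \<beta>1 t powr w * X \<beta>2 t powr (1 - w)"
proof -
  have nz: "M (x, t) \<noteq> 0" for x using M_pos[OF t, of x] by simp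
  have "M (x, t) powr \<beta> = (M (x, t) powr \<beta>1) powr w * (M (x, t) powr \<beta>2) powr (1 - w)" for x
    unfolding powr_powr powr_add[symmetric] \<beta> by (simp add: mult.commute)
  then have "X \<beta> t = tint (\<lambda>x. (M (x, t) powr \<beta>1) powr w * (M (x, t) powr \<beta>2) powr (1 - w))"
    unfolding X_def by (intro integral_cong) blast
  also have "\<dots> \<le> X \<beta>1 t powr w * X \<beta>2 t powr (1 - w)"
    unfolding X_def by (rule Holder_tint[OF cper_M_powr[OF t] _ cper_M_powr[OF t] _ w]) (simp_all add: nz)
  finally show ?thesis .
qed

lemma tint_powr_by_parts:
  assumes t: "t \<in> {0..T}" and v: "stp v"
  shows "tint (\<lambda>x. M (x, t) powr \<gamma> * dx j v (x, t)) = - \<gamma> * tint (\<lambda>x. M (x, t) powr (\<gamma> - 1) * dx j M (x, t) * v (x, t))"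
proof -
  let ?d = "\<lambda>x. M (x, t) powr \<gamma> * dx j v (x, t) + \<gamma> * (M (x, t) powr (\<gamma> - 1) * dx j M (x, t) * v (x, t))"
  have "tint ?d = 0"
  proof (rule tint_derivative_eq_0)
    show "((\<lambda>s. M (x + s *\<^sub>R axis j 1, t) powr \<gamma> * v (x + s *\<^sub>R axis j 1, t)) has_real_derivative ?d x) (at 0)" for x
      using DERIV_mult[OF dx_M_powr[OF t, of x j \<gamma>] dx_has_derivative[OF v, of x j t]] by (simp add: algebra_simps)
  qed (intro cper_M_intros t stp_cper[OF v] stp_cper[OF stp_dx[OF v]])+
  also have "tint ?d = tint (\<lambda>x. M (x, t) powr \<gamma> * dx j v (x, t)) + \<gamma> * tint (\<lambda>x. M (x, t) powr (\<gamma> - 1) * dx j M (x, t) * v (x, t))"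
    unfolding tint_cmult[symmetric] by (intro tint_add cper_M_intros t stp_cper[OF v] stp_cper[OF stp_dx[OF v]])
  finally show ?thesis by simp
qed

definition X' where "X' \<beta> t = tint (\<lambda>x. \<beta> * M (x, t) powr (\<beta> - 1) * dt M (x, t))"

lemma X_has_derivative:
  assumes "t \<in> {0..T}"
  shows "(X \<beta> has_real_derivative X' \<beta> t) (at t within {0..T})"
  unfolding X_def[abs_def] X'_def
proof (rule tint_has_real_derivative[where F="\<lambda>x t. M (x, t) powr \<beta>" and F'="\<lambda>x t. \<beta> * M (x, t) powr (\<beta> - 1) * dt M (x, t)"])
  show "((\<lambda>s. M (x, s) powr \<beta>) has_real_derivative \<beta> * M (x, t) powr (\<beta> - 1) * dt M (x, t)) (at t within {0..T})"
    if "t \<in> {0..T}" for x t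
    by (intro powr_derivative dt_has_derivative stp_M M_pos that)
  show "continuous_on (UNIV \<times> {0..T}) (\<lambda>(x, t). \<beta> * M (x, t) powr (\<beta> - 1) * dt M (x, t))"
  proof -
    have "M z \<noteq> 0" if "z \<in> UNIV \<times> {0..T}" for z
      using M_pos[of "snd z" "fst z"] that by (cases z) auto
    then show ?thesis
      unfolding case_prod_beta prod.collapse by (intro continuous_intros stp_continuous stp_sol) auto
  qed
qed (use assms in \<open>auto intro: cper_M_powr\<close>)

text \<open>\<open>M powr (\<beta> - 2)\<close> times the squared gradient of \<open>M\<close> is
  \<open>4 / \<beta>^2\<close> times the squared gradient of \<open>M powr (\<beta> / 2)\<close>,
  whence the dissipation constant \<open>4 * (\<beta> - 1) / \<beta>\<close>. The drift stays
  undifferentiated, ready for a bound on \<open>b\<close> itself.\<close>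

lemma X'_eq:
  assumes t: "t \<in> {0..T}" and \<beta>: "1 \<le> \<beta>"
  shows "X' \<beta> t = - (\<beta> * (\<beta> - 1)) * tint (\<lambda>x. M (x, t) powr (\<beta> - 1) * (\<Sum>j\<in>UNIV. b j (x, t) * dx j M (x, t)))
      - 4 * (\<beta> - 1) / \<beta> * Y \<beta> t"
proof -
  let ?P = "\<lambda>\<gamma> x. M (x, t) powr \<gamma>"
  have c: "cper (?P \<gamma>)" for \<gamma> by (rule cper_M_powr[OF t])
  have red: "?P (\<beta> - 1 - 1) x * M (x, t) = ?P (\<beta> - 1) x" for x
    using powr_mult_base[of "M (x, t)" "\<beta> - 1 - 1"] M_pos[OF t, of x] by (simp add: mult.commute less_imp_le)
  have "X' \<beta> t = tint (\<lambda>x. \<beta> * ((\<Sum>j\<in>UNIV. ?P (\<beta> - 1) x * dx j (\<lambda>z. b j z * M z) (x, t)) + (\<Sum>j\<in>UNIV. ?P (\<beta> - 1) x * dx j (dx j M) (x, t))))"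
    unfolding X'_def Fokker_Planck[OF t] Lap_def by (simp add: sum_distrib_left distrib_left mult.assoc)
  also have "\<dots> = \<beta> * ((\<Sum>j\<in>UNIV. tint (\<lambda>x. ?P (\<beta> - 1) x * dx j (\<lambda>z. b j z * M z) (x, t))) + (\<Sum>j\<in>UNIV. tint (\<lambda>x. ?P (\<beta> - 1) x * dx j (dx j M) (x, t))))"
    unfolding tint_cmult
    by (subst tint_add, (intro cper_M_intros c)+, subst tint_sum, (intro cper_M_intros c)+, simp, subst tint_sum, (intro cper_M_intros c)+, simp_all)
  also have "(\<Sum>j\<in>UNIV. tint (\<lambda>x. ?P (\<beta> - 1) x * dx j (\<lambda>z. b j z * M z) (x, t))) =
      - (\<beta> - 1) * tint (\<lambda>x. ?P (\<beta> - 1) x * (\<Sum>j\<in>UNIV. b j (x, t) * dx j M (x, t)))"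
  proof -
    have "tint (\<lambda>x. ?P (\<beta> - 1) x * dx j (\<lambda>z. b j z * M z) (x, t)) = - (\<beta> - 1) * tint (\<lambda>x. ?P (\<beta> - 1) x * (b j (x, t) * dx j M (x, t)))" for j
    proof -
      have e: "?P (\<beta> - 1 - 1) x * dx j M (x, t) * (b j (x, t) * M (x, t)) = ?P (\<beta> - 1) x * (b j (x, t) * dx j M (x, t))" for x
        unfolding red[symmetric] by (simp only: mult_ac)
      show ?thesis using tint_powr_by_parts[OF t stp_mult[OF stp_b stp_M], of "\<beta> - 1" j j] unfolding e .
    qed
    moreover have "tint (\<lambda>x. ?P (\<beta> - 1) x * (\<Sum>j\<in>UNIV. b j (x, t) * dx j M (x, t))) = (\<Sum>j\<in>UNIV. tint (\<lambda>x. ?P (\<beta> - 1) x * (b j (x, t) * dx j M (x, t))))"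
      unfolding sum_distrib_left by (intro tint_sum cper_M_intros c) simp
    ultimately show ?thesis by (simp add: sum_distrib_left)
  qed
  also have "(\<Sum>j\<in>UNIV. tint (\<lambda>x. ?P (\<beta> - 1) x * dx j (dx j M) (x, t))) = - (\<beta> - 1) * ((4 / \<beta>^2) * Y \<beta> t)"
  proof -
    have sq: "?P (\<beta> - 1 - 1) x * dx j M (x, t) * dx j M (x, t) = (4 / \<beta>^2) * (\<beta> / 2 * ?P (\<beta> / 2 - 1) x * dx j M (x, t))^2" for x j
    proof -
      have "(?P (\<beta> / 2 - 1) x)^2 = ?P (\<beta> - 1 - 1) x"
        using M_pos[OF t, of x] by (simp add: powr_power algebra_simps)
      then show ?thesis using \<beta> by (simp add: power_mult_distrib field_simps power2_eq_square)
    qed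
    have "tint (\<lambda>x. ?P (\<beta> - 1) x * dx j (dx j M) (x, t)) = - (\<beta> - 1) * ((4 / \<beta>^2) * tint (\<lambda>x. (\<beta> / 2 * ?P (\<beta> / 2 - 1) x * dx j M (x, t))^2))" for j
      using tint_powr_by_parts[OF t stp_dx[OF stp_M], of "\<beta> - 1" j j] unfolding sq tint_cmult .
    moreover have "Y \<beta> t = (\<Sum>j\<in>UNIV. tint (\<lambda>x. (\<beta> / 2 * ?P (\<beta> / 2 - 1) x * dx j M (x, t))^2))"
      unfolding Y_def by (intro tint_sum cper_M_intros c) simp
    ultimately show ?thesis by (simp add: sum_distrib_left)
  qed
  also have "\<beta> * (- (\<beta> - 1) * a + - (\<beta> - 1) * ((4 / \<beta>^2) * y)) = - (\<beta> * (\<beta> - 1)) * a - 4 * (\<beta> - 1) / \<beta> * y" for a y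
    using \<beta> by (simp add: field_simps power2_eq_square)
  finally show ?thesis .
qed

text \<open>The derivative now sits on the drift: this is the form to which the bound of
  \<open>div b\<close> by \<open>Hc + Q\<close> applies.\<close>

lemma X'_eq_divb:
  assumes t: "t \<in> {0..T}" and \<beta>: "1 \<le> \<beta>"
  shows "X' \<beta> t = (\<beta> - 1) * tint (\<lambda>x. divb (x, t) * M (x, t) powr \<beta>) - 4 * (\<beta> - 1) / \<beta> * Y \<beta> t"
proof -
  have c: "cper (\<lambda>x. M (x, t) powr \<gamma>)" for \<gamma> by (rule cper_M_powr[OF t])
  have "tint (\<lambda>x. divb (x, t) * M (x, t) powr \<beta>) = (\<Sum>j\<in>UNIV. tint (\<lambda>x. M (x, t) powr \<beta> * dx j (b j) (x, t)))"
    unfolding divb_def sum_distrib_right by (subst tint_sum) (auto intro!: cper_M_intros c simp: mult.commute)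
  also have "\<dots> = (\<Sum>j\<in>UNIV. - \<beta> * tint (\<lambda>x. M (x, t) powr (\<beta> - 1) * (b j (x, t) * dx j M (x, t))))"
    by (intro sum.cong refl, subst tint_powr_by_parts[OF t stp_b]) (simp add: mult_ac)
  also have "\<dots> = - \<beta> * tint (\<lambda>x. M (x, t) powr (\<beta> - 1) * (\<Sum>j\<in>UNIV. b j (x, t) * dx j M (x, t)))"
    unfolding sum_distrib_left[of "M _ powr _"] by (subst tint_sum) (auto intro!: cper_M_intros c simp: sum_distrib_left)
  finally show ?thesis unfolding X'_eq[OF t \<beta>] by simp
qed

end

text \<open>At a fixed time \<open>A\<close> stands for the integral of \<open>(Hc + Q) M\<close>,
  \<open>X\<close>, \<open>Z\<close> and \<open>V\<close> for those of \<open>M\<close> to the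
  powers \<beta>, \<beta>(1+2/N) and \<open>1 + (2+\<mu>)(\<beta>-1)\<close>, \<open>Y\<close> for
  the dissipation and \<open>W\<close> for the drift term. Eliminating \<open>Z\<close> and
  \<open>V\<close> bounds \<open>W\<close> by a multiple of
  \<open>A powr ((1+\<mu>)/(2+\<mu>)) * P powr (1 - s) * B powr s\<close> with
  \<open>P = X + 1\<close> and \<open>B = X + 1 + Y\<close>. Since \<sigma> \<le> 1, the exponent of
  \<open>A\<close> is at most \<open>1 - s\<close>, so Young's inequality leaves \<open>A\<close> to
  the first power.\<close>

lemma base_absorb:
  fixes N \<mu> \<beta> C1 :: real
  assumes N: "2 \<le> N" and \<mu>: "0 < \<mu>" and \<beta>: "1 \<le> \<beta>" "\<beta> < N * (1 + \<mu>) / (N * (1 + \<mu>) - 2)" and C1: "0 \<le> C1"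
  defines "\<sigma> \<equiv> N * (1 + \<mu>) * (\<beta> - 1) / (2 * \<beta>)"
  obtains K where "0 < K" and "\<And>A X Y Z V W. 0 < A \<Longrightarrow> 0 < X \<Longrightarrow> 0 \<le> Y \<Longrightarrow> 0 < Z \<Longrightarrow> 0 < V \<Longrightarrow>
      Z \<le> 18 * X powr (2 / N) * (X + Y) \<Longrightarrow> V \<le> X powr (1 - \<sigma>) * Z powr \<sigma> \<Longrightarrow>
      W \<le> A powr ((1 + \<mu>) / (2 + \<mu>)) * V powr (1 / (2 + \<mu>)) \<Longrightarrow>
      (\<beta> - 1) * C1 * W \<le> 4 * (\<beta> - 1) / \<beta> * Y + K * (A + 1) * (X + 1)"
proof -
  have "2 * (1 + \<mu>) \<le> N * (1 + \<mu>)" using N \<mu> by (intro mult_right_mono) auto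
  then have pos: "N * (1 + \<mu>) - 2 > 0" using \<mu> by simp
  have "\<beta> * (N * (1 + \<mu>) - 2) < N * (1 + \<mu>)" using \<beta>(2) pos by (simp add: less_divide_eq)
  then have "N * (1 + \<mu>) * (\<beta> - 1) < 2 * \<beta>" by (simp add: algebra_simps)
  then have \<sigma>: "0 \<le> \<sigma>" "\<sigma> < 1" using \<beta>(1) N \<mu> by (auto simp: \<sigma>_def divide_less_eq)
  define s where "s = \<sigma> / (2 + \<mu>)"
  have "s \<le> \<sigma>" unfolding s_def using \<sigma> \<mu> by (simp add: divide_le_eq mult_le_cancel_left1)
  then have s: "0 \<le> s" "s < 1" using \<sigma> \<mu> by (auto simp: s_def)
  define D where "D = C1 * 18 powr s"
  have D: "0 \<le> D" using C1 by (simp add: D_def)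
  \<comment> \<open>Keeps \<open>D * \<delta>\<close> below \<open>4 / \<beta>\<close>, so that the
    absorbed part does not exceed the dissipation.\<close>
  define \<delta> where "\<delta> = (4 / \<beta>) / (D + 1)"
  have \<delta>: "0 < \<delta>" "D * \<delta> \<le> 4 / \<beta>"
  proof -
    show "0 < \<delta>" using D \<beta>(1) unfolding \<delta>_def by (intro divide_pos_pos) auto
    have "D * \<delta> = (4 / \<beta>) * (D / (D + 1))" by (simp add: \<delta>_def)
    also have "\<dots> \<le> (4 / \<beta>) * 1" using D \<beta>(1) by (intro mult_left_mono) (auto simp: divide_le_eq)
    finally show "D * \<delta> \<le> 4 / \<beta>" by simp
  qed
  obtain C where C: "C > 0" "\<And>a b. 0 < a \<Longrightarrow> 0 < b \<Longrightarrow> a powr (1 - s) * b powr s \<le> \<delta> * b + C * a"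
    by (rule powr_interpolation_absorb[OF \<delta>(1) s]) blast
  define K where "K = (\<beta> - 1) * (4 / \<beta> + D * C) + 1"
  show ?thesis
  proof (rule that[of K])
    have "0 \<le> (\<beta> - 1) * (4 / \<beta> + D * C)" using \<beta>(1) D C(1) by (intro mult_nonneg_nonneg add_nonneg_nonneg) auto
    then show "0 < K" by (simp add: K_def)
    fix A X Y Z V W :: real
    assume A: "0 < A" and X: "0 < X" and Y: "0 \<le> Y" and Z: "0 < Z" and V: "0 < V"
      and ZX: "Z \<le> 18 * X powr (2 / N) * (X + Y)" and VZ: "V \<le> X powr (1 - \<sigma>) * Z powr \<sigma>"
      and W: "W \<le> A powr ((1 + \<mu>) / (2 + \<mu>)) * V powr (1 / (2 + \<mu>))"
    \<comment> \<open>Adding 1 makes \<open>P\<close> and \<open>a\<close> at least 1, so that their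
      exponents may be increased.\<close>
    define P a B where "P = X + 1" and "a = A + 1" and "B = X + 1 + Y"
    have P: "1 \<le> P" "X \<le> P" and a: "1 \<le> a" "A \<le> a" and B: "0 < B" "X + Y \<le> B" using X A Y by (auto simp: P_def a_def B_def)
    have "Z powr \<sigma> \<le> (18 * P powr (2 / N) * B) powr \<sigma>"
    proof (rule powr_mono2)
      have "X powr (2 / N) \<le> P powr (2 / N)" using X P N by (intro powr_mono2) auto
      then have "18 * X powr (2 / N) * (X + Y) \<le> 18 * P powr (2 / N) * B"
        using X Y B by (intro mult_mono) auto
      then show "Z \<le> 18 * P powr (2 / N) * B" using ZX by linarith
    qed (use \<sigma> Z in auto)
    also have "\<dots> = 18 powr \<sigma> * P powr (2 / N * \<sigma>) * B powr \<sigma>" using P B by (simp add: powr_mult powr_powr)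
    finally have Z\<sigma>: "Z powr \<sigma> \<le> 18 powr \<sigma> * P powr (2 / N * \<sigma>) * B powr \<sigma>" .
    have "V \<le> P powr (1 - \<sigma>) * (18 powr \<sigma> * P powr (2 / N * \<sigma>) * B powr \<sigma>)"
      using VZ Z\<sigma> X P \<sigma> by (elim order_trans) (intro mult_mono powr_mono2, auto)
    also have "\<dots> = 18 powr \<sigma> * P powr (1 - \<sigma> + 2 / N * \<sigma>) * B powr \<sigma>" using P by (simp add: powr_add)
    finally have "V powr (1 / (2 + \<mu>)) \<le> (18 powr \<sigma> * P powr (1 - \<sigma> + 2 / N * \<sigma>) * B powr \<sigma>) powr (1 / (2 + \<mu>))"
      using V \<mu> by (intro powr_mono2) auto
    also have "\<dots> = 18 powr s * P powr ((1 - \<sigma> + 2 / N * \<sigma>) / (2 + \<mu>)) * B powr s"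
      using P B by (simp add: powr_mult powr_powr s_def)
    also have "\<dots> \<le> 18 powr s * P powr (1 - s) * B powr s"
    proof (intro mult_left_mono mult_right_mono powr_mono)
      have "2 / N * \<sigma> \<le> 1 * 1" using N \<sigma> by (intro mult_mono) auto
      moreover have "s * (2 + \<mu>) = \<sigma>" using \<mu> by (simp add: s_def)
      then have "(1 - s) * (2 + \<mu>) = 2 + \<mu> - \<sigma>" by (simp add: left_diff_distrib)
      ultimately have "1 - \<sigma> + 2 / N * \<sigma> \<le> (1 - s) * (2 + \<mu>)" using \<mu> by linarith
      then show "(1 - \<sigma> + 2 / N * \<sigma>) / (2 + \<mu>) \<le> 1 - s" using \<mu> by (simp add: divide_le_eq)
    qed (use P in auto)
    finally have Vs: "V powr (1 / (2 + \<mu>)) \<le> 18 powr s * P powr (1 - s) * B powr s" .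
    have As: "A powr ((1 + \<mu>) / (2 + \<mu>)) \<le> a powr (1 - s)"
    proof -
      have "A powr ((1 + \<mu>) / (2 + \<mu>)) \<le> a powr ((1 + \<mu>) / (2 + \<mu>))" using A a \<mu> by (intro powr_mono2) auto
      also have "\<dots> \<le> a powr (1 - s)"
      proof (rule powr_mono)
        have "s * (2 + \<mu>) = \<sigma>" using \<mu> by (simp add: s_def)
        then have "(1 - s) * (2 + \<mu>) = 2 + \<mu> - \<sigma>" by (simp add: left_diff_distrib)
        then show "(1 + \<mu>) / (2 + \<mu>) \<le> 1 - s" using \<mu> \<sigma> by (simp add: divide_le_eq)
      qed (rule a)
      finally show ?thesis .
    qed
    have "W \<le> a powr (1 - s) * (18 powr s * P powr (1 - s) * B powr s)"
      using As Vs by (intro order_trans[OF W] mult_mono) auto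
    also have "\<dots> = 18 powr s * ((a * P) powr (1 - s) * B powr s)" using a P by (simp add: powr_mult)
    also have "\<dots> \<le> 18 powr s * (\<delta> * B + C * (a * P))"
      using a P B by (intro mult_left_mono C(2)) auto
    finally have "(\<beta> - 1) * C1 * W \<le> (\<beta> - 1) * C1 * (18 powr s * (\<delta> * B + C * (a * P)))"
      using \<beta>(1) C1 by (intro mult_left_mono) auto
    also have "\<dots> = (\<beta> - 1) * (D * \<delta> * B + D * C * (a * P))" by (simp add: D_def algebra_simps)
    also have "\<dots> \<le> (\<beta> - 1) * (4 / \<beta> * B + D * C * (a * P))"
      using \<beta>(1) \<delta>(2) B by (intro mult_left_mono add_right_mono mult_right_mono) auto
    also have "\<dots> = 4 * (\<beta> - 1) / \<beta> * Y + (\<beta> - 1) * (4 / \<beta> * P + D * C * (a * P))"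
    proof -
      have "4 / \<beta> * B = 4 / \<beta> * Y + 4 / \<beta> * P" by (simp add: B_def P_def add_divide_distrib)
      then have "(\<beta> - 1) * (4 / \<beta> * B + D * C * (a * P)) = (\<beta> - 1) * (4 / \<beta> * Y) + (\<beta> - 1) * (4 / \<beta> * P + D * C * (a * P))"
        by (simp only: distrib_left add.assoc)
      then show ?thesis by simp
    qed
    also have "(\<beta> - 1) * (4 / \<beta> * P + D * C * (a * P)) \<le> (\<beta> - 1) * (4 / \<beta> * (a * P) + D * C * (a * P))"
      using \<beta>(1) a P by (intro mult_left_mono add_right_mono) (auto simp: mult_le_cancel_right1)
    also have "\<dots> = (\<beta> - 1) * (4 / \<beta> + D * C) * (a * P)" by (simp only: distrib_right mult.assoc)
    also have "\<dots> \<le> K * (a * P)" using a P unfolding K_def by (intro mult_right_mono) auto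
    finally show "(\<beta> - 1) * C1 * W \<le> 4 * (\<beta> - 1) / \<beta> * Y + K * (A + 1) * (X + 1)"
      by (simp add: a_def P_def mult.assoc)
  qed
qed

text \<open>\<open>k\<close> is the weight of \<theta>\<beta>0(1+2/N) when \<theta>\<beta>0 is
  interpolated against \<beta>0. Inserting the bound for \<open>Z\<close> leaves
  \<open>X powr (2 * k / N)\<close> on the right; moved to the left it gives
  \<open>X \<le> D * (X + Y) powr (k / e)\<close> with \<open>e = 1 - 2 * k / N\<close>. Since
  \<open>k / e = 1 - 1 / r\<close>, Young's inequality turns \<open>R * X\<close> into
  \<open>R powr r\<close>: this is the origin of \<open>r\<close>.\<close>

lemma iteration_absorb:
  fixes N \<theta> c0 \<delta> P0 :: real
  assumes N: "2 \<le> N" and \<theta>: "1 < \<theta>" and c0: "0 \<le> c0" and \<delta>: "0 < \<delta>" and P0: "0 < P0"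
  defines "k \<equiv> (\<theta> - 1) / (\<theta> - 1 + 2 * \<theta> / N)" and "r \<equiv> (N * (\<theta> - 1) + 2) / 2"
  obtains K where "0 < K" and "\<And>X Y Z P R. 0 < X \<Longrightarrow> 0 \<le> Y \<Longrightarrow> 0 < Z \<Longrightarrow> 0 < P \<Longrightarrow> P \<le> P0 \<Longrightarrow> 1 \<le> R \<Longrightarrow>
      Z \<le> 18 * X powr (2 / N) * (X + Y) \<Longrightarrow> X \<le> P powr (1 - k) * Z powr k \<Longrightarrow>
      c0 * R * X \<le> \<delta> * (X + Y) + K * R powr r"
proof -
  have d: "0 < N * (\<theta> - 1) + 2 * \<theta>" "0 < N * (\<theta> - 1) + 2"
    using N \<theta> by (auto intro!: add_pos_pos)
  have keq: "k = N * (\<theta> - 1) / (N * (\<theta> - 1) + 2 * \<theta>)"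
  proof -
    have "\<theta> - 1 + 2 * \<theta> / N = (N * (\<theta> - 1) + 2 * \<theta>) / N" using N by (simp add: field_simps)
    then show ?thesis by (simp add: k_def)
  qed
  have k: "0 < k" "k < 1" using d N \<theta> unfolding keq by (auto simp: divide_less_eq)
  have e_eq: "1 - 2 * k / N = (N * (\<theta> - 1) + 2) / (N * (\<theta> - 1) + 2 * \<theta>)"
  proof -
    have "2 * k / N = 2 * (\<theta> - 1) / (N * (\<theta> - 1) + 2 * \<theta>)" unfolding keq using N by simp
    moreover have "1 = (N * (\<theta> - 1) + 2 * \<theta>) / (N * (\<theta> - 1) + 2 * \<theta>)" using d by simp
    ultimately have "1 - 2 * k / N = ((N * (\<theta> - 1) + 2 * \<theta>) - 2 * (\<theta> - 1)) / (N * (\<theta> - 1) + 2 * \<theta>)"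
      by (simp only: diff_divide_distrib)
    then show ?thesis by (simp add: algebra_simps)
  qed
  define e where "e = 1 - 2 * k / N"
  have e: "0 < e" unfolding e_def e_eq using d by simp
  have ke: "k / e = 1 - 1 / r"
  proof -
    have "k / e = N * (\<theta> - 1) / (N * (\<theta> - 1) + 2)" unfolding e_def e_eq unfolding keq using d by simp
    also have "\<dots> = 1 - 1 / r" using d by (simp add: r_def field_simps)
    finally show ?thesis .
  qed
  have r: "1 < r" using N \<theta> by (simp add: r_def)
  define D where "D = (P0 powr (1 - k) * 18 powr k) powr (1 / e)"
  have D: "0 < D" using P0 by (simp add: D_def)
  have "0 < \<delta> / (c0 * D + 1)" using \<delta> c0 D by (intro divide_pos_pos add_nonneg_pos) auto
  moreover have "0 \<le> 1 - 1 / r" "1 - 1 / r < 1" using r by auto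
  ultimately obtain C where C: "C > 0"
      "\<And>a b. 0 < a \<Longrightarrow> 0 < b \<Longrightarrow> a powr (1 - (1 - 1 / r)) * b powr (1 - 1 / r) \<le> \<delta> / (c0 * D + 1) * b + C * a"
    by (rule powr_interpolation_absorb) blast
  show ?thesis
  proof (rule that[of "c0 * D * C + 1"])
    show "0 < c0 * D * C + 1" using c0 D C(1) by (intro add_nonneg_pos) auto
    fix X Y Z P R :: real
    assume X: "0 < X" and Y: "0 \<le> Y" and Z: "0 < Z" and P: "0 < P" "P \<le> P0" and R: "1 \<le> R"
      and ZX: "Z \<le> 18 * X powr (2 / N) * (X + Y)" and XZ: "X \<le> P powr (1 - k) * Z powr k"
    let ?B = "X + Y"
    have B: "0 < ?B" using X Y by simp
    have "X \<le> P0 powr (1 - k) * (18 * X powr (2 / N) * ?B) powr k"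
      using P k Z ZX by (intro order_trans[OF XZ] mult_mono powr_mono2) auto
    also have "\<dots> = (P0 powr (1 - k) * 18 powr k * ?B powr k) * X powr (2 * k / N)"
      using X B by (simp add: powr_mult powr_powr)
    finally have "X powr e * X powr (2 * k / N) \<le> (P0 powr (1 - k) * 18 powr k * ?B powr k) * X powr (2 * k / N)"
      using X by (simp add: powr_add[symmetric] e_def)
    then have "X powr e \<le> P0 powr (1 - k) * 18 powr k * ?B powr k"
      by (rule mult_right_le_imp_le) (use X in simp)
    then have "(X powr e) powr (1 / e) \<le> (P0 powr (1 - k) * 18 powr k * ?B powr k) powr (1 / e)"
      using e by (intro powr_mono2) auto
    then have XB: "X \<le> D * ?B powr (1 - 1 / r)"
      using X B e P0 by (simp add: powr_powr D_def powr_mult ke[symmetric])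
    have Rr: "(R powr r) powr (1 - (1 - 1 / r)) = R" using R r by (simp add: powr_powr)
    have "R * X \<le> R * (D * ?B powr (1 - 1 / r))" using XB R by (intro mult_left_mono) auto
    also have "\<dots> = D * ((R powr r) powr (1 - (1 - 1 / r)) * ?B powr (1 - 1 / r))" unfolding Rr by simp
    also have "\<dots> \<le> D * (\<delta> / (c0 * D + 1) * ?B + C * R powr r)"
      using D B R by (intro mult_left_mono C(2)) auto
    finally have "c0 * (R * X) \<le> c0 * (D * (\<delta> / (c0 * D + 1) * ?B + C * R powr r))" using c0 by (intro mult_left_mono)
    also have "\<dots> = (c0 * D / (c0 * D + 1)) * (\<delta> * ?B) + c0 * D * C * R powr r" by (simp add: algebra_simps)
    also have "\<dots> \<le> 1 * (\<delta> * ?B) + (c0 * D * C + 1) * R powr r"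
      using c0 D \<delta> B by (intro add_mono mult_right_mono) (auto simp: divide_le_eq add_nonneg_pos)
    finally show "c0 * R * X \<le> \<delta> * ?B + (c0 * D * C + 1) * R powr r" by (simp add: mult.assoc)
  qed
qed

context mfg_solution
begin

text \<open>Gronwall is run for \<open>X \<beta> + 1\<close>, whose rate
  \<open>K * (A t + 1)\<close> has time integral at most \<open>K * (E + T)\<close>. The absorption
  inequality is a hypothesis, so that its constant is chosen before the solution.\<close>

lemma base_norm_bound:
  fixes \<mu> \<beta> C1 K E :: real
  defines "N \<equiv> real CARD('d)"
  defines "\<sigma> \<equiv> N * (1 + \<mu>) * (\<beta> - 1) / (2 * \<beta>)"
  assumes card: "2 \<le> CARD('d)" and \<mu>: "0 < \<mu>" and \<beta>: "1 \<le> \<beta>" and \<sigma>: "0 \<le> \<sigma>" "\<sigma> \<le> 1"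
    and divb: "\<And>z. \<bar>divb z\<bar> \<le> C1 * (Hc z + Q z) powr ((1 + \<mu>) / (2 + \<mu>))" and C1: "0 \<le> C1"
    and Q: "\<And>z. 0 \<le> Q z" and Hc: "\<And>z. 1 \<le> Hc z" and E: "J Hc + J Q \<le> E" and K: "0 < K"
    and absorb: "\<And>A X Y Z V W. 0 < A \<Longrightarrow> 0 < X \<Longrightarrow> 0 \<le> Y \<Longrightarrow> 0 < Z \<Longrightarrow> 0 < V \<Longrightarrow>
      Z \<le> 18 * X powr (2 / N) * (X + Y) \<Longrightarrow> V \<le> X powr (1 - \<sigma>) * Z powr \<sigma> \<Longrightarrow>
      W \<le> A powr ((1 + \<mu>) / (2 + \<mu>)) * V powr (1 / (2 + \<mu>)) \<Longrightarrow>
      (\<beta> - 1) * C1 * W \<le> 4 * (\<beta> - 1) / \<beta> * Y + K * (A + 1) * (X + 1)"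
    and t: "t \<in> {0..T}"
  shows "X \<beta> t \<le> (X \<beta> 0 + 1) * exp (K * (E + T))"
proof -
  define l where "l = (1 + \<mu>) / (2 + \<mu>)"
  \<comment> \<open>The solution of \<open>l + q * (1 - l) = \<beta>\<close>: in Hoelder's
    inequality \<open>M powr l\<close> accompanies the energy, and \<open>q\<close> is the exponent
    of the other factor.\<close>
  define q where "q = 1 + (2 + \<mu>) * (\<beta> - 1)"
  define A where "A t = tint (\<lambda>x. (Hc (x, t) + Q (x, t)) * M (x, t))" for t
  have N: "2 \<le> N" using card by (simp add: N_def)
  have l: "0 \<le> l" "l \<le> 1" "1 - l = 1 / (2 + \<mu>)" using \<mu> by (auto simp: l_def field_simps)
  have HQ: "0 < Hc z + Q z" for z using Hc[of z] Q[of z] by linarith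
  have A_pos: "0 < A t" if "t \<in> {0..T}" for t
    unfolding A_def by (intro tint_pos cper_M_intros mult_pos_pos HQ M_pos that)
  have le: "X' \<beta> t \<le> K * (A t + 1) * (X \<beta> t + 1)" if t: "t \<in> {0..T}" for t
  proof -
    have nz: "M (x, t) \<noteq> 0" "Hc (x, t) + Q (x, t) \<noteq> 0" for x using M_pos[OF t, of x] HQ[of "(x, t)"] by auto
    define W where "W = tint (\<lambda>x. (Hc (x, t) + Q (x, t)) powr l * M (x, t) powr \<beta>)"
    have cHQ: "cper (\<lambda>x. (Hc (x, t) + Q (x, t)) powr l)" by (intro cper_powr cper_M_intros HQ)
    have "W \<le> A t powr l * X q t powr (1 - l)"
    proof -
      have "l + q * (1 - l) = ((1 + \<mu>) + q) / (2 + \<mu>)" unfolding l(3) unfolding l_def by (simp add: add_divide_distrib)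
      also have "(1 + \<mu>) + q = (2 + \<mu>) * \<beta>" by (simp add: q_def algebra_simps)
      finally have e: "l + q * (1 - l) = \<beta>" using \<mu> by simp
      have "(Hc (x, t) + Q (x, t)) powr l * M (x, t) powr \<beta> =
          ((Hc (x, t) + Q (x, t)) * M (x, t)) powr l * (M (x, t) powr q) powr (1 - l)" for x
        using M_pos[OF t, of x] HQ[of "(x, t)"] by (simp add: powr_mult powr_powr e[symmetric] powr_add)
      then have "W = tint (\<lambda>x. ((Hc (x, t) + Q (x, t)) * M (x, t)) powr l * (M (x, t) powr q) powr (1 - l))"
        unfolding W_def by (intro integral_cong) blast
      also have "\<dots> \<le> A t powr l * X q t powr (1 - l)"
        unfolding A_def X_def
        by (rule Holder_tint) (auto intro!: cper_M_intros mult_pos_pos HQ M_pos t simp: nz l)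
      finally show ?thesis .
    qed
    moreover have "X q t \<le> X \<beta> t powr (1 - \<sigma>) * X (\<beta> * (1 + 2 / N)) t powr \<sigma>"
    proof -
      \<comment> \<open>This identity is what \<sigma> was chosen for: it says
        \<open>q = \<beta> + \<sigma> * \<beta> * 2 / N\<close>.\<close>
      have "\<sigma> * (\<beta> * (2 / N)) = (1 + \<mu>) * (\<beta> - 1)" using N \<beta> by (simp add: \<sigma>_def)
      then have "q = (1 - \<sigma>) * \<beta> + (1 - (1 - \<sigma>)) * (\<beta> * (1 + 2 / N))" by (simp add: q_def algebra_simps)
      from X_interpolation[OF t _ _ this] \<sigma> show ?thesis by simp
    qed
    moreover have "X (\<beta> * (1 + 2 / N)) t \<le> 18 * X \<beta> t powr (2 / N) * (X \<beta> t + Y \<beta> t)"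
      unfolding N_def by (rule Gagliardo_Nirenberg_M[OF t card])
    ultimately have "(\<beta> - 1) * C1 * W \<le> 4 * (\<beta> - 1) / \<beta> * Y \<beta> t + K * (A t + 1) * (X \<beta> t + 1)"
      by (intro absorb[where Z="X (\<beta> * (1 + 2 / N)) t" and V="X q t"] A_pos X_pos Y_nonneg t) (auto simp: l_def[symmetric] l(3)[symmetric])
    moreover have "tint (\<lambda>x. divb (x, t) * M (x, t) powr \<beta>) \<le> C1 * W"
      unfolding W_def tint_cmult[symmetric]
    proof (rule tint_mono)
      show "divb (x, t) * M (x, t) powr \<beta> \<le> C1 * ((Hc (x, t) + Q (x, t)) powr l * M (x, t) powr \<beta>)" for x
        using divb[of "(x, t)"] unfolding l_def[symmetric] mult.assoc[symmetric]
        by (intro mult_right_mono) auto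
    qed (intro cper_M_intros cHQ t)+
    then have "(\<beta> - 1) * tint (\<lambda>x. divb (x, t) * M (x, t) powr \<beta>) \<le> (\<beta> - 1) * (C1 * W)"
      using \<beta> by (intro mult_left_mono) auto
    ultimately show ?thesis unfolding X'_eq_divb[OF t \<beta>] by (simp add: mult.assoc)
  qed
  have cA: "continuous_on {0..T} A"
    unfolding A_def[abs_def] by (intro tint_stp_continuous[of "\<lambda>z. (Hc z + Q z) * M z", simplified] stp_sol)
  then have ca: "continuous_on {0..T} (\<lambda>t. K * (A t + 1))" by (intro continuous_intros)
  have "X \<beta> t + 1 \<le> (X \<beta> 0 + 1) * exp (integral {0..t} (\<lambda>t. K * (A t + 1)))"
    by (rule Gronwall[where X'="X' \<beta>", OF _ le ca t]) (auto intro!: derivative_eq_intros X_has_derivative)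
  also have "\<dots> \<le> (X \<beta> 0 + 1) * exp (K * (E + T))"
  proof (intro mult_left_mono, subst exp_le_cancel_iff)
    have nn: "0 \<le> K * (A t + 1)" if "t \<in> {0..T}" for t using A_pos[OF that] K by simp
    have "integral {0..t} (\<lambda>t. K * (A t + 1)) \<le> integral {0..T} (\<lambda>t. K * (A t + 1))"
      using t by (intro integral_subset_le integrable_continuous_interval continuous_on_subset[OF ca]) (auto intro: nn)
    also have "\<dots> = K * (J (\<lambda>z. Hc z + Q z) + T)"
      using T_pos cA by (simp add: A_def[symmetric] integral_add integrable_continuous_interval)
    also have "\<dots> \<le> K * (E + T)"
      using E K J_add[OF stp_Hc stp_Q] by (intro mult_left_mono) auto
    finally show "integral {0..t} (\<lambda>t. K * (A t + 1)) \<le> K * (E + T)" .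
    show "0 \<le> X \<beta> 0 + 1" using X_pos[of 0 \<beta>] T_pos by simp
  qed
  finally show ?thesis by simp
qed

text \<open>Young's inequality on the drift term spends \<open>(\<beta> - 1) / \<beta>\<close> of
  the dissipation \<open>4 * (\<beta> - 1) / \<beta>\<close>, which leaves \<open>c\<close>. The
  extra \<open>2 * c\<close> in \<open>absorb\<close> pays once for the \<open>c * X\<close> on its
  right-hand side and once for the damping that \<open>Gronwall_damped\<close> asks for.\<close>

lemma iteration_norm_bound:
  fixes \<theta> \<beta>0 C2 K P0 Rr :: real
  defines "N \<equiv> real CARD('d)" and "\<beta> \<equiv> \<theta> * \<beta>0"
  defines "k \<equiv> (\<theta> - 1) / (\<theta> - 1 + 2 * \<theta> / N)" and "r \<equiv> (N * (\<theta> - 1) + 2) / 2" and "c \<equiv> 3 * (\<beta> - 1) / \<beta>"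
  assumes card: "2 \<le> CARD('d)" and \<theta>: "1 < \<theta>" and \<beta>0: "1 \<le> \<beta>0"
    and b2: "\<And>x t. t \<in> {0..T} \<Longrightarrow> (\<Sum>j\<in>UNIV. (b j (x, t))\<^sup>2) \<le> C2 * Rr" and C2: "0 \<le> C2" and Rr: "1 \<le> Rr"
    and P0: "\<And>t. t \<in> {0..T} \<Longrightarrow> X \<beta>0 t \<le> P0" and K: "0 < K"
    and absorb: "\<And>X Y Z P R. 0 < X \<Longrightarrow> 0 \<le> Y \<Longrightarrow> 0 < Z \<Longrightarrow> 0 < P \<Longrightarrow> P \<le> P0 \<Longrightarrow> 1 \<le> R \<Longrightarrow>
      Z \<le> 18 * X powr (2 / N) * (X + Y) \<Longrightarrow> X \<le> P powr (1 - k) * Z powr k \<Longrightarrow>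
      (\<beta> * (\<beta> - 1) * C2 + 2 * c) * R * X \<le> c * (X + Y) + K * R powr r"
    and t: "t \<in> {0..T}"
  shows "X \<beta> t \<le> X \<beta> 0 + K * Rr powr r / c"
proof -
  have N: "2 \<le> N" using card by (simp add: N_def)
  have "1 * 1 < \<theta> * \<beta>0" using \<theta> \<beta>0 by (intro mult_less_le_imp_less) auto
  then have \<beta>: "1 < \<beta>" by (simp add: \<beta>_def)
  have c: "0 < c" using \<beta> by (simp add: c_def)
  have le: "X' \<beta> t + c * X \<beta> t \<le> K * Rr powr r" if t: "t \<in> {0..T}" for t
  proof -
    have "X \<beta> t \<le> X \<beta>0 t powr (1 - k) * X (\<beta> * (1 + 2 / N)) t powr k"
    proof -
      have den: "0 < \<theta> - 1 + 2 * \<theta> / N" using \<theta> N by (intro add_pos_pos) auto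
      have k: "0 \<le> k" "k \<le> 1" using den \<theta> N by (auto simp: k_def divide_le_eq)
      have "k * (\<theta> - 1 + 2 * \<theta> / N) = \<theta> - 1" using den by (simp add: k_def)
      then have "\<beta>0 * (k * (\<theta> - 1 + 2 * \<theta> / N)) = \<beta>0 * (\<theta> - 1)" by simp
      then have "\<beta> = (1 - k) * \<beta>0 + (1 - (1 - k)) * (\<beta> * (1 + 2 / N))" by (simp add: \<beta>_def algebra_simps)
      from X_interpolation[OF t _ _ this] k show ?thesis by simp
    qed
    moreover have "X (\<beta> * (1 + 2 / N)) t \<le> 18 * X \<beta> t powr (2 / N) * (X \<beta> t + Y \<beta> t)"
      unfolding N_def by (rule Gagliardo_Nirenberg_M[OF t card])
    ultimately have abs: "(\<beta> * (\<beta> - 1) * C2 + 2 * c) * Rr * X \<beta> t \<le> c * (X \<beta> t + Y \<beta> t) + K * Rr powr r"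
      by (intro absorb[where Z="X (\<beta> * (1 + 2 / N)) t" and P="X \<beta>0 t"] X_pos Y_nonneg t P0 Rr)
    let ?D = "\<lambda>j x. \<beta> / 2 * M (x, t) powr (\<beta> / 2 - 1) * dx j M (x, t)"
    have "- (\<beta> * (\<beta> - 1)) * tint (\<lambda>x. M (x, t) powr (\<beta> - 1) * (\<Sum>j\<in>UNIV. b j (x, t) * dx j M (x, t)))
        \<le> tint (\<lambda>x. (\<beta> * (\<beta> - 1) * (C2 * Rr)) * M (x, t) powr \<beta> + (\<beta> - 1) / \<beta> * (\<Sum>j\<in>UNIV. (?D j x)\<^sup>2))"
      unfolding tint_cmult[symmetric]
    proof (rule tint_mono)
      fix x
      let ?f = "M (x, t) powr (\<beta> / 2)"
      have pM: "M (x, t) powr (\<beta> - 1) = ?f * M (x, t) powr (\<beta> / 2 - 1)" "?f^2 = M (x, t) powr \<beta>"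
        using M_pos[OF t, of x] by (simp_all add: powr_add[symmetric] powr_power)
      have young: "- (2 * u * v) \<le> \<beta> * u^2 + (1 / \<beta>) * v^2" for u v :: real
      proof -
        have "0 \<le> (1 / \<beta>) * (\<beta> * u + v)^2" using \<beta> by simp
        also have "\<dots> = \<beta> * u^2 + (1 / \<beta>) * v^2 + 2 * u * v" using \<beta> by (simp add: power2_eq_square field_simps)
        finally show ?thesis by simp
      qed
      have "- (\<beta> * (\<beta> - 1)) * (M (x, t) powr (\<beta> - 1) * (\<Sum>j\<in>UNIV. b j (x, t) * dx j M (x, t)))
          = (\<beta> - 1) * (\<Sum>j\<in>UNIV. - (2 * (?f * b j (x, t)) * ?D j x))"
      proof -
        have "- (2 * (?f * b j (x, t)) * ?D j x) = - \<beta> * (M (x, t) powr (\<beta> - 1) * (b j (x, t) * dx j M (x, t)))" for j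
          unfolding pM(1) by simp
        then have "(\<Sum>j\<in>UNIV. - (2 * (?f * b j (x, t)) * ?D j x)) = - \<beta> * (M (x, t) powr (\<beta> - 1) * (\<Sum>j\<in>UNIV. b j (x, t) * dx j M (x, t)))"
          by (simp only: sum_distrib_left)
        then show ?thesis by (simp only:) (simp add: algebra_simps)
      qed
      also have "\<dots> \<le> (\<beta> - 1) * (\<Sum>j\<in>UNIV. \<beta> * (?f * b j (x, t))^2 + (1 / \<beta>) * (?D j x)^2)"
        using \<beta> by (intro mult_left_mono sum_mono young) auto
      also have "\<dots> = (\<beta> - 1) * (\<beta> * (M (x, t) powr \<beta> * (\<Sum>j\<in>UNIV. (b j (x, t))^2)) + (1 / \<beta>) * (\<Sum>j\<in>UNIV. (?D j x)^2))"
        unfolding power_mult_distrib[of ?f] pM sum.distrib sum_distrib_left[symmetric] ..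
      also have "\<dots> \<le> (\<beta> - 1) * (\<beta> * (M (x, t) powr \<beta> * (C2 * Rr)) + (1 / \<beta>) * (\<Sum>j\<in>UNIV. (?D j x)^2))"
        using \<beta> b2[OF t, of x] by (intro mult_left_mono add_right_mono) auto
      finally show "- (\<beta> * (\<beta> - 1)) * (M (x, t) powr (\<beta> - 1) * (\<Sum>j\<in>UNIV. b j (x, t) * dx j M (x, t)))
          \<le> (\<beta> * (\<beta> - 1) * (C2 * Rr)) * M (x, t) powr \<beta> + (\<beta> - 1) / \<beta> * (\<Sum>j\<in>UNIV. (?D j x)\<^sup>2)"
        by (simp add: algebra_simps)
    qed (intro cper_M_intros t)+
    also have "\<dots> = (\<beta> * (\<beta> - 1) * (C2 * Rr)) * X \<beta> t + (\<beta> - 1) / \<beta> * Y \<beta> t"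
      unfolding X_def Y_def tint_cmult[symmetric] by (intro tint_add cper_M_intros t)
    finally have "X' \<beta> t \<le> \<beta> * (\<beta> - 1) * C2 * Rr * X \<beta> t - c * Y \<beta> t"
    proof -
      assume le: "- (\<beta> * (\<beta> - 1)) * tint (\<lambda>x. M (x, t) powr (\<beta> - 1) * (\<Sum>j\<in>UNIV. b j (x, t) * dx j M (x, t)))
        \<le> \<beta> * (\<beta> - 1) * (C2 * Rr) * X \<beta> t + (\<beta> - 1) / \<beta> * Y \<beta> t"
      have "4 * (\<beta> - 1) / \<beta> * Y \<beta> t = c * Y \<beta> t + (\<beta> - 1) / \<beta> * Y \<beta> t"
        using \<beta> by (simp add: c_def field_simps)
      with le show ?thesis unfolding X'_eq[OF t less_imp_le[OF \<beta>]] mult.assoc by linarith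
    qed
    moreover have "2 * c * X \<beta> t \<le> 2 * c * Rr * X \<beta> t"
      using c Rr X_pos[OF t, of \<beta>] by (simp add: mult_le_cancel_right1)
    ultimately show ?thesis using abs by (simp add: algebra_simps)
  qed
  have "0 < X \<beta> 0" using T_pos by (intro X_pos) simp
  then show ?thesis
    using Gronwall_damped[OF X_has_derivative le c _ t] K by simp
qed

text \<open>The outer mollification is removed with exponent \<open>p\<close>, the inner one with
  \<open>\<beta> = \<alpha> * p\<close>, and both preserve integrals; hence the two conditions that
  these exponents be at least 1.\<close>

lemma g_eps_norm_bound:
  assumes t: "t \<in> {0..T}" and p: "1 \<le> p" and \<beta>: "\<beta> = \<alpha> * p" "1 \<le> \<beta>"
  shows "tint (\<lambda>x. \<bar>g_eps \<eta> \<alpha> \<epsilon> (\<lambda>y. m y t) x\<bar> powr p) \<le> X \<beta> t"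
proof -
  define z where "z = ker.conv (\<lambda>x. M (x, t))"
  have M: "cper (\<lambda>x. M (x, t))" "\<And>x. 0 < M (x, t)" using M_pos[OF t] by (auto intro: cper_M_intros)
  have z: "cper z" "\<And>x. 0 < z x" unfolding z_def by (auto intro!: ker.cper_conv ker.conv_pos M)
  have nz: "z x \<noteq> 0" for x using z(2)[of x] by simp
  have za: "cper (\<lambda>x. z x powr \<gamma>)" "0 < z x powr \<gamma>" for \<gamma> x by (auto intro!: cper_powr z simp: nz)
  have G: "g_eps \<eta> \<alpha> \<epsilon> (\<lambda>y. m y t) x = ker.conv (\<lambda>y. z y powr \<alpha>) x" for x
    by (simp add: g_eps_def moll_eq m_slice z_def)
  have Gpos: "0 < ker.conv (\<lambda>y. z y powr \<alpha>) x" for x by (intro ker.conv_pos za)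
  have "tint (\<lambda>x. \<bar>g_eps \<eta> \<alpha> \<epsilon> (\<lambda>y. m y t) x\<bar> powr p) = tint (\<lambda>x. ker.conv (\<lambda>y. z y powr \<alpha>) x powr p)"
    unfolding G using Gpos by (simp add: less_imp_le)
  also have "\<dots> \<le> tint (ker.conv (\<lambda>x. (z x powr \<alpha>) powr p))"
    by (intro tint_mono cper_powr ker.cper_conv Gpos z za ker.conv_Jensen p)
  also have "\<dots> = tint (\<lambda>x. z x powr \<beta>)"
    unfolding powr_powr \<beta>(1)[symmetric] by (rule ker.tint_conv[OF za(1)])
  also have "\<dots> \<le> tint (ker.conv (\<lambda>x. M (x, t) powr \<beta>))"
    unfolding z_def
    by (intro tint_mono cper_powr ker.cper_conv ker.conv_pos cper_M_powr t M ker.conv_Jensen \<beta>(2))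
  also have "\<dots> = X \<beta> t" unfolding X_def by (rule ker.tint_conv[OF cper_M_powr[OF t]])
  finally show ?thesis .
qed

end

section \<open>Explicit energy constants, the gradient norm and the drift\<close>

lemma one_add_powr_le:
  fixes y e :: real
  assumes "0 \<le> y" "0 \<le> e"
  shows "(1 + y) powr e \<le> 2 powr e * (1 + y powr e)"
proof (cases "y \<le> 1")
  case True
  then have "(1 + y) powr e \<le> 2 powr e * 1" using assms by (simp add: powr_mono2)
  also have "\<dots> \<le> 2 powr e * (1 + y powr e)" by (intro mult_left_mono) auto
  finally show ?thesis .
next
  case False
  then have "(1 + y) powr e \<le> (2 * y) powr e" using assms by (intro powr_mono2) auto
  also have "\<dots> = 2 powr e * y powr e" using assms by (simp add: powr_mult)
  also have "\<dots> \<le> 2 powr e * (1 + y powr e)" by (intro mult_left_mono) auto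
  finally show ?thesis .
qed

lemma cper_smooth: "smooth_fun f \<Longrightarrow> periodic f \<Longrightarrow> cper f"
  by (simp add: cper_def smooth_fun_continuous_on)

lemma periodic_dd: "periodic f \<Longrightarrow> periodic (dd f v)"
  unfolding periodic_def by (intro allI dd_periodic) blast

lemma smooth_lap: "smooth_fun f \<Longrightarrow> smooth_fun (lap f)"
  unfolding lap_def[abs_def] by (intro smooth_fun_sum smooth_fun_dd axis_Basis)

lemma periodic_lap:
  assumes "periodic f"
  shows "periodic (lap f)"
proof -
  have "periodic (dd (dd f (axis i 1)) (axis i 1))" for i by (intro periodic_dd assms)
  then show ?thesis unfolding lap_def periodic_def by (auto intro!: sum.cong)
qed

text \<open>Superlinearity is used with slope \<open>S / \<kappa>\<close>, where \<open>S\<close>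
  bounds the sum of the absolute partial derivatives of \<open>w\<close>; the positive lower bound
  of the weight carries the estimate from \<open>H\<close> to \<open>H * w\<close>.\<close>

lemma weighted_Hamiltonian_lower_bound:
  fixes H :: "real^'d \<Rightarrow> real^'d \<Rightarrow> real"
  assumes super: "\<And>K. 0 < K \<Longrightarrow> \<exists>C. \<forall>x p. K * norm p \<le> H x p + C" and H: "\<And>x p. 0 \<le> H x p"
    and w: "smooth_fun w" "periodic w" "\<And>x. \<kappa> \<le> w x" and \<kappa>: "0 < \<kappa>"
  shows "\<exists>C. \<forall>x p. - C \<le> H x p * w x + (\<Sum>i\<in>UNIV. p $ i * dd w (axis i 1) x)"
proof -
  have "\<exists>L. 0 < L \<and> (\<forall>x. \<bar>dd w (axis i 1) x\<bar> \<le> L)" for i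
    using cper_bounded[OF cper_smooth[OF smooth_fun_dd[OF w(1) axis_Basis] periodic_dd[OF w(2)]], of i] by metis
  then obtain L where L: "\<And>i. 0 < L i" "\<And>i x. \<bar>dd w (axis i 1) x\<bar> \<le> L i" by metis
  define S where "S = (\<Sum>i\<in>UNIV. L i)"
  have S: "0 < S" unfolding S_def using L by (intro sum_pos) auto
  obtain C where C: "\<And>x p. (S / \<kappa>) * norm p \<le> H x p + C" using super[of "S / \<kappa>"] S \<kappa> by auto
  have "- (\<kappa> * C) \<le> H x p * w x + (\<Sum>i\<in>UNIV. p $ i * dd w (axis i 1) x)" for x p
  proof -
    have "\<bar>\<Sum>i\<in>UNIV. p $ i * dd w (axis i 1) x\<bar> \<le> (\<Sum>i\<in>UNIV. norm p * L i)"
      unfolding abs_mult[symmetric]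
    proof (rule order_trans[OF sum_abs], rule sum_mono)
      fix i show "\<bar>p $ i * dd w (axis i 1) x\<bar> \<le> norm p * L i"
        unfolding abs_mult using L(2)[of i x] component_le_norm_cart[of p i] by (intro mult_mono) auto
    qed
    also have "\<dots> = norm p * S" unfolding S_def sum_distrib_left ..
    also have "\<dots> = \<kappa> * ((S / \<kappa>) * norm p)" using \<kappa> by (simp add: mult.commute)
    also have "\<dots> \<le> \<kappa> * (H x p + C)" using \<kappa> by (intro mult_left_mono C) auto
    also have "\<dots> \<le> H x p * w x + \<kappa> * C"
      using mult_left_mono[OF w(3)[of x] H[of x p]] by (simp add: algebra_simps)
    finally show ?thesis by (simp add: abs_le_iff)
  qed
  then show ?thesis by blast
qed

context mfg_solution
begin

text \<open>The initial value of the second order identity is the pairing of \<open>u(0)\<close> with \<open>\<Delta>m\<^sub>0\<close>, which has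
  no sign; \<open>w = k1 m\<^sub>0 - \<Delta>m\<^sub>0\<close> is bounded below by a positive constant, so that the one-sided bound
  of \<open>tint_U0_upper\<close> applies to it.\<close>
lemma energy_bound:
  assumes A3: "\<And>x p. c * H x p - C \<le> Lhat H x p" and c: "0 < c" and H1: "\<And>x p. 1 \<le> H x p"
    and B: "\<And>x. \<bar>uT x\<bar> \<le> B" and K: "\<And>x. m0 x \<le> K" "0 < K"
    and Cw: "\<And>x p. - Cw \<le> H x p * m0 x + (\<Sum>i\<in>UNIV. p $ i * dd m0 (axis i 1) x)"
    and RQ: "\<And>z. Q z / 2 - C6 * Hc z \<le> R z + Q z" and Q: "\<And>z. 0 \<le> Q z"
    and B2: "\<And>x. \<bar>lap uT x\<bar> \<le> B2"
    and w: "smooth_fun w" "periodic w" "\<And>x. w x = k1 * m0 x - lap m0 x" and k1: "0 \<le> k1"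
    and K2: "\<And>x. w x \<le> K2" "0 < K2"
    and Cw2: "\<And>x p. - Cw2 \<le> H x p * w x + (\<Sum>i\<in>UNIV. p $ i * dd w (axis i 1) x)"
    and B3: "\<And>x. uT x * w x \<le> B3"
    and E1: "E1 = B * K + B + T * (Cw + K * (2 * K) powr \<alpha> + C)"
  shows "J Hc + J Q \<le> E1 / c + 2 * (\<bar>C6\<bar> * (E1 / c) + B2 + B3 + T * (Cw2 + K2 * (2 * K2) powr \<alpha>) + E1 + k1 * (B + C * T))"
proof -
  have Hc: "1 \<le> Hc z" for z unfolding Hc_eq by (rule H1)
  have Hc0: "0 \<le> Hc z" for z using Hc[of z] by simp
  have Lh: "c * Hc z - C \<le> Lh z" for z unfolding Hc_eq Lh_eq by (rule A3)
  note first = first_order_estimate[OF Lh B less_imp_le[OF c] Hc0 K Cw]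
  have JH: "0 \<le> J Hc"
    by (intro integral_nonneg J_integrable stp_sol tint_nonneg cper_sol mult_nonneg_nonneg less_imp_le[OF M_pos] Hc0) auto
  have cJ: "c * J Hc \<le> E1" and JG: "J G / 2 \<le> E1"
    using first(1) J_G_nonneg mult_nonneg_nonneg[OF less_imp_le[OF c] JH] unfolding E1 by linarith+
  have JHE: "J Hc \<le> E1 / c" using cJ c by (simp add: pos_le_divide_eq mult.commute)
  have "C6 * J Hc \<le> \<bar>C6\<bar> * (E1 / c)"
    using JH JHE by (intro order_trans[OF mult_right_mono[OF abs_ge_self JH] mult_left_mono]) auto
  moreover have "J Q / 2 \<le> C6 * J Hc + B2 - tint (\<lambda>x. U (x, 0) * lap m0 x)"
    by (rule second_order_estimate[OF RQ B2])
  \<comment> \<open>Since \<open>- lap m0 = w - k1 * m0\<close>, the pairing with \<open>w\<close>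
    is needed from above and the pairing with \<open>m0\<close> from below; both are at
    hand.\<close>
  moreover have "tint (\<lambda>x. U (x, 0) * w x) = k1 * tint (\<lambda>x. U (x, 0) * m0 x) - tint (\<lambda>x. U (x, 0) * lap m0 x)"
  proof -
    have c: "cper (\<lambda>x. U (x, 0) * m0 x)" "cper (\<lambda>x. U (x, 0) * lap m0 x)"
      by (intro cper_mult stp_cper[OF stp_U] cper_smooth smooth_lap periodic_lap m0_smooth)+
    have "tint (\<lambda>x. U (x, 0) * w x) = tint (\<lambda>x. k1 * (U (x, 0) * m0 x) - U (x, 0) * lap m0 x)"
      by (simp add: w(3) algebra_simps)
    also have "\<dots> = tint (\<lambda>x. k1 * (U (x, 0) * m0 x)) - tint (\<lambda>x. U (x, 0) * lap m0 x)"
      by (intro tint_diff cper_mult[OF cper_const] c)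
    finally show ?thesis by (simp only: tint_cmult)
  qed
  moreover have "tint (\<lambda>x. U (x, 0) * w x) \<le> B3 + T * (Cw2 + K2 * (2 * K2) powr \<alpha>) + J G / 2"
    by (rule tint_U0_upper[OF w(1,2) K2 Cw2 B3])
  moreover have "- (k1 * (B + C * T)) \<le> k1 * tint (\<lambda>x. U (x, 0) * m0 x)"
    using mult_left_mono[OF first(2) k1] by (simp add: algebra_simps)
  ultimately have "J Q / 2 \<le> \<bar>C6\<bar> * (E1 / c) + B2 + B3 + T * (Cw2 + K2 * (2 * K2) powr \<alpha>) + E1 + k1 * (B + C * T)"
    using JG by linarith
  moreover have "a + q \<le> x + 2 * y" if "a \<le> x" "q / 2 \<le> y" for a q x y :: real using that by linarith
  ultimately show ?thesis using JHE by blast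
qed

text \<open>Boundedness of the set, from periodicity and compactness of \<open>[0,T]\<close>, is
  what makes this \<open>Sup\<close> a genuine least upper bound.\<close>

lemma Du_le_Sup:
  assumes "t \<in> {0..T}"
  shows "norm (Du U (x, t)) \<le> Sup {norm (grad (\<lambda>y. u y s) x) | x s. s \<in> {0..T}}"
proof (rule cSup_upper)
  show "norm (Du U (x, t)) \<in> {norm (grad (\<lambda>y. u y s) x) | x s. s \<in> {0..T}}"
    using assms by (auto simp: Du_eq)
  have "\<exists>L. \<forall>x t. t \<in> {0..T} \<longrightarrow> \<bar>dx i U (x, t)\<bar> \<le> L" for i
    using stp_bounded[OF stp_dx[OF stp_U], of T i] by metis
  then obtain L where L: "\<And>i x t. t \<in> {0..T} \<Longrightarrow> \<bar>dx i U (x, t)\<bar> \<le> L i" by metis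
  show "bdd_above {norm (grad (\<lambda>y. u y s) x) | x s. s \<in> {0..T}}"
  proof (rule bdd_aboveI[of _ "\<Sum>i\<in>UNIV. L i"])
    fix y assume "y \<in> {norm (grad (\<lambda>y. u y s) x) | x s. s \<in> {0..T}}"
    then obtain x s where y: "y = norm (Du U (x, s))" and s: "s \<in> {0..T}" by (auto simp: Du_eq)
    have "norm (Du U (x, s)) \<le> (\<Sum>i\<in>UNIV. \<bar>Du U (x, s) $ i\<bar>)" by (rule norm_le_l1_cart)
    also have "\<dots> \<le> (\<Sum>i\<in>UNIV. L i)" using L[OF s] by (intro sum_mono) (simp add: Du_def)
    finally show "y \<le> (\<Sum>i\<in>UNIV. L i)" by (simp add: y)
  qed
qed

text \<open>(A8) and the upper bound in (A7) multiply to
  \<open>n powr \<mu> * n powr (2 + \<mu>) = n powr (2 + 2 * \<mu>)\<close>; the lower powers are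
  swallowed by the added 1.\<close>

lemma drift_bound:
  assumes A8: "\<And>x p. (norm (DpH H x p))\<^sup>2 \<le> C8 * norm p powr \<mu> * H x p + C8"
    and A7: "\<And>x p. H x p \<le> c2 * norm p powr (2 + \<mu>) + C2" and nn: "0 \<le> c2" "0 \<le> C2" "0 < \<mu>"
    and H1: "\<And>x p. 1 \<le> H x p" and N: "norm (Du U (x, t)) \<le> N"
  shows "(\<Sum>j\<in>UNIV. (b j (x, t))\<^sup>2) \<le> (\<bar>C8\<bar> * (c2 + C2 + 1)) * (N powr (2 + 2 * \<mu>) + 1)"
proof -
  let ?p = "Du U (x, t)"
  define n where "n = norm ?p"
  have n: "0 \<le> n" "n \<le> N" using N by (auto simp: n_def)
  have "(\<Sum>j\<in>UNIV. (b j (x, t))\<^sup>2) = (norm (DpH H x ?p))\<^sup>2"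
    by (simp only: power2_norm_eq_inner inner_vec_def b_eq) (simp add: power2_eq_square)
  also have "\<dots> \<le> C8 * n powr \<mu> * H x ?p + C8" unfolding n_def by (rule A8)
  also have "\<dots> = C8 * (n powr \<mu> * H x ?p + 1)" by (simp add: algebra_simps)
  also have "\<dots> \<le> \<bar>C8\<bar> * (n powr \<mu> * H x ?p + 1)"
    using H1[of x ?p] by (intro mult_right_mono) auto
  also have "\<dots> \<le> \<bar>C8\<bar> * (n powr \<mu> * (c2 * n powr (2 + \<mu>) + C2) + 1)"
    using A7[of x ?p] by (intro mult_left_mono add_right_mono) (auto simp: n_def)
  also have "n powr \<mu> * (c2 * n powr (2 + \<mu>) + C2) = c2 * n powr (2 + 2 * \<mu>) + C2 * n powr \<mu>"
    by (simp add: algebra_simps powr_add[symmetric])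
  also have "\<bar>C8\<bar> * (c2 * n powr (2 + 2 * \<mu>) + C2 * n powr \<mu> + 1) \<le>
      \<bar>C8\<bar> * (c2 * (N powr (2 + 2 * \<mu>) + 1) + C2 * (N powr (2 + 2 * \<mu>) + 1) + (N powr (2 + 2 * \<mu>) + 1))"
  proof -
    have a: "n powr (2 + 2 * \<mu>) \<le> N powr (2 + 2 * \<mu>)" using n nn by (intro powr_mono2) auto
    have b: "n powr \<mu> \<le> N powr (2 + 2 * \<mu>) + 1"
    proof (cases "n \<le> 1")
      case True
      then have "n powr \<mu> \<le> 1" using n nn by (intro powr_le1) auto
      then show ?thesis by (simp add: add_increasing)
    next
      case False
      then have "n powr \<mu> \<le> n powr (2 + 2 * \<mu>)" using nn by (intro powr_mono) auto
      with a show ?thesis by linarith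
    qed
    show ?thesis using a b nn by (intro mult_left_mono add_mono) auto
  qed
  also have "\<dots> = (\<bar>C8\<bar> * (c2 + C2 + 1)) * (N powr (2 + 2 * \<mu>) + 1)" by (simp add: algebra_simps)
  finally show ?thesis .
qed

end

theorem theorem2:
  fixes H :: "real^'d \<Rightarrow> real^'d \<Rightarrow> real"
    and uT m0 \<eta> :: "real^'d \<Rightarrow> real"
    and T \<alpha> \<mu> \<kappa>0 \<theta> \<upsilon> \<beta>0 :: real
  assumes T_pos: "T > 0"
    and mollifier: "mollifier \<eta>"
    \<comment> \<open>(A1)\<close>
    and A1_smooth: "smooth_fun (\<lambda>z::(real^'d) \<times> (real^'d). H (fst z) (snd z))"
    and A1_periodic: "\<forall>p. periodic (\<lambda>x. H x p)"
    and A1_convex: "\<forall>x. strict_convex_fun (H x)"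
    and A1_superlinear: "\<forall>x. filterlim (\<lambda>p. H x p / norm p) at_top at_infinity"
    and A1_ge1: "\<forall>x p. H x p \<ge> 1"
    \<comment> \<open>(A2), with g(z) = z powr alpha by (A4)\<close>
    and A2_uT: "smooth_fun uT" "periodic uT"
    and A2_m0: "smooth_fun m0" "periodic m0" "\<forall>x. m0 x \<ge> 0"
      "integral torus_cell m0 = 1"
    \<comment> \<open>(A3)\<close>
    and A3: "\<exists>c C. c > 0 \<and> C > 0 \<and> (\<forall>x p. Lhat H x p \<ge> c * H x p - C)"
    \<comment> \<open>(A4)\<close>
    and A4: "\<alpha> > 0"
    \<comment> \<open>(A5)\<close>
    and A5a: "\<exists>C. \<forall>x p. norm (DxH H x p) \<le> C * H x p + C \<and> norm (D2xxH H x p) \<le> C * H x p + C"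
    and A5b: "\<forall>\<delta>>0. \<exists>C\<delta>. \<forall>M x p. symmetric_mat M \<longrightarrow>
                 trace (D2pxH H x p ** M) \<le> \<delta> * trace (D2ppH H x p ** (M ** M)) + C\<delta> * H x p"
    \<comment> \<open>(A6)\<close>
    and A6: "\<kappa>0 > 0" "\<forall>x. m0 x \<ge> \<kappa>0"
    \<comment> \<open>(A7)\<close>
    and A7: "0 < \<mu>" "\<mu> < 1"
      "\<exists>c1 c2 C1 C2. c1 \<ge> 0 \<and> c2 \<ge> 0 \<and> C1 \<ge> 0 \<and> C2 \<ge> 0 \<and>
         (\<forall>x p. c1 * norm p powr (2 + \<mu>) + C1 \<le> H x p \<and> H x p \<le> c2 * norm p powr (2 + \<mu>) + C2)"
    \<comment> \<open>(A8)\<close>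
    and A8: "\<exists>C. \<forall>x p. (norm (DpH H x p))\<^sup>2 \<le> C * norm p powr \<mu> * H x p + C"
    \<comment> \<open>(A9)\<close>
    and A9a: "\<exists>C. \<forall>x p. (norm (D2xpH H x p))\<^sup>2 \<le> C * H x p powr ((2 + 2 * \<mu>) / (2 + \<mu>))"
    and A9b: "\<exists>C. \<forall>M x p. symmetric_mat M \<longrightarrow>
                 (norm (D2ppH H x p ** M))\<^sup>2 \<le> C * H x p powr (\<mu> / (2 + \<mu>)) * trace (D2ppH H x p ** M ** M)"
    \<comment> \<open>parameters\<close>
    and \<theta>: "\<theta> > 1"
    and \<upsilon>: "0 \<le> \<upsilon>" "\<upsilon> \<le> 1"
    and \<beta>0: "1 \<le> \<beta>0" "\<beta>0 < real CARD('d) * (1 + \<mu>) / (real CARD('d) * (1 + \<mu>) - 2)"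
    and p_gt1: "\<theta> * \<beta>0 / (\<theta> + \<upsilon> - \<theta> * \<upsilon>) / \<alpha> > 1"
  shows "\<exists>C. \<forall>\<epsilon>>0. \<forall>u m. reg_solution H \<eta> \<alpha> T \<epsilon> uT m0 u m \<longrightarrow>
           (\<forall>t\<in>{0..T}.
              (integral torus_cell (\<lambda>x. \<bar>g_eps \<eta> \<alpha> \<epsilon> (\<lambda>y. m y t) x\<bar>
                   powr (\<theta> * \<beta>0 / (\<theta> + \<upsilon> - \<theta> * \<upsilon>) / \<alpha>)))
                 powr (1 / (\<theta> * \<beta>0 / (\<theta> + \<upsilon> - \<theta> * \<upsilon>) / \<alpha>))
              \<le> C + C * (Sup {norm (grad (\<lambda>y. u y s) x) | x s. s \<in> {0..T}})
                       powr ((2 + 2 * \<mu>) * ((real CARD('d) * (\<theta> - 1) + 2) / 2) * \<upsilon> * \<alpha>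
                              / (\<theta> * \<beta>0)))"
proof -
  define N where "N = real CARD('d)"
  \<comment> \<open>For \<open>d = 1\<close> the upper bound on \<open>\<beta>0\<close> is negative.\<close>
  have card: "2 \<le> CARD('d)"
  proof (rule ccontr)
    assume "\<not> 2 \<le> CARD('d)"
    moreover have "0 < CARD('d)" by simp
    ultimately have "CARD('d) = 1" by linarith
    then have "1 < (1 + \<mu>) / (\<mu> - 1)" using \<beta>0 by simp
    then show False using A7(1,2) by (simp add: less_divide_eq)
  qed
  then have N: "2 \<le> N" by (simp add: N_def)
  have H1: "1 \<le> H x p" for x p using A1_ge1 by blast
  have H0: "0 \<le> H x p" for x p using H1[of x p] by simp
  obtain c3 C3 where A3': "0 < c3" "\<And>x p. c3 * H x p - C3 \<le> Lhat H x p" using A3 by blast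
  obtain C5 where A5a': "\<And>x p. norm (D2xxH H x p) \<le> C5 * H x p + C5" using A5a by blast
  obtain C5' where A5b': "\<And>M x p. symmetric_mat M \<Longrightarrow>
      trace (D2pxH H x p ** M) \<le> (1/4) * trace (D2ppH H x p ** (M ** M)) + C5' * H x p"
    using A5b[rule_format, of "1/4"] by auto
  obtain c2 C2 where A7': "0 \<le> c2" "0 \<le> C2" "\<And>x p. H x p \<le> c2 * norm p powr (2 + \<mu>) + C2" using A7(3) by blast
  obtain C8 where A8': "\<And>x p. (norm (DpH H x p))\<^sup>2 \<le> C8 * norm p powr \<mu> * H x p + C8" using A8 by blast
  obtain C9 where A9a': "\<And>x p. (norm (D2xpH H x p))\<^sup>2 \<le> C9 * H x p powr ((2 + 2 * \<mu>) / (2 + \<mu>))" using A9a by blast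
  obtain C9' where A9b': "\<And>M x p. symmetric_mat M \<Longrightarrow>
      (norm (D2ppH H x p ** M))\<^sup>2 \<le> C9' * H x p powr (\<mu> / (2 + \<mu>)) * trace (D2ppH H x p ** M ** M)"
    using A9b by blast
  have super: "\<exists>C. \<forall>x p. K * norm p \<le> H x p + C" if "0 < K" for K
  proof (rule uniform_superlinear[OF _ _ _ _ _ H0 that])
    show "H x 0 \<le> C2" for x using A7'(3)[of x 0] by simp
  qed (use A1_smooth A1_periodic A1_convex A1_superlinear in \<open>auto intro: smooth_fun_continuous_on\<close>)
  have c_uT: "cper uT" and c_m0: "cper m0" by (intro cper_smooth A2_uT A2_m0)+
  obtain B where B: "\<And>x. \<bar>uT x\<bar> \<le> B" using cper_bounded[OF c_uT] by blast
  obtain K where K: "0 < K" "\<And>x. m0 x \<le> K" using cper_bounded[OF c_m0] by (metis abs_le_D1)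
  obtain B2 where B2: "\<And>x. \<bar>lap uT x\<bar> \<le> B2"
    using cper_bounded[OF cper_smooth[OF smooth_lap periodic_lap]] A2_uT by metis
  obtain L where L: "0 < L" "\<And>x. \<bar>lap m0 x\<bar> \<le> L"
    using cper_bounded[OF cper_smooth[OF smooth_lap periodic_lap]] A2_m0 by metis
  \<comment> \<open>Gives \<open>k1 * \<kappa>0 = L + 1\<close>, hence
    \<open>w \<ge> 1\<close>.\<close>
  define k1 where "k1 = (L + 1) / \<kappa>0"
  define w where "w x = k1 * m0 x - lap m0 x" for x
  have w: "smooth_fun w" "periodic w"
    unfolding w_def[abs_def] using periodic_lap[OF A2_m0(2)] A2_m0(2)
    by (auto intro!: smooth_fun_intros smooth_lap A2_m0 simp: periodic_def)
  have k1: "0 \<le> k1" using L A6 by (simp add: k1_def)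
  have w1: "1 \<le> w x" for x
  proof -
    have "L + 1 = k1 * \<kappa>0" using A6 by (simp add: k1_def)
    also have "\<dots> \<le> k1 * m0 x" using A6 k1 by (intro mult_left_mono) auto
    finally show ?thesis using L(2)[of x] by (simp add: w_def)
  qed
  have c_w: "cper w" by (intro cper_smooth w)
  obtain K2 where K2: "0 < K2" "\<And>x. w x \<le> K2" using cper_bounded[OF c_w] by (metis abs_le_D1)
  obtain B3 where B3: "\<And>x. uT x * w x \<le> B3" using cper_bounded[OF cper_mult[OF c_uT c_w]] by (metis abs_le_D1)
  obtain Cw where Cw: "\<And>x p. - Cw \<le> H x p * m0 x + (\<Sum>i\<in>UNIV. p $ i * dd m0 (axis i 1) x)"
    using weighted_Hamiltonian_lower_bound[OF super H0 A2_m0(1,2), of \<kappa>0] A6 by blast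
  obtain Cw2 where Cw2: "\<And>x p. - Cw2 \<le> H x p * w x + (\<Sum>i\<in>UNIV. p $ i * dd w (axis i 1) x)"
    using weighted_Hamiltonian_lower_bound[OF super H0 w w1] by auto
  define E1 where "E1 = B * K + B + T * (Cw + K * (2 * K) powr \<alpha> + C3)"
  define C6 where "C6 = 2 * real CARD('d) * \<bar>C5\<bar> + 2 * C5'"
  define E where "E = E1 / c3 + 2 * (\<bar>C6\<bar> * (E1 / c3) + B2 + B3 + T * (Cw2 + K2 * (2 * K2) powr \<alpha>) + E1 + k1 * (B + C3 * T))"
  define Cd where "Cd = N * (sqrt \<bar>C9\<bar> + sqrt \<bar>C9'\<bar>)"
  have Cd: "0 \<le> Cd" using N by (simp add: Cd_def)
  define \<sigma> where "\<sigma> = N * (1 + \<mu>) * (\<beta>0 - 1) / (2 * \<beta>0)"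
  have \<sigma>: "0 \<le> \<sigma>" "\<sigma> \<le> 1"
  proof -
    have "2 * (1 + \<mu>) \<le> N * (1 + \<mu>)" using N A7 by (intro mult_right_mono) auto
    then have "N * (1 + \<mu>) - 2 > 0" using A7 by simp
    then have "\<beta>0 * (N * (1 + \<mu>) - 2) < N * (1 + \<mu>)" using \<beta>0(2) by (simp add: less_divide_eq N_def)
    then have "N * (1 + \<mu>) * (\<beta>0 - 1) \<le> 2 * \<beta>0" by (simp add: algebra_simps)
    then show "\<sigma> \<le> 1" "0 \<le> \<sigma>" using \<beta>0 N A7 by (auto simp: \<sigma>_def divide_le_eq)
  qed
  obtain Kb where Kb: "0 < Kb" and absorb_b: "\<And>A X Y Z V W. 0 < A \<Longrightarrow> 0 < X \<Longrightarrow> 0 \<le> Y \<Longrightarrow> 0 < Z \<Longrightarrow> 0 < V \<Longrightarrow>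
      Z \<le> 18 * X powr (2 / N) * (X + Y) \<Longrightarrow> V \<le> X powr (1 - \<sigma>) * Z powr \<sigma> \<Longrightarrow>
      W \<le> A powr ((1 + \<mu>) / (2 + \<mu>)) * V powr (1 / (2 + \<mu>)) \<Longrightarrow>
      (\<beta>0 - 1) * Cd * W \<le> 4 * (\<beta>0 - 1) / \<beta>0 * Y + Kb * (A + 1) * (X + 1)"
    using base_absorb[OF N A7(1) \<beta>0(1) _ Cd] \<beta>0(2) unfolding N_def[symmetric] \<sigma>_def[symmetric] by metis
  \<comment> \<open>The bound of \<open>base_norm_bound\<close> with \<open>m0\<close> inserted for
    the density at time 0, so that the solution no longer appears in it.\<close>
  define P0 where "P0 = (tint (\<lambda>x. m0 x powr \<beta>0) + 1) * exp (Kb * (E + T))"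
  have P0: "0 < P0"
  proof -
    have "0 \<le> tint (\<lambda>x. m0 x powr \<beta>0)" using A6 by (intro tint_nonneg cper_powr c_m0) (auto intro: less_le_trans)
    then show ?thesis unfolding P0_def by (intro mult_pos_pos) auto
  qed
  define \<beta>1 where "\<beta>1 = \<theta> * \<beta>0"
  define c where "c = 3 * (\<beta>1 - 1) / \<beta>1"
  define Cb where "Cb = \<bar>C8\<bar> * (c2 + C2 + 1)"
  have "1 * 1 < \<theta> * \<beta>0" using \<theta> \<beta>0 by (intro mult_less_le_imp_less) auto
  then have \<beta>1: "1 < \<beta>1" by (simp add: \<beta>1_def)
  have c: "0 < c" using \<beta>1 by (simp add: c_def)
  have Cb: "0 \<le> Cb" using A7' by (simp add: Cb_def)
  have c0: "0 \<le> \<beta>1 * (\<beta>1 - 1) * Cb + 2 * c" using \<beta>1 Cb c by simp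
  define r where "r = (N * (\<theta> - 1) + 2) / 2"
  define k where "k = (\<theta> - 1) / (\<theta> - 1 + 2 * \<theta> / N)"
  have r: "0 < r" using N \<theta> by (auto simp: r_def intro: add_pos_pos)
  obtain Ki where Ki: "0 < Ki" and absorb_i: "\<And>X Y Z P R. 0 < X \<Longrightarrow> 0 \<le> Y \<Longrightarrow> 0 < Z \<Longrightarrow> 0 < P \<Longrightarrow> P \<le> P0 \<Longrightarrow> 1 \<le> R \<Longrightarrow>
      Z \<le> 18 * X powr (2 / N) * (X + Y) \<Longrightarrow> X \<le> P powr (1 - k) * Z powr k \<Longrightarrow>
      (\<beta>1 * (\<beta>1 - 1) * Cb + 2 * c) * R * X \<le> c * (X + Y) + Ki * R powr r"
    using iteration_absorb[OF N \<theta> c0 c P0] unfolding k_def r_def by metis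
  define S1 where "S1 = tint (\<lambda>x. m0 x powr \<beta>1)"
  \<comment> \<open>The factor \<open>2 powr r\<close> comes from splitting the power
    \<open>r\<close> of \<open>1 + S powr (2 + 2 * \<mu>)\<close>; \<open>2 powr e\<close> in
    \<open>C\<close> arises in the same way.\<close>
  define D where "D = S1 + Ki / c * 2 powr r"
  have S1: "0 \<le> S1" unfolding S1_def using A6 by (intro tint_nonneg cper_powr c_m0) (auto intro: less_le_trans)
  have D: "0 < D" using S1 Ki c by (auto simp: D_def intro!: add_nonneg_pos)
  \<comment> \<open>\<upsilon> interpolates \<open>1 / \<beta>\<close> linearly between
    \<open>1 / \<beta>0\<close> and \<open>1 / \<beta>1\<close>. For the exponent itself, which is
    what integrals of powers need, the weight of \<open>\<beta>1\<close> becomes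
    \<open>w' = \<upsilon> / q\<close>.\<close>
  define q where "q = \<theta> + \<upsilon> - \<theta> * \<upsilon>"
  define \<beta> where "\<beta> = \<theta> * \<beta>0 / q"
  define w' where "w' = \<upsilon> / q"
  \<comment> \<open>Equals \<open>w' / p\<close>, the power of the bound for \<open>\<beta>1\<close>
    that is left after the \<open>p\<close>-th root.\<close>
  define e where "e = \<upsilon> * \<alpha> / (\<theta> * \<beta>0)"
  have q_eq: "q = 1 + (\<theta> - 1) * (1 - \<upsilon>)" by (simp add: q_def algebra_simps)
  have q: "1 \<le> q" "q \<le> \<theta>"
  proof -
    have "0 \<le> (\<theta> - 1) * (1 - \<upsilon>)" "(\<theta> - 1) * (1 - \<upsilon>) \<le> (\<theta> - 1) * 1"
      using \<theta> \<upsilon> by (auto intro!: mult_nonneg_nonneg mult_left_mono)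
    then show "1 \<le> q" "q \<le> \<theta>" unfolding q_eq by auto
  qed
  have w': "0 \<le> w'" "w' \<le> 1"
  proof -
    have "q - \<upsilon> = \<theta> * (1 - \<upsilon>)" by (simp add: q_def algebra_simps)
    then have "\<upsilon> \<le> q" using \<theta> \<upsilon> by (smt (verit) mult_nonneg_nonneg)
    then show "0 \<le> w'" "w' \<le> 1" using q \<upsilon> by (auto simp: w'_def)
  qed
  have \<beta>_eq: "\<beta> = w' * \<beta>1 + (1 - w') * \<beta>0"
  proof -
    have "\<upsilon> * (\<theta> * \<beta>0) + (q - \<upsilon>) * \<beta>0 = \<theta> * \<beta>0" by (simp add: q_def algebra_simps)
    then have "\<theta> * \<beta>0 / q = (\<upsilon> * (\<theta> * \<beta>0) + (q - \<upsilon>) * \<beta>0) / q" by simp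
    also have "\<dots> = w' * \<beta>1 + (1 - w') * \<beta>0" using q by (simp add: w'_def \<beta>1_def field_simps)
    finally show ?thesis by (simp add: \<beta>_def)
  qed
  have \<beta>: "1 \<le> \<beta>"
  proof -
    have "q * 1 \<le> \<theta> * \<beta>0" using q \<beta>0 by (intro mult_mono) auto
    then show ?thesis using q by (simp add: \<beta>_def le_divide_eq)
  qed
  define p where "p = \<beta> / \<alpha>"
  have p: "1 < p" using p_gt1 by (simp add: p_def \<beta>_def q_def)
  have we: "w' * (1 / p) = e" using q \<theta> \<beta>0 A4 by (simp add: w'_def p_def e_def \<beta>_def)
  have e: "0 \<le> e" using \<upsilon> A4 \<theta> \<beta>0 by (simp add: e_def)
  define C where "C = P0 powr ((1 - w') * (1 / p)) * (D powr e * 2 powr e)"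
  show ?thesis
  proof (intro exI[of _ C] allI impI ballI)
    fix \<epsilon> u m t
    assume "0 < \<epsilon>" and sol: "reg_solution H \<eta> \<alpha> T \<epsilon> uT m0 u m" and t: "t \<in> {0..T}"
    interpret mfg_solution H \<eta> uT m0 T \<alpha> \<kappa>0 \<epsilon> u m
      using \<open>0 < \<epsilon>\<close> sol T_pos mollifier A1_smooth A1_periodic A2_uT A2_m0 A4 A6 by unfold_locales auto
    define S where "S = Sup {norm (grad (\<lambda>y. u y s) x) | x s. s \<in> {0..T}}"
    have DuS: "norm (Du U (x, t)) \<le> S" if "t \<in> {0..T}" for x t
      unfolding S_def by (rule Du_le_Sup[OF that])
    have S: "0 \<le> S" using DuS[OF t, of 0] norm_ge_zero[of "Du U (0, t)"] by linarith
    have Q0: "0 \<le> Q z" for z by (rule Q_nonneg[OF A5b']) auto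
    have Hc1: "1 \<le> Hc z" for z unfolding Hc_eq by (rule H1)
    have energy: "J Hc + J Q \<le> E"
      unfolding E_def
      by (rule energy_bound[OF A3'(2,1) H1 B K(2,1) Cw RQ_lower[OF A5a' A5b' H1, folded C6_def] Q0 B2 w w_def k1 K2(2,1) Cw2 B3 E1_def])
    have divb: "\<bar>divb z\<bar> \<le> Cd * (Hc z + Q z) powr ((1 + \<mu>) / (2 + \<mu>))" for z
      unfolding Cd_def N_def by (rule divb_bound[OF A9a' A9b' H1 Q0 A7(1)])
    have base: "X \<beta>0 t \<le> P0" if "t \<in> {0..T}" for t
    proof -
      have "X \<beta>0 t \<le> (X \<beta>0 0 + 1) * exp (Kb * (E + T))"
        by (rule base_norm_bound[OF card A7(1) \<beta>0(1), folded N_def, folded \<sigma>_def, OF \<sigma> divb Cd Q0 Hc1 energy Kb absorb_b that])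
      then show ?thesis by (simp add: P0_def X_def initial)
    qed
    \<comment> \<open>The added 1 supplies the condition \<open>1 \<le> R\<close> of the absorption
      inequality.\<close>
    define Rr where "Rr = S powr (2 + 2 * \<mu>) + 1"
    have Rr: "1 \<le> Rr" by (simp add: Rr_def)
    have drift: "(\<Sum>j\<in>UNIV. (b j (x, t))\<^sup>2) \<le> Cb * Rr" if "t \<in> {0..T}" for x t
      unfolding Cb_def Rr_def by (rule drift_bound[OF A8' A7'(3,1,2) A7(1) H1 DuS[OF that]])
    have "X \<beta>1 t \<le> X \<beta>1 0 + Ki * Rr powr r / c"
    proof (rule iteration_norm_bound[of \<theta> \<beta>0 Cb Rr P0 Ki t, folded N_def \<beta>1_def, folded c_def k_def r_def])
    qed (rule card \<theta> \<beta>0(1) drift Cb Rr base Ki t absorb_i; assumption)+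
    also have "\<dots> = S1 + Ki / c * Rr powr r" by (simp add: X_def S1_def initial)
    also have "\<dots> \<le> S1 + Ki / c * (2 powr r * (1 + S powr ((2 + 2 * \<mu>) * r)))"
    proof (intro add_left_mono mult_left_mono)
      show "Rr powr r \<le> 2 powr r * (1 + S powr ((2 + 2 * \<mu>) * r))"
        using one_add_powr_le[of "S powr (2 + 2 * \<mu>)" r] r by (simp add: Rr_def powr_powr add.commute)
    qed (use Ki c in simp)
    also have "S1 + Ki / c * (2 powr r * (1 + S powr ((2 + 2 * \<mu>) * r))) \<le> D * (1 + S powr ((2 + 2 * \<mu>) * r))"
    proof -
      have "S1 * 1 \<le> S1 * (1 + S powr ((2 + 2 * \<mu>) * r))" using S1 by (intro mult_left_mono) auto
      then show ?thesis by (simp add: D_def distrib_right mult.assoc)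
    qed
    finally have iter: "X \<beta>1 t \<le> D * (1 + S powr ((2 + 2 * \<mu>) * r))" .
    have "tint (\<lambda>x. \<bar>g_eps \<eta> \<alpha> \<epsilon> (\<lambda>y. m y t) x\<bar> powr p) \<le> X \<beta> t"
      using p A4 \<beta> by (intro g_eps_norm_bound t) (auto simp: p_def)
    also have "\<dots> \<le> X \<beta>1 t powr w' * X \<beta>0 t powr (1 - w')" by (rule X_interpolation[OF t w' \<beta>_eq])
    also have "\<dots> \<le> (D * (1 + S powr ((2 + 2 * \<mu>) * r))) powr w' * P0 powr (1 - w')"
      using iter base[OF t] X_pos[OF t] w' by (intro mult_mono powr_mono2) (auto intro: less_imp_le)
    finally have "tint (\<lambda>x. \<bar>g_eps \<eta> \<alpha> \<epsilon> (\<lambda>y. m y t) x\<bar> powr p) powr (1 / p)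
        \<le> ((D * (1 + S powr ((2 + 2 * \<mu>) * r))) powr w' * P0 powr (1 - w')) powr (1 / p)"
    proof (rule powr_mono2[rotated 2])
      let ?f = "\<lambda>x. \<bar>g_eps \<eta> \<alpha> \<epsilon> (\<lambda>y. m y t) x\<bar> powr p"
      \<comment> \<open>The integral of a non-integrable function is 0 by convention, so both cases
        give nonnegativity.\<close>
      show "0 \<le> tint ?f"
        by (cases "?f integrable_on torus_cell") (auto intro: integral_nonneg simp: not_integrable_integral)
    qed (use p in auto)
    also have "\<dots> = P0 powr ((1 - w') * (1 / p)) * (D powr e * (1 + S powr ((2 + 2 * \<mu>) * r)) powr e)"
      using D P0 by (simp add: powr_mult powr_powr we[symmetric])
    also have "\<dots> \<le> P0 powr ((1 - w') * (1 / p)) * (D powr e * (2 powr e * (1 + S powr ((2 + 2 * \<mu>) * r * e))))"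
      using one_add_powr_le[of "S powr ((2 + 2 * \<mu>) * r)" e] e by (intro mult_left_mono) (auto simp: powr_powr)
    also have "\<dots> = C + C * S powr ((2 + 2 * \<mu>) * r * e)" by (simp add: C_def algebra_simps)
    finally show "(integral torus_cell (\<lambda>x. \<bar>g_eps \<eta> \<alpha> \<epsilon> (\<lambda>y. m y t) x\<bar>
                   powr (\<theta> * \<beta>0 / (\<theta> + \<upsilon> - \<theta> * \<upsilon>) / \<alpha>)))
                 powr (1 / (\<theta> * \<beta>0 / (\<theta> + \<upsilon> - \<theta> * \<upsilon>) / \<alpha>))
              \<le> C + C * (Sup {norm (grad (\<lambda>y. u y s) x) | x s. s \<in> {0..T}})
                       powr ((2 + 2 * \<mu>) * ((real CARD('d) * (\<theta> - 1) + 2) / 2) * \<upsilon> * \<alpha>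
                              / (\<theta> * \<beta>0))"
      unfolding S_def[symmetric] by (simp add: p_def \<beta>_def q_def e_def r_def N_def mult.assoc)
  qed
qed

end
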